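(* Let $B$ be a hyperelliptic curve of genus $\gamma\ge2$, let $q\in B$ be a Weierstrass point, let $[p-q]\in\Theta_1^0\subset\operatorname{Jac}(B)$, and let $(\epsilon_i)_{i\ge1}$ be the multiplication profile of $[p-q]$. Then: (1) $\epsilon_1=1$, and $0\le\epsilon_j\le\gamma$ for every $j$; (2) $\epsilon_i+\epsilon_j\ge\epsilon_{i+j}$ for all $i,j$; (3) $|\epsilon_j-\epsilon_{j+1}|\le1$ for every $j$, and if $\epsilon_j<\gamma$ then $\epsilon_j\ne\epsilon_{j+1}$; (4) there is no $j$ for which $\epsilon_{j+1}=\epsilon_j+1=\epsilon_{j+2}+1$, unless $\epsilon_j=\epsilon_2=0$; (5) the first index $N$ for which $\epsilon_N=0$ (if there is one) is either $N=2$ or else $N\ge2\gamma+1$, in which case $\epsilon_{sN+r}=\epsilon_r$ and $\epsilon_{N-r}=\epsilon_r$ for every $1\le r<N$ and $s\ge0$.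
   Context: Work over an algebraically closed field of characteristic zero. For $d\ge0$ let $\Theta_d\subset\operatorname{Jac}(B)$ be the image of $B^d\to\operatorname{Jac}(B)$, $(p_1,\dots,p_d)\mapsto[\sum p_i-dq]$ (so $\Theta_0=\{0\}$), and $\Theta_d^0=\Theta_d\setminus\Theta_{d-1}$ (with $\Theta_{-1}=\emptyset$). The multiplication profile of $x\in\operatorname{Jac}(B)$ is the sequence $(\epsilon_j)_{j\ge1}$ where $\epsilon_j$ is the unique integer with $jx\in\Theta^0_{\epsilon_j}$, $0\le \epsilon_j\le\gamma$. Thus $[p-q]\in\Theta_1^0$ means $p\ne q$. *)

theory Defs
  imports "HOL-Algebra.Free_Abelian_Groups" "HOL-Computational_Algebra.Polynomial"
begin

section \<open>Smooth projective curves as function fields of one variable\<close>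

text \<open>
  A smooth projective curve over an algebraically closed field \<open>k\<close> is given by its function
  field \<open>F\<close>, a finitely generated extension of \<open>k\<close> of transcendence degree one.  Its points are
  the discrete valuations of \<open>F\<close> that are trivial on \<open>k\<close> (the abstract nonsingular curve of
  Hartshorne, I.6).  The extension is a homomorphism \<open>\<iota>\<close> from the type of constants to the type
  of rational functions.
\<close>

definition transcendental_over :: "('k::field \<Rightarrow> 'f::field) \<Rightarrow> 'f \<Rightarrow> bool" where
  "transcendental_over \<iota> x \<longleftrightarrow> (\<forall>p. p \<noteq> 0 \<longrightarrow> poly (map_poly \<iota> p) x \<noteq> 0)"

text \<open>The subfield \<open>k(x)\<close> of \<open>F\<close>.\<close>

definition simple_subfield :: "('k::field \<Rightarrow> 'f::field) \<Rightarrow> 'f \<Rightarrow> 'f set" where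
  "simple_subfield \<iota> x =
     {poly (map_poly \<iota> a) x / poly (map_poly \<iota> b) x | a b. poly (map_poly \<iota> b) x \<noteq> 0}"

definition basis_over :: "'f::field set \<Rightarrow> 'f set \<Rightarrow> bool" where
  "basis_over K B \<longleftrightarrow> finite B \<and>
     (\<forall>z. \<exists>!c. c ` B \<subseteq> K \<and> (\<forall>b. b \<notin> B \<longrightarrow> c b = 0) \<and> z = (\<Sum>b\<in>B. c b * b))"

text \<open>\<open>[F : K] = n\<close>, where \<open>F\<close> is the whole type.\<close>

definition has_ext_degree :: "'f::field set \<Rightarrow> nat \<Rightarrow> bool" where
  "has_ext_degree K n \<longleftrightarrow> (\<exists>B. basis_over K B \<and> card B = n)"

locale function_field =
  fixes \<iota> :: "'k::{alg_closed_field, field_char_0} \<Rightarrow> 'f::field"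
  assumes hom_one: "\<iota> 1 = 1"
    and hom_add: "\<iota> (a + b) = \<iota> a + \<iota> b"
    and hom_mult: "\<iota> (a * b) = \<iota> a * \<iota> b"
    and one_variable:
      "\<exists>x n. transcendental_over \<iota> x \<and> has_ext_degree (simple_subfield \<iota> x) n"

text \<open>
  A point is identified with its normalised order-of-vanishing function.  The order of the zero
  function, usually infinite, is set to \<open>0\<close> so that a place is determined by its values on
  nonzero functions.
\<close>

definition places :: "('k::field \<Rightarrow> 'f::field) \<Rightarrow> ('f \<Rightarrow> int) set" where
  "places \<iota> = {v. v 0 = 0 \<and> surj v \<and>
     (\<forall>c. v (\<iota> c) = 0) \<and>
     (\<forall>x y. x \<noteq> 0 \<longrightarrow> y \<noteq> 0 \<longrightarrow> v (x * y) = v x + v y) \<and>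
     (\<forall>x y. x \<noteq> 0 \<longrightarrow> y \<noteq> 0 \<longrightarrow> x + y \<noteq> 0 \<longrightarrow> min (v x) (v y) \<le> v (x + y))}"

section \<open>Divisors, genus, Weierstrass points\<close>

type_synonym 'f divisor = "('f \<Rightarrow> int) \<Rightarrow>\<^sub>0 int"

definition divisors :: "('k::field \<Rightarrow> 'f::field) \<Rightarrow> 'f divisor set" where
  "divisors \<iota> = carrier (free_Abelian_group (places \<iota>))"

definition divisor_degree :: "'f divisor \<Rightarrow> int" where
  "divisor_degree D = (\<Sum>p\<in>Poly_Mapping.keys D. Poly_Mapping.lookup D p)"

definition principal_divisors :: "('k::field \<Rightarrow> 'f::field) \<Rightarrow> 'f divisor set" where
  "principal_divisors \<iota> =
     {D \<in> divisors \<iota>. \<exists>f. f \<noteq> 0 \<and> (\<forall>p\<in>places \<iota>. Poly_Mapping.lookup D p = p f)}"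

text \<open>The space \<open>L(D) = H\<^sup>0(B, O(D))\<close> and its dimension over \<open>k\<close>.\<close>

definition RR_space :: "('k::field \<Rightarrow> 'f::field) \<Rightarrow> 'f divisor \<Rightarrow> 'f set" where
  "RR_space \<iota> D = {f. f = 0 \<or> (\<forall>p\<in>places \<iota>. 0 \<le> p f + Poly_Mapping.lookup D p)}"

definition RR_dim :: "('k::field \<Rightarrow> 'f::field) \<Rightarrow> 'f divisor \<Rightarrow> nat" where
  "RR_dim \<iota> D = vector_space.dim (\<lambda>c z. \<iota> c * z) (RR_space \<iota> D)"

lemma (in function_field) vector_space_constants: "vector_space (\<lambda>c z. \<iota> c * z)"
  by unfold_locales (simp_all add: hom_one hom_add hom_mult algebra_simps)

text \<open>The genus is the maximum of \<open>deg D - l(D) + 1\<close> over all divisors \<open>D\<close>.\<close>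

definition has_genus :: "('k::field \<Rightarrow> 'f::field) \<Rightarrow> nat \<Rightarrow> bool" where
  "has_genus \<iota> g \<longleftrightarrow>
     (\<forall>D\<in>divisors \<iota>. divisor_degree D - int (RR_dim \<iota> D) + 1 \<le> int g) \<and>
     (\<exists>D\<in>divisors \<iota>. divisor_degree D - int (RR_dim \<iota> D) + 1 = int g)"

text \<open>There is a morphism of degree two to the projective line.\<close>

definition hyperelliptic :: "('k::field \<Rightarrow> 'f::field) \<Rightarrow> bool" where
  "hyperelliptic \<iota> \<longleftrightarrow>
     (\<exists>x. transcendental_over \<iota> x \<and> has_ext_degree (simple_subfield \<iota> x) 2)"

text \<open>
  For a curve of genus \<open>g\<close> the point \<open>q\<close> is a Weierstrass point if \<open>h\<^sup>0(O(g q)) > 1\<close>, i.e. some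
  nonconstant function has a pole of order at most \<open>g\<close> at \<open>q\<close> and no other pole.
\<close>

definition weierstrass_point :: "('k::field \<Rightarrow> 'f::field) \<Rightarrow> nat \<Rightarrow> ('f \<Rightarrow> int) \<Rightarrow> bool" where
  "weierstrass_point \<iota> g q \<longleftrightarrow>
     q \<in> places \<iota> \<and> 1 < RR_dim \<iota> (frag_cmul (int g) (frag_of q))"

section \<open>The Jacobian and its multiplication profiles\<close>

definition degree_zero_divisors :: "('k::field \<Rightarrow> 'f::field) \<Rightarrow> 'f divisor monoid" where
  "degree_zero_divisors \<iota> =
     (free_Abelian_group (places \<iota>))\<lparr>carrier := {D \<in> divisors \<iota>. divisor_degree D = 0}\<rparr>"

text \<open>
  The group of points of the Jacobian: divisors of degree zero modulo linear equivalence.  Its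
  elements are cosets and its operation is written multiplicatively, so \<open>j x\<close> is \<open>x [^] j\<close>.
\<close>

definition Jac :: "('k::field \<Rightarrow> 'f::field) \<Rightarrow> 'f divisor set monoid" where
  "Jac \<iota> = degree_zero_divisors \<iota> Mod principal_divisors \<iota>"

definition divisor_class :: "('k::field \<Rightarrow> 'f::field) \<Rightarrow> 'f divisor \<Rightarrow> 'f divisor set" where
  "divisor_class \<iota> D = principal_divisors \<iota> #>\<^bsub>degree_zero_divisors \<iota>\<^esub> D"

definition Theta :: "('k::field \<Rightarrow> 'f::field) \<Rightarrow> ('f \<Rightarrow> int) \<Rightarrow> nat \<Rightarrow> 'f divisor set set" where
  "Theta \<iota> q d =
     (\<lambda>ps. divisor_class \<iota> (sum_list (map frag_of ps) - frag_cmul (int d) (frag_of q)))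
       ` {ps. length ps = d \<and> set ps \<subseteq> places \<iota>}"

definition Theta0 :: "('k::field \<Rightarrow> 'f::field) \<Rightarrow> ('f \<Rightarrow> int) \<Rightarrow> nat \<Rightarrow> 'f divisor set set" where
  "Theta0 \<iota> q d = Theta \<iota> q d - (if d = 0 then {} else Theta \<iota> q (d - 1))"

definition mult_profile ::
    "('k::field \<Rightarrow> 'f::field) \<Rightarrow> nat \<Rightarrow> ('f \<Rightarrow> int) \<Rightarrow> 'f divisor set \<Rightarrow> nat \<Rightarrow> nat" where
  "mult_profile \<iota> g q x j = (THE e. e \<le> g \<and> x [^]\<^bsub>Jac \<iota>\<^esub> j \<in> Theta0 \<iota> q e)"

end

theory Submission
  imports Defs
begin

text \<open>
  The curve is a double cover of the line, with involution \<open>\<sigma>\<close>, and \<open>q\<close> is one of its branch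
  points, so \<open>v + \<sigma> v \<sim> 2 q\<close> for every point \<open>v\<close>.  The number \<open>\<epsilon>\<^sub>j\<close> is the least \<open>d\<close> for which
  \<open>j (p - q) \<sim> D - d q\<close> with \<open>D\<close> effective of degree \<open>d\<close>; it is called the weight of \<open>j (p - q)\<close>.

  Apart from formal properties of weights, the assertions rest on one fact about linear
  equivalence, \<open>effective_lin_nq\<close>: if \<open>M\<close> is
  effective of degree \<open>n \<le> 2 \<gamma>\<close> and \<open>M \<sim> n q\<close>, then away from \<open>q\<close> it is the zero divisor of a
  polynomial in \<open>x\<close>.  Hence \<open>M\<close> is \<open>\<sigma>\<close>-invariant, its multiplicities at the branch points other than
  \<open>q\<close> are even, and its multiplicity at \<open>q\<close> has the parity of \<open>n\<close>.  The reason is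
  \<open>polynomial_of_bounded_poles\<close>.  Write the function field as \<open>k(x) + k(x) y\<close> with \<open>y\<^sup>2 = G(x)\<close> and
  \<open>G\<close> squarefree.  If \<open>f = a + b y\<close> has a pole of order at most \<open>2 \<gamma>\<close> at \<open>q\<close> and no other pole, then
  so has \<open>f - \<sigma> f = 2 b y\<close>; its square \<open>4 b\<^sup>2 G\<close> is a polynomial of degree at most \<open>2 \<gamma>\<close> in \<open>x\<close>, which
  forces \<open>b\<close> to be a polynomial and then, as \<open>deg G \<ge> 2 \<gamma> + 1\<close>, to vanish.

  If \<open>D - d q \<sim> E - e q\<close> with \<open>d + e \<le> 2 \<gamma>\<close>, the fact applies to \<open>M = D + \<sigma> E\<close>.  When \<open>D\<close> is reduced,
  that is, contains neither \<open>q\<close> nor a whole fibre \<open>v + \<sigma> v\<close>, the symmetry of \<open>M\<close> gives \<open>D \<le> E\<close>, so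
  \<open>d \<le> e\<close> (\<open>reduced_degree_le\<close>).  Representatives of minimal degree are reduced.  A plateau below
  \<open>\<gamma>\<close> contradicts the parity at \<open>q\<close> (\<open>weight_step_neq\<close>); a peak, for \<open>p\<close> not a branch
  point, would replace \<open>D\<close> by the reduced divisor \<open>D + 2 p\<close> without raising the weight
  (\<open>weight_no_peak\<close>); and \<open>N p\<close> is reduced when \<open>p\<close> is not
  a branch point, so \<open>N p \<sim> N q\<close> needs \<open>N > 2 \<gamma>\<close> (\<open>weight_multiple_nonzero\<close>).  The bound
  on the steps follows from the subadditivity of weights and their invariance under \<open>X \<mapsto> - X\<close>,
  for which \<open>\<sigma>\<close> is responsible, and the reflection \<open>r \<mapsto> N - r\<close> from this invariance and
  \<open>N (p - q) \<sim> 0\<close>.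

  The geometry of the curve has to be derived from the function field.  Explicit formulas for the
  order of \<open>(A + B y) / C\<close> show that the places over a point of the line are \<open>v\<close> and \<open>v \<circ> \<sigma>\<close>, with
  ramification index two exactly when they coincide (\<open>places_above\<close>, \<open>places_at_infinity\<close>).  The
  genus enters four times: finite-dimensionality of Riemann-Roch spaces yields a place over every
  point of the line (\<open>exists_place_above\<close>), the sections \<open>x\<^sup>i\<close> and \<open>x\<^sup>j y\<close> of large multiples of
  the fibre at infinity yield \<open>deg G \<ge> 2 \<gamma> + 1\<close> (\<open>genus_less\<close>), this bound makes the Weierstrass
  point \<open>q\<close> a branch point (\<open>weierstrass_conj\<close>), and every class has weight at most \<open>\<gamma>\<close>
  (\<open>theta_genus\<close>).
\<close>

section \<open>Constants and polynomials in a function\<close>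

abbreviation mult_at :: "'a::idom \<Rightarrow> 'a poly \<Rightarrow> nat" where
  "mult_at \<equiv> Polynomial.order"

text \<open>
  A place has the value \<open>0\<close> at the zero function, whose order should count as infinite; \<open>val_ge\<close>
  restores the filtration of the field by additive subgroups.
\<close>

definition val_ge :: "('f::field \<Rightarrow> int) \<Rightarrow> int \<Rightarrow> 'f \<Rightarrow> bool" where
  "val_ge v n f \<longleftrightarrow> f = 0 \<or> n \<le> v f"

lemma val_ge_0 [simp]: "val_ge v n 0"
  by (simp add: val_ge_def)

lemma val_ge_mono: "val_ge v n f \<Longrightarrow> m \<le> n \<Longrightarrow> val_ge v m f"
  by (auto simp: val_ge_def)

context function_field
begin

lemma const_0 [simp]: "\<iota> 0 = 0"
proof -
  have "\<iota> 0 + \<iota> 0 = \<iota> 0 + 0"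
    by (simp flip: hom_add)
  then show ?thesis
    by (simp only: add_left_cancel)
qed

lemma const_minus: "\<iota> (- a) = - \<iota> a"
  using hom_add[of a "- a"] by (simp add: eq_neg_iff_add_eq_0 add.commute)

lemma const_diff: "\<iota> (a - b) = \<iota> a - \<iota> b"
  using hom_add[of a "- b"] by (simp add: const_minus)

lemma const_eq_0_iff [simp]: "\<iota> a = 0 \<longleftrightarrow> a = 0"
proof
  assume "\<iota> a = 0"
  show "a = 0"
  proof (rule ccontr)
    assume "a \<noteq> 0"
    then have "\<iota> 1 = \<iota> a * \<iota> (inverse a)"
      by (simp flip: hom_mult)
    with \<open>\<iota> a = 0\<close> show False
      by (simp add: hom_one)
  qed
qed simp

lemma const_inverse: "\<iota> (inverse a) = inverse (\<iota> a)"
proof (cases "a = 0")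
  case False
  then have "\<iota> a * \<iota> (inverse a) = 1"
    by (simp flip: hom_mult add: hom_one)
  then show ?thesis
    by (rule inverse_unique[symmetric])
qed simp

lemma const_2: "\<iota> 2 = 2"
  using hom_add[of 1 1] by (simp add: hom_one)

lemma two_neq_0: "(2::'f) \<noteq> 0"
  using const_eq_0_iff[of 2] by (simp add: const_2)

definition ev :: "'f \<Rightarrow> 'k poly \<Rightarrow> 'f" where
  "ev x A = poly (map_poly \<iota> A) x"

lemma ev_0 [simp]: "ev x 0 = 0"
  by (simp add: ev_def)

lemma ev_pCons: "ev x (pCons c A) = \<iota> c + x * ev x A"
  by (simp add: ev_def map_poly_pCons)

lemma ev_1 [simp]: "ev x 1 = 1"
  by (simp add: one_pCons ev_pCons hom_one)

lemma ev_2: "ev x 2 = 2"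
  by (simp add: numeral_poly ev_pCons const_2)

lemma ev_add: "ev x (A + B) = ev x A + ev x B"
  by (induction A B rule: poly_induct2) (simp_all add: ev_pCons hom_add algebra_simps)

lemma ev_smult: "ev x (smult c A) = \<iota> c * ev x A"
  by (induction A) (simp_all add: ev_pCons hom_mult algebra_simps)

lemma ev_mult: "ev x (A * B) = ev x A * ev x B"
  by (induction A) (simp_all add: ev_pCons ev_add ev_smult algebra_simps)

lemma ev_minus: "ev x (- A) = - ev x A"
  using ev_smult[of x "- 1" A] by (simp add: const_minus hom_one)

lemma ev_diff: "ev x (A - B) = ev x A - ev x B"
  using ev_add[of x A "- B"] by (simp add: ev_minus)

lemma ev_power: "ev x (A ^ n) = ev x A ^ n"
  by (induction n) (simp_all add: ev_mult)

lemma ev_linear: "ev x [:- a, 1:] = x - \<iota> a"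
  by (simp add: ev_pCons const_minus hom_one)

lemma ev_monom: "ev x (monom c n) = \<iota> c * x ^ n"
  by (induction n) (simp_all add: ev_pCons monom_Suc monom_0)

lemmas ev_simps = ev_pCons ev_add ev_smult ev_mult ev_minus ev_diff ev_power

text \<open>
  Over an algebraically closed field a nonzero polynomial is a product of factors \<open>X - a\<close>, and
  none of these vanishes at a nonconstant \<open>x\<close>.
\<close>

lemma ev_nonzero:
  assumes "x \<notin> range \<iota>" "A \<noteq> 0"
  shows "ev x A \<noteq> 0"
proof -
  have "ev x (\<Prod>a\<in>#M. [:- a, 1:]) \<noteq> 0" for M
    using assms(1) by (induction M) (auto simp: ev_mult ev_linear simp del: mult_pCons_left)
  moreover obtain M where "A = smult (lead_coeff A) (\<Prod>a\<in>#M. [:- a, 1:])"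
    using alg_closed_imp_factorization[OF assms(2)] by blast
  ultimately show ?thesis
    using assms(2) by (metis ev_smult const_eq_0_iff leading_coeff_0_iff mult_eq_0_iff)
qed

lemma transcendental_over_iff: "transcendental_over \<iota> x \<longleftrightarrow> x \<notin> range \<iota>"
proof
  assume t: "transcendental_over \<iota> x"
  show "x \<notin> range \<iota>"
  proof
    assume "x \<in> range \<iota>"
    then obtain a where "x = \<iota> a" by auto
    then have "poly (map_poly \<iota> [:- a, 1:]) x = 0"
      using ev_linear[of x a] by (simp add: ev_def)
    with t show False
      unfolding transcendental_over_def by (metis one_neq_zero pCons_eq_0_iff)
  qed
qed (auto simp: transcendental_over_def ev_nonzero simp flip: ev_def)

section \<open>The field \<open>k(x)\<close>\<close>

lemma simple_subfield_iff:
  "f \<in> simple_subfield \<iota> x \<longleftrightarrow> (\<exists>A B. ev x B \<noteq> 0 \<and> f = ev x A / ev x B)"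
  by (auto simp: simple_subfield_def ev_def)

lemma simple_subfield_ev: "ev x A \<in> simple_subfield \<iota> x"
  unfolding simple_subfield_iff by (intro exI[of _ A] exI[of _ 1]) simp

lemma simple_subfield_const: "\<iota> c \<in> simple_subfield \<iota> x"
  using simple_subfield_ev[of x "[:c:]"] by (simp add: ev_pCons)

lemma simple_subfield_0: "0 \<in> simple_subfield \<iota> x"
  and simple_subfield_1: "1 \<in> simple_subfield \<iota> x"
  and simple_subfield_2: "2 \<in> simple_subfield \<iota> x"
  using simple_subfield_const[of 0 x] simple_subfield_const[of 1 x] simple_subfield_const[of 2 x]
  by (simp_all add: hom_one const_2)

lemma simple_subfield_self: "x \<in> simple_subfield \<iota> x"
  using simple_subfield_ev[of x "[:0, 1:]"] by (simp add: ev_pCons hom_one)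

lemma simple_subfield_add:
  assumes "f \<in> simple_subfield \<iota> x" "g \<in> simple_subfield \<iota> x"
  shows "f + g \<in> simple_subfield \<iota> x"
proof -
  obtain A B C D where nz: "ev x B \<noteq> 0" "ev x D \<noteq> 0"
    and fg: "f = ev x A / ev x B" "g = ev x C / ev x D"
    using assms unfolding simple_subfield_iff by blast
  show ?thesis
    unfolding simple_subfield_iff fg using nz
    by (intro exI[of _ "A * D + C * B"] exI[of _ "B * D"]) (simp add: ev_simps add_frac_eq)
qed

lemma simple_subfield_mult:
  assumes "f \<in> simple_subfield \<iota> x" "g \<in> simple_subfield \<iota> x"
  shows "f * g \<in> simple_subfield \<iota> x"
proof -
  obtain A B C D where nz: "ev x B \<noteq> 0" "ev x D \<noteq> 0"
    and fg: "f = ev x A / ev x B" "g = ev x C / ev x D"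
    using assms unfolding simple_subfield_iff by blast
  show ?thesis
    unfolding simple_subfield_iff fg using nz
    by (intro exI[of _ "A * C"] exI[of _ "B * D"]) (simp add: ev_simps)
qed

lemma simple_subfield_inverse:
  assumes "f \<in> simple_subfield \<iota> x"
  shows "inverse f \<in> simple_subfield \<iota> x"
proof (cases "f = 0")
  case False
  obtain A B where f: "ev x B \<noteq> 0" "f = ev x A / ev x B"
    using assms unfolding simple_subfield_iff by blast
  with False have "ev x A \<noteq> 0" by auto
  then show ?thesis
    unfolding simple_subfield_iff f(2) by (intro exI[of _ B] exI[of _ A]) simp
qed (simp add: simple_subfield_0)

lemma simple_subfield_minus: "f \<in> simple_subfield \<iota> x \<Longrightarrow> - f \<in> simple_subfield \<iota> x"
  using simple_subfield_mult[OF simple_subfield_const[of "- 1"]] by (simp add: const_minus hom_one)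

lemma simple_subfield_diff:
  "f \<in> simple_subfield \<iota> x \<Longrightarrow> g \<in> simple_subfield \<iota> x \<Longrightarrow> f - g \<in> simple_subfield \<iota> x"
  using simple_subfield_add[OF _ simple_subfield_minus] by (metis diff_conv_add_uminus)

lemma simple_subfield_divide:
  "f \<in> simple_subfield \<iota> x \<Longrightarrow> g \<in> simple_subfield \<iota> x \<Longrightarrow> f / g \<in> simple_subfield \<iota> x"
  using simple_subfield_mult[OF _ simple_subfield_inverse] by (metis divide_inverse)

lemma simple_subfield_power: "f \<in> simple_subfield \<iota> x \<Longrightarrow> f ^ n \<in> simple_subfield \<iota> x"
  by (induction n) (simp_all add: simple_subfield_1 simple_subfield_mult)

lemmas simple_subfield_closed =
  simple_subfield_ev simple_subfield_const simple_subfield_0 simple_subfield_1 simple_subfield_2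
  simple_subfield_self simple_subfield_add simple_subfield_mult simple_subfield_inverse
  simple_subfield_minus simple_subfield_diff simple_subfield_divide simple_subfield_power

lemma simple_subfield_least:
  assumes "z \<in> simple_subfield \<iota> x"
  shows "simple_subfield \<iota> z \<subseteq> simple_subfield \<iota> x"
proof
  have "ev z A \<in> simple_subfield \<iota> x" for A
    by (induction A) (simp_all add: ev_pCons simple_subfield_closed assms)
  then show "f \<in> simple_subfield \<iota> x" if "f \<in> simple_subfield \<iota> z" for f
    using that by (auto simp: simple_subfield_iff[of _ z] intro: simple_subfield_divide)
qed

text \<open>
  Passing from \<open>x\<close> to \<open>1 / (x - a)\<close> moves a point over \<open>a\<close> to infinity while keeping the subfield
  over which the degree is two.
\<close>

lemma simple_subfield_mobius:
  "simple_subfield \<iota> (inverse (x - \<iota> a)) = simple_subfield \<iota> x"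
proof
  let ?z = "inverse (x - \<iota> a)"
  show "simple_subfield \<iota> ?z \<subseteq> simple_subfield \<iota> x"
    by (intro simple_subfield_least simple_subfield_closed)
  have "x = inverse ?z + \<iota> a" by simp
  then have "x \<in> simple_subfield \<iota> ?z"
    by (metis simple_subfield_self simple_subfield_inverse simple_subfield_add simple_subfield_const)
  then show "simple_subfield \<iota> x \<subseteq> simple_subfield \<iota> ?z"
    by (rule simple_subfield_least)
qed

lemma mobius_nonconst: "x \<notin> range \<iota> \<Longrightarrow> inverse (x - \<iota> a) \<notin> range \<iota>"
proof
  assume x: "x \<notin> range \<iota>" and "inverse (x - \<iota> a) \<in> range \<iota>"
  then obtain c where "inverse (x - \<iota> a) = \<iota> c" by auto
  then have "x - \<iota> a = \<iota> (inverse c)"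
    by (metis const_inverse inverse_inverse_eq)
  then have "x = \<iota> (inverse c + a)"
    by (simp add: hom_add algebra_simps)
  with x show False by simp
qed

section \<open>Orders of vanishing\<close>

context
  fixes v assumes v: "v \<in> places \<iota>"
begin

lemma place_0: "v 0 = 0" and place_surj: "surj v" and place_const: "v (\<iota> c) = 0"
  and place_mult: "f \<noteq> 0 \<Longrightarrow> g \<noteq> 0 \<Longrightarrow> v (f * g) = v f + v g"
  and place_add: "f \<noteq> 0 \<Longrightarrow> g \<noteq> 0 \<Longrightarrow> f + g \<noteq> 0 \<Longrightarrow> min (v f) (v g) \<le> v (f + g)"
  using v by (auto simp: places_def)

lemma place_1: "v 1 = 0"
  using place_const[of 1] by (simp add: hom_one)

lemma place_inverse: "v (inverse f) = - v f"
  using place_mult[of f "inverse f"] by (cases "f = 0") (simp_all add: place_0 place_1)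

lemma place_divide: "f \<noteq> 0 \<Longrightarrow> g \<noteq> 0 \<Longrightarrow> v (f / g) = v f - v g"
  by (simp add: divide_inverse place_mult place_inverse)

lemma place_power: "f \<noteq> 0 \<Longrightarrow> v (f ^ n) = int n * v f"
  by (induction n) (simp_all add: place_1 place_mult algebra_simps)

lemma place_minus: "v (- f) = v f"
  using place_mult[of "\<iota> (- 1)" f] place_const[of "- 1"]
  by (cases "f = 0") (simp_all add: const_minus hom_one)

lemma val_ge_const: "val_ge v 0 (\<iota> c)"
  by (simp add: val_ge_def place_const)

lemma val_ge_add: "val_ge v n f \<Longrightarrow> val_ge v n g \<Longrightarrow> val_ge v n (f + g)"
  using place_add[of f g] by (fastforce simp: val_ge_def min_def split: if_splits)

lemma val_ge_mult: "val_ge v n f \<Longrightarrow> val_ge v m g \<Longrightarrow> val_ge v (n + m) (f * g)"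
  by (cases "f = 0 \<or> g = 0") (auto simp: val_ge_def place_mult)

lemma val_ge_mult0: "val_ge v 0 f \<Longrightarrow> val_ge v n g \<Longrightarrow> val_ge v n (f * g)"
  using val_ge_mult[of 0 f n g] by simp

lemma val_ge_minus: "val_ge v n (- f) \<longleftrightarrow> val_ge v n f"
  by (simp add: val_ge_def place_minus)

lemma val_ge_diff: "val_ge v n f \<Longrightarrow> val_ge v n g \<Longrightarrow> val_ge v n (f - g)"
  using val_ge_add[of n f "- g"] by (simp add: val_ge_minus)

lemma place_add_dominant:
  assumes "f \<noteq> 0" "val_ge v (v f + 1) g"
  shows "f + g \<noteq> 0" "v (f + g) = v f"
proof -
  show nz: "f + g \<noteq> 0"
  proof
    assume "f + g = 0"
    then have "g = - f" by (simp add: eq_neg_iff_add_eq_0 add.commute)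
    with assms show False by (simp add: val_ge_def place_minus)
  qed
  show "v (f + g) = v f"
  proof (cases "g = 0")
    case False
    with assms have "v f < v g" by (auto simp: val_ge_def)
    moreover have "min (v f) (v g) \<le> v (f + g)"
      using place_add assms False nz by blast
    moreover have "min (v (f + g)) (v (- g)) \<le> v (f + g + - g)"
      using place_add[of "f + g" "- g"] assms False nz by simp
    ultimately show ?thesis by (simp add: place_minus min_def split: if_splits)
  qed simp
qed

lemma not_const_of_val_ge_1:
  assumes "val_ge v 1 (f - \<iota> c)" "c \<noteq> 0"
  shows "f \<noteq> 0" "v f = 0"
  using place_add_dominant[of "\<iota> c" "f - \<iota> c"] assms by (simp_all add: place_const)

lemma val_ge_ev: "val_ge v 0 x \<Longrightarrow> val_ge v 0 (ev x A)"
  by (induction A) (simp_all add: ev_pCons val_ge_add val_ge_const val_ge_mult0)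

lemma val_ge_of_value:
  assumes "val_ge v 1 (x - \<iota> a)"
  shows "val_ge v 0 x"
  using val_ge_add[OF val_ge_mono[OF assms, of 0] val_ge_const[of a]] by simp

text \<open>
  The difference is divisible by \<open>x - a\<close>.
\<close>

lemma ev_value:
  assumes "val_ge v 1 (x - \<iota> a)"
  shows "val_ge v 1 (ev x A - \<iota> (poly A a))"
proof -
  have "A = pCons 0 (synthetic_div A a) + [:poly A a:] - smult a (synthetic_div A a)"
    using synthetic_div_correct'[of a A]
    by (simp add: algebra_simps)
  then have "ev x A = ev x (pCons 0 (synthetic_div A a) + [:poly A a:] - smult a (synthetic_div A a))"
    by simp
  then have "ev x A - \<iota> (poly A a) = ev x (synthetic_div A a) * (x - \<iota> a)"
    by (simp add: ev_simps algebra_simps)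
  then show ?thesis
    using val_ge_mult0[OF val_ge_ev[OF val_ge_of_value[OF assms]] assms] by simp
qed

lemma ev_unit:
  assumes "val_ge v 1 (x - \<iota> a)" "poly A a \<noteq> 0"
  shows "ev x A \<noteq> 0" "v (ev x A) = 0"
  using not_const_of_val_ge_1[OF ev_value[OF assms(1)] assms(2)] by auto

lemma place_ev:
  assumes x: "x \<notin> range \<iota>" and a: "val_ge v 1 (x - \<iota> a)" and A: "A \<noteq> 0"
  shows "v (ev x A) = int (mult_at a A) * v (x - \<iota> a)"
proof -
  obtain B where B: "A = [:- a, 1:] ^ mult_at a A * B" "\<not> [:- a, 1:] dvd B"
    using order_decomp[OF A] by blast
  then have "poly B a \<noteq> 0" by (simp add: poly_eq_0_iff_dvd)
  note u = ev_unit[OF a this]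
  have "ev x A = (x - \<iota> a) ^ mult_at a A * ev x B"
    using arg_cong[OF B(1), of "ev x"] by (simp add: ev_mult ev_power ev_linear)
  moreover have "x - \<iota> a \<noteq> 0" using x by auto
  ultimately show ?thesis
    using u by (simp add: place_mult place_power)
qed

text \<open>
  At a pole of \<open>x\<close> the leading term dominates.
\<close>

lemma place_ev_pole:
  assumes "v x < 0" "A \<noteq> 0"
  shows "ev x A \<noteq> 0 \<and> v (ev x A) = int (degree A) * v x"
  using assms(2)
proof (induction A)
  case (pCons c A)
  have x0: "x \<noteq> 0" using assms(1) place_0 by auto
  show ?case
  proof (cases "A = 0")
    case True
    with pCons show ?thesis by (simp add: ev_pCons place_const)
  next
    case False
    with pCons have IH: "ev x A \<noteq> 0" "v (ev x A) = int (degree A) * v x" by auto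
    have d: "v (x * ev x A) = int (Suc (degree A)) * v x"
      using IH x0 by (simp add: place_mult algebra_simps)
    have neg: "int (Suc (degree A)) * v x < 0"
      using assms(1) by (simp add: mult_pos_neg)
    have ge: "val_ge v (v (x * ev x A) + 1) (\<iota> c)"
      using neg d by (auto simp: val_ge_def place_const)
    show ?thesis
      using place_add_dominant[OF _ ge] IH x0 False d by (simp add: ev_pCons add.commute)
  qed
qed simp

end

lemma not_nonneg_place:
  assumes "v \<in> places \<iota>" "\<And>f. f \<noteq> 0 \<Longrightarrow> 0 \<le> v f"
  shows False
proof -
  obtain f where "v f = - 1" using place_surj[OF assms(1)] by (metis surjD)
  moreover have "f \<noteq> 0" using calculation place_0[OF assms(1)] by auto
  ultimately show False using assms(2)[of f] by simp
qed

end

section \<open>Quadratic covers of the line\<close>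

text \<open>
  Dividing a family of polynomials by its common power of \<open>X - a\<close> leaves a family that does not
  vanish identically at \<open>a\<close>.
\<close>

lemma exists_common_multiplicity:
  fixes S :: "'a::idom poly set"
  assumes "A \<in> S" "A \<noteq> 0"
  shows "\<exists>n. (\<forall>A\<in>S. [:- a, 1:] ^ n dvd A) \<and> (\<exists>A\<in>S. \<not> [:- a, 1:] ^ Suc n dvd A)"
proof (rule ccontr)
  assume *: "\<not> ?thesis"
  have "\<forall>A\<in>S. [:- a, 1:] ^ n dvd A" for n
    using * by (induction n) auto
  then show False
    using order_2[OF assms(2)] assms(1) by blast
qed

text \<open>
  This computes ramification indices and proves uniqueness of places at the same time.  If the
  places in \<open>S\<close> all have the form \<open>v f = h v * \<kappa> f\<close> with a common \<open>\<kappa>\<close>, then \<open>h v\<close> divides all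
  values of \<open>v\<close>; as \<open>v\<close> is normalised, \<open>h v = 1\<close>, and nothing is left to distinguish two places.
\<close>

lemma places_eq_of_proportional:
  fixes \<iota> :: "'k::field \<Rightarrow> 'f::field" and h :: "('f \<Rightarrow> int) \<Rightarrow> int"
  assumes S: "S \<subseteq> places \<iota>"
    and pos: "\<And>v. v \<in> S \<Longrightarrow> 0 < h v"
    and scaled: "\<And>f. f \<noteq> 0 \<Longrightarrow> \<exists>\<kappa>. \<forall>v\<in>S. v f = h v * \<kappa>"
    and v: "v \<in> S"
  shows "h v = 1" and "w \<in> S \<Longrightarrow> w = v"
proof -
  have h1: "h v = 1" if v: "v \<in> S" for v
  proof -
    have "surj v" "v 0 = 0" using S v by (auto simp: places_def)
    obtain f where f: "v f = 1" using \<open>surj v\<close> by (metis surjD)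
    with \<open>v 0 = 0\<close> obtain \<kappa> where "1 = h v * \<kappa>" using scaled[of f] v by fastforce
    then show ?thesis using pos[OF v] by (simp add: pos_zmult_eq_1_iff)
  qed
  from v show "h v = 1" by (rule h1)
  assume w: "w \<in> S"
  show "w = v"
  proof
    fix f
    show "w f = v f"
    proof (cases "f = 0")
      case True
      moreover have "v \<in> places \<iota>" "w \<in> places \<iota>" using S v w by auto
      ultimately show ?thesis by (simp add: places_def)
    next
      case False
      obtain \<kappa> where \<kappa>: "\<forall>v\<in>S. v f = h v * \<kappa>" using scaled[OF False] by blast
      show ?thesis using bspec[OF \<kappa> v] bspec[OF \<kappa> w] h1[OF v] h1[OF w] by simp
    qed
  qed
qed

context function_field
begin

text \<open>
  If \<open>f\<close> takes no value in the constants at \<open>v\<close>, then every factor \<open>f - c\<close> is a unit there, and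
  \<open>v\<close> is trivial on the polynomials in \<open>f\<close>.
\<close>

lemma ev_unit_of_no_residue:
  assumes v: "v \<in> places \<iota>" and f: "val_ge v 0 f" and no: "\<And>c. \<not> val_ge v 1 (f - \<iota> c)"
    and "R \<noteq> 0"
  shows "ev f R \<noteq> 0 \<and> v (ev f R) = 0"
proof -
  have lin: "f - \<iota> c \<noteq> 0 \<and> v (f - \<iota> c) = 0" for c
    using no[of c] val_ge_diff[OF v f val_ge_const[OF v, of c]] by (auto simp: val_ge_def)
  have "ev f (\<Prod>a\<in>#M. [:- a, 1:]) \<noteq> 0 \<and> v (ev f (\<Prod>a\<in>#M. [:- a, 1:])) = 0" for M
    using lin by (induction M)
      (auto simp: ev_mult ev_linear place_mult[OF v] place_1[OF v] simp del: mult_pCons_left)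
  moreover obtain M where M: "R = smult (lead_coeff R) (\<Prod>a\<in>#M. [:- a, 1:])"
    using alg_closed_imp_factorization[OF assms(4)] by blast
  moreover have "ev f R = \<iota> (lead_coeff R) * ev f (\<Prod>a\<in>#M. [:- a, 1:])"
    by (subst M) (simp only: ev_smult)
  ultimately show ?thesis
    using assms(4) by (simp add: place_mult[OF v] place_const[OF v])
qed

end

text \<open>
  The double cover \<open>y\<^sup>2 = G(x)\<close> of the line with its involution.  That \<open>G\<close> has at most simple zeros
  is not part of the structure but is assumed at one point at a time, so that the same results
  apply to the point at infinity through the coordinates \<open>1 / x\<close> and \<open>y / x\<^sup>m\<close>.
\<close>

locale quadratic_cover = function_field \<iota>
  for \<iota> :: "'k::{alg_closed_field, field_char_0} \<Rightarrow> 'f::field" +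
  fixes x y :: 'f and G :: "'k poly" and \<sigma> :: "'f \<Rightarrow> 'f"
  assumes x_nonconst: "x \<notin> range \<iota>"
    and y_nonzero: "y \<noteq> 0"
    and y_sq: "y ^ 2 = ev x G"
    and span: "\<exists>a\<in>simple_subfield \<iota> x. \<exists>b\<in>simple_subfield \<iota> x. f = a + b * y"
    and \<sigma>_add: "\<sigma> (f + g) = \<sigma> f + \<sigma> g"
    and \<sigma>_mult: "\<sigma> (f * g) = \<sigma> f * \<sigma> g"
    and \<sigma>_const: "\<sigma> (\<iota> c) = \<iota> c"
    and \<sigma>_x: "\<sigma> x = x"
    and \<sigma>_y: "\<sigma> y = - y"
begin

lemma \<sigma>_0 [simp]: "\<sigma> 0 = 0"
  using \<sigma>_const[of 0] by simp

lemma \<sigma>_minus: "\<sigma> (- f) = - \<sigma> f"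
  using \<sigma>_add[of f "- f"] by (simp add: eq_neg_iff_add_eq_0 add.commute)

lemma \<sigma>_diff: "\<sigma> (f - g) = \<sigma> f - \<sigma> g"
  using \<sigma>_add[of f "- g"] by (simp add: \<sigma>_minus)

lemma \<sigma>_ev: "\<sigma> (ev x A) = ev x A"
  by (induction A) (simp_all add: ev_pCons \<sigma>_add \<sigma>_mult \<sigma>_const \<sigma>_x)

lemma \<sigma>_fixes:
  assumes "a \<in> simple_subfield \<iota> x"
  shows "\<sigma> a = a"
proof -
  obtain A B where nz: "ev x B \<noteq> 0" and a: "a = ev x A / ev x B"
    using assms unfolding simple_subfield_iff by blast
  have "\<sigma> a * ev x B = \<sigma> (a * ev x B)" by (simp add: \<sigma>_mult \<sigma>_ev)
  also have "\<dots> = a * ev x B" using nz by (simp add: a \<sigma>_ev)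
  finally show ?thesis using nz by simp
qed

lemma \<sigma>_\<sigma> [simp]: "\<sigma> (\<sigma> f) = f"
proof -
  obtain a b where "a \<in> simple_subfield \<iota> x" "b \<in> simple_subfield \<iota> x" "f = a + b * y"
    using span by blast
  then show ?thesis by (simp add: \<sigma>_add \<sigma>_mult \<sigma>_fixes \<sigma>_y \<sigma>_minus \<sigma>_diff)
qed

lemma \<sigma>_eq_0_iff [simp]: "\<sigma> f = 0 \<longleftrightarrow> f = 0"
  by (metis \<sigma>_0 \<sigma>_\<sigma>)

lemma G_nonzero: "G \<noteq> 0"
  using y_sq y_nonzero by auto

lemma y_sq_in: "y * y \<in> simple_subfield \<iota> x"
  using y_sq simple_subfield_ev by (simp add: power2_eq_square)

lemma trace_in: "f + \<sigma> f \<in> simple_subfield \<iota> x"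
proof -
  obtain a b where ab: "a \<in> simple_subfield \<iota> x" "b \<in> simple_subfield \<iota> x" "f = a + b * y"
    using span by blast
  then have eq: "f + \<sigma> f = 2 * a" by (simp add: \<sigma>_add \<sigma>_mult \<sigma>_fixes \<sigma>_y)
  show ?thesis unfolding eq using ab(1) by (simp add: simple_subfield_closed)
qed

lemma norm_in: "f * \<sigma> f \<in> simple_subfield \<iota> x"
proof -
  obtain a b where ab: "a \<in> simple_subfield \<iota> x" "b \<in> simple_subfield \<iota> x" "f = a + b * y"
    using span by blast
  then have eq: "f * \<sigma> f = a * a - b * b * (y * y)"
    by (simp add: \<sigma>_add \<sigma>_mult \<sigma>_fixes \<sigma>_y algebra_simps)
  show ?thesis unfolding eq using ab(1,2) y_sq_in by (simp add: simple_subfield_closed)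
qed

lemma coordinates:
  "\<exists>A B C. C \<noteq> 0 \<and> f * ev x C = ev x A + ev x B * y"
proof -
  obtain a b where ab: "a \<in> simple_subfield \<iota> x" "b \<in> simple_subfield \<iota> x" "f = a + b * y"
    using span by blast
  then obtain A B C D where nz: "ev x B \<noteq> 0" "ev x D \<noteq> 0"
    and f: "f = ev x A / ev x B + ev x C / ev x D * y"
    unfolding simple_subfield_iff by blast
  have "f * ev x (B * D) = ev x (A * D) + ev x (C * B) * y"
    using nz by (simp add: f ev_mult field_simps)
  moreover have "B * D \<noteq> 0" using nz by auto
  ultimately show ?thesis by blast
qed

lemma quadratic_relation:
  "\<exists>P Q R. P \<noteq> 0 \<and> ev x P * f ^ 2 + ev x Q * f + ev x R = 0"
proof -
  obtain A B C where C: "C \<noteq> 0" and f: "f * ev x C = ev x A + ev x B * y"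
    using coordinates by blast
  have "(f * ev x C - ev x A) ^ 2 = ev x B ^ 2 * ev x G"
    by (simp add: f power_mult_distrib y_sq)
  then have "ev x (C ^ 2) * f ^ 2 + ev x (- (A * C + A * C)) * f + ev x (A ^ 2 - B ^ 2 * G) = 0"
    by (simp add: ev_simps ev_2 power2_eq_square algebra_simps)
  moreover have "C ^ 2 \<noteq> 0" using C by simp
  ultimately show ?thesis by blast
qed

lemma place_conj:
  assumes v: "v \<in> places \<iota>"
  shows "v \<circ> \<sigma> \<in> places \<iota>"
proof -
  have "surj \<sigma>" by (metis \<sigma>_\<sigma> surjI)
  then have "surj (v \<circ> \<sigma>)" using comp_surj place_surj[OF v] by blast
  moreover have "min (v (\<sigma> f)) (v (\<sigma> g)) \<le> v (\<sigma> f + \<sigma> g)"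
    if "f \<noteq> 0" "g \<noteq> 0" "f + g \<noteq> 0" for f g
    using that place_add[OF v] by (metis \<sigma>_add \<sigma>_eq_0_iff)
  ultimately show ?thesis
    by (simp add: places_def \<sigma>_const \<sigma>_mult \<sigma>_add place_const[OF v] place_mult[OF v] place_0[OF v])
qed

lemma conj_conj [simp]: "v \<circ> \<sigma> \<circ> \<sigma> = v"
  by (auto simp: fun_eq_iff)

lemma conj_eq_iff: "v \<circ> \<sigma> = w \<longleftrightarrow> v = w \<circ> \<sigma>"
  by auto

section \<open>Places at finite distance\<close>

text \<open>
  Otherwise \<open>v\<close> would be trivial on the polynomials in \<open>x\<close>.  Every function satisfies a quadratic
  equation over these, and a negative value would make its leading term dominate.
\<close>

lemma finite_or_infinite_place:
  assumes v: "v \<in> places \<iota>"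
  shows "v x < 0 \<or> (\<exists>a. val_ge v 1 (x - \<iota> a))"
proof (rule ccontr)
  assume "\<not> ?thesis"
  then have x: "val_ge v 0 x" and no: "\<And>a. \<not> val_ge v 1 (x - \<iota> a)"
    by (auto simp: val_ge_def)
  note unit = ev_unit_of_no_residue[OF v x no]
  have ge: "val_ge v 0 (ev x A)" for A
    by (rule val_ge_ev[OF v x])
  have "0 \<le> v f" if "f \<noteq> 0" for f
  proof (rule ccontr)
    assume neg: "\<not> 0 \<le> v f"
    obtain P Q R where P: "P \<noteq> 0" and rel: "ev x P * f ^ 2 + ev x Q * f + ev x R = 0"
      using quadratic_relation by blast
    have lead: "ev x P * f ^ 2 \<noteq> 0" "v (ev x P * f ^ 2) = 2 * v f"
      using unit[OF P] that by (simp_all add: place_mult[OF v] place_power[OF v])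
    have "val_ge v (v f) (ev x Q * f)"
      by (rule val_ge_mult0[OF v ge]) (simp add: val_ge_def)
    moreover have "val_ge v (v f) (ev x R)"
      using val_ge_mono[OF ge] neg by simp
    ultimately have "val_ge v (2 * v f + 1) (ev x Q * f + ev x R)"
      using neg by (intro val_ge_mono[OF val_ge_add[OF v]]) auto
    from place_add_dominant(1)[OF v lead(1) this[folded lead(2)]] rel show False
      by (simp add: add.assoc)
  qed
  then show False by (rule not_nonneg_place[OF v])
qed

text \<open>
  The quadratic equation of \<open>f\<close>, freed of common zeros of its coefficients at \<open>a\<close>, reduces at
  \<open>x = a\<close> to a nonzero polynomial over the constants which has the value of \<open>f\<close> as a root.
\<close>

lemma residue_finite:
  assumes v: "v \<in> places \<iota>" and a: "val_ge v 1 (x - \<iota> a)" and f: "val_ge v 0 f"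
  shows "\<exists>c. val_ge v 1 (f - \<iota> c)"
proof (rule ccontr)
  assume no: "\<nexists>c. val_ge v 1 (f - \<iota> c)"
  obtain P Q R where P: "P \<noteq> 0" and rel: "ev x P * f ^ 2 + ev x Q * f + ev x R = 0"
    using quadratic_relation by blast
  obtain n where n: "\<forall>A\<in>{P, Q, R}. [:- a, 1:] ^ n dvd A"
      "\<exists>A\<in>{P, Q, R}. \<not> [:- a, 1:] ^ Suc n dvd A"
    using exists_common_multiplicity[of P "{P, Q, R}" a] P by blast
  then obtain P' Q' R' where
    PQR: "P = [:- a, 1:] ^ n * P'" "Q = [:- a, 1:] ^ n * Q'" "R = [:- a, 1:] ^ n * R'"
    by (auto simp: dvd_def)
  have nonzero: "poly P' a \<noteq> 0 \<or> poly Q' a \<noteq> 0 \<or> poly R' a \<noteq> 0"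
  proof (rule ccontr)
    assume "\<not> ?thesis"
    then have "[:- a, 1:] dvd P'" "[:- a, 1:] dvd Q'" "[:- a, 1:] dvd R'"
      by (simp_all add: poly_eq_0_iff_dvd)
    then have "[:- a, 1:] ^ Suc n dvd P" "[:- a, 1:] ^ Suc n dvd Q" "[:- a, 1:] ^ Suc n dvd R"
      unfolding PQR power_Suc2 by - (rule mult_dvd_mono[OF dvd_refl], assumption)+
    with n(2) show False by auto
  qed
  have "x - \<iota> a \<noteq> 0" using x_nonconst by auto
  have "(x - \<iota> a) ^ n * (ev x P' * f ^ 2 + ev x Q' * f + ev x R') = 0"
    using rel unfolding PQR ev_mult ev_power ev_linear by (simp add: algebra_simps)
  then have rel': "ev x P' * f ^ 2 + ev x Q' * f + ev x R' = 0"
    using \<open>x - \<iota> a \<noteq> 0\<close> by simp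
  let ?S = "[:poly R' a, poly Q' a, poly P' a:]"
  have "ev f ?S = (\<iota> (poly P' a) - ev x P') * f ^ 2 + (\<iota> (poly Q' a) - ev x Q') * f
      + (\<iota> (poly R' a) - ev x R')"
    using rel' by (simp add: ev_pCons power2_eq_square algebra_simps)
  moreover have small: "val_ge v 1 ((\<iota> (poly A a) - ev x A) * g)" if "val_ge v 0 g" for A g
    using val_ge_mult0[OF v that] ev_value[OF v a, of A]
    by (subst mult.commute) (metis minus_diff_eq val_ge_minus[OF v])
  moreover have "val_ge v 0 (f ^ 2)"
    using val_ge_mult0[OF v f f] by (simp add: power2_eq_square)
  ultimately have "val_ge v 1 (ev f ?S)"
    using small[of 1 R'] f val_ge_const[OF v, of 1] by (simp add: val_ge_add[OF v] hom_one)
  moreover have "ev f ?S \<noteq> 0 \<and> v (ev f ?S) = 0"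
    using no nonzero by (intro ev_unit_of_no_residue[OF v f]) auto
  ultimately show False by (simp add: val_ge_def)
qed

context
  fixes a :: 'k
begin

abbreviation above :: "('f \<Rightarrow> int) set" where
  "above \<equiv> {v \<in> places \<iota>. val_ge v 1 (x - \<iota> a)}"

lemma place_pos: "v \<in> above \<Longrightarrow> 0 < v (x - \<iota> a)"
  using x_nonconst by (auto simp: val_ge_def)

lemma above_conj: "v \<in> above \<Longrightarrow> v \<circ> \<sigma> \<in> above"
  using place_conj by (auto simp: val_ge_def \<sigma>_diff \<sigma>_x \<sigma>_const)

text \<open>
  At a simple zero of \<open>G\<close> the order of \<open>x - a\<close> is twice that of \<open>y\<close>.  Measured in units of \<open>v y\<close>,
  the orders of \<open>A(x)\<close> and \<open>B(x) y\<close> have different parity, so they cannot cancel and the order of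
  \<open>(A + B y) / C\<close> is determined by \<open>A\<close>, \<open>B\<close> and \<open>C\<close>.
\<close>

lemma ramified_place:
  assumes G: "mult_at a G = 1" and v: "v \<in> above"
  shows "v (x - \<iota> a) = 2" and "w \<in> above \<Longrightarrow> w = v"
proof -
  have half: "v (x - \<iota> a) = 2 * v y" if "v \<in> above" for v
  proof -
    have v: "v \<in> places \<iota>" "val_ge v 1 (x - \<iota> a)" using that by auto
    have "2 * v y = v (ev x G)"
      using y_sq y_nonzero place_power[OF v(1), of y 2] by simp
    also have "\<dots> = v (x - \<iota> a)"
      using place_ev[OF v(1) x_nonconst v(2) G_nonzero] G by simp
    finally show ?thesis by simp
  qed
  have scaled: "\<exists>\<kappa>. \<forall>v\<in>above. v f = v y * \<kappa>" if "f \<noteq> 0" for f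
  proof -
    obtain A B C where C: "C \<noteq> 0" and f: "f * ev x C = ev x A + ev x B * y"
      using coordinates by blast
    define \<alpha> where "\<alpha> = 2 * int (mult_at a A)"
    define \<beta> where "\<beta> = 2 * int (mult_at a B) + 1"
    define \<kappa> where
      "\<kappa> = (if A = 0 then \<beta> else if B = 0 then \<alpha> else min \<alpha> \<beta>) - 2 * int (mult_at a C)"
    have "v f = v y * \<kappa>" if "v \<in> above" for v
    proof -
      have v: "v \<in> places \<iota>" "val_ge v 1 (x - \<iota> a)" using that by auto
      have pos: "0 < v y" using half[OF that] place_pos[OF that] by simp
      have ev: "v (ev x D) = 2 * int (mult_at a D) * v y" "ev x D \<noteq> 0" if "D \<noteq> 0" for D
        using place_ev[OF v(1) x_nonconst v(2) that] half[OF \<open>v \<in> above\<close>] ev_nonzero[OF x_nonconst that]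
        by simp_all
      have A: "ev x A \<noteq> 0" "v (ev x A) = \<alpha> * v y" if "A \<noteq> 0"
        using ev[OF that] by (simp_all add: \<alpha>_def)
      have B: "ev x B * y \<noteq> 0" "v (ev x B * y) = \<beta> * v y" if "B \<noteq> 0"
        using ev[OF that] y_nonzero by (simp_all add: \<beta>_def place_mult[OF v(1)] algebra_simps)
      have "\<alpha> \<noteq> \<beta>" unfolding \<alpha>_def \<beta>_def by presburger
      have "ev x A + ev x B * y \<noteq> 0" using f C \<open>f \<noteq> 0\<close> ev(2) by (metis mult_eq_0_iff)
      then have "v (ev x A + ev x B * y)
          = (if A = 0 then \<beta> else if B = 0 then \<alpha> else min \<alpha> \<beta>) * v y"
      proof -
        consider "A = 0" "B \<noteq> 0" | "B = 0" "A \<noteq> 0" | "A \<noteq> 0" "B \<noteq> 0" "\<alpha> < \<beta>" | "A \<noteq> 0" "B \<noteq> 0" "\<beta> < \<alpha>"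
          using \<open>ev x A + ev x B * y \<noteq> 0\<close> \<open>\<alpha> \<noteq> \<beta>\<close> by fastforce
        then show ?thesis
        proof cases
          case 3
          have "\<alpha> * v y < \<beta> * v y" using 3 pos by simp
          then have "val_ge v (v (ev x A) + 1) (ev x B * y)"
            using A B 3 by (simp add: val_ge_def)
          with place_add_dominant(2)[OF v(1) A(1)] 3 A(2) show ?thesis by simp
        next
          case 4
          have "\<beta> * v y < \<alpha> * v y" using 4 pos by simp
          then have "val_ge v (v (ev x B * y) + 1) (ev x A)"
            using A B 4 by (simp add: val_ge_def)
          with place_add_dominant(2)[OF v(1) B(1)] 4 B(2) show ?thesis by (simp add: add.commute)
        qed (use A B in auto)
      qed
      moreover have "v f + v (ev x C) = v (ev x A + ev x B * y)"
        using place_mult[OF v(1) \<open>f \<noteq> 0\<close> ev(2)[OF C]] f by simp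
      ultimately show ?thesis using ev(1)[OF C] by (simp add: \<kappa>_def algebra_simps)
    qed
    then show ?thesis by blast
  qed
  have pos: "0 < v y" if "v \<in> above" for v
    using half[OF that] place_pos[OF that] by simp
  have sub: "above \<subseteq> places \<iota>" by auto
  have "v y = 1"
    by (rule places_eq_of_proportional(1)[where S = above and h = "\<lambda>v. v y", OF sub])
      (use pos scaled v in blast)+
  then show "v (x - \<iota> a) = 2" using half[OF v] by simp
  show "w \<in> above \<Longrightarrow> w = v"
    by (rule places_eq_of_proportional(2)[where S = above and h = "\<lambda>v. v y", OF sub])
      (use pos scaled v in blast)+
qed

text \<open>
  Where \<open>G(a) = b\<^sup>2 \<noteq> 0\<close>, a place over \<open>a\<close> selects one of the values \<open>\<plusminus> b\<close> of \<open>y\<close>.  After removal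
  of powers of \<open>x - a\<close>, an element \<open>u = A' + B' y\<close> and its conjugate cannot both vanish there.
  So either \<open>u\<close> is a unit or its order is that of its norm, which is a polynomial in \<open>x\<close>; the
  order is therefore the same multiple of \<open>v (x - a)\<close> for all places with the same sign.
\<close>

lemma split_place:
  assumes b: "b ^ 2 = poly G a" "b \<noteq> 0"
    and v: "v \<in> above" "val_ge v 1 (y - \<iota> b)"
  shows "v (x - \<iota> a) = 1" and "w \<in> above \<Longrightarrow> val_ge w 1 (y - \<iota> b) \<Longrightarrow> w = v"
proof -
  let ?S = "{v \<in> above. val_ge v 1 (y - \<iota> b)}"
  have scaled: "\<exists>\<kappa>. \<forall>v\<in>?S. v f = v (x - \<iota> a) * \<kappa>" if "f \<noteq> 0" for f
  proof -
    obtain A B C where C: "C \<noteq> 0" and f: "f * ev x C = ev x A + ev x B * y"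
      using coordinates by blast
    have "A \<noteq> 0 \<or> B \<noteq> 0"
      using f that ev_nonzero[OF x_nonconst C] by fastforce
    then obtain n where n: "\<forall>D\<in>{A, B}. [:- a, 1:] ^ n dvd D"
        "\<exists>D\<in>{A, B}. \<not> [:- a, 1:] ^ Suc n dvd D"
      using exists_common_multiplicity[of A "{A, B}" a] exists_common_multiplicity[of B "{A, B}" a]
      by blast
    then obtain A' B' where AB: "A = [:- a, 1:] ^ n * A'" "B = [:- a, 1:] ^ n * B'"
      by (auto simp: dvd_def)
    have nonzero: "poly A' a \<noteq> 0 \<or> poly B' a \<noteq> 0"
    proof (rule ccontr)
      assume "\<not> ?thesis"
      then have "[:- a, 1:] dvd A'" "[:- a, 1:] dvd B'"
        by (simp_all add: poly_eq_0_iff_dvd)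
      then have "[:- a, 1:] ^ Suc n dvd A" "[:- a, 1:] ^ Suc n dvd B"
        unfolding AB power_Suc2 by - (rule mult_dvd_mono[OF dvd_refl], assumption)+
      with n(2) show False by auto
    qed
    \<comment> \<open>\<open>P\<close> takes at \<open>a\<close> the value of \<open>u\<close>, and \<open>N\<close> is the norm of \<open>u\<close>.\<close>
    define u where "u = ev x A' + ev x B' * y"
    define N where "N = A' ^ 2 - B' ^ 2 * G"
    define P where "P = A' + smult b B'"
    define \<kappa> where
      "\<kappa> = int n - int (mult_at a C) + (if poly P a \<noteq> 0 then 0 else int (mult_at a N))"
    have fC: "f * ev x C = (x - \<iota> a) ^ n * u"
      using f unfolding AB u_def ev_mult ev_power ev_linear by (simp add: algebra_simps)
    have xa: "x - \<iota> a \<noteq> 0" using x_nonconst by auto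
    have u0: "u \<noteq> 0" using fC that ev_nonzero[OF x_nonconst C] by force
    have norm_u: "u * \<sigma> u = ev x N"
    proof -
      have "u * \<sigma> u = ev x A' ^ 2 - ev x B' ^ 2 * y ^ 2"
        by (simp add: u_def \<sigma>_add \<sigma>_mult \<sigma>_ev \<sigma>_y power2_eq_square algebra_simps)
      then show ?thesis by (simp add: N_def y_sq ev_diff ev_mult ev_power)
    qed
    have N0: "N \<noteq> 0" using u0 norm_u by auto
    have "v f = v (x - \<iota> a) * \<kappa>" if "v \<in> ?S" for v
    proof -
      have v: "v \<in> places \<iota>" "val_ge v 1 (x - \<iota> a)" "val_ge v 1 (y - \<iota> b)" using that by auto
      have small: "val_ge v 1 (ev x D * (y - \<iota> b))" for D
        using val_ge_mult0[OF v(1) val_ge_ev[OF v(1) val_ge_of_value[OF v(1,2)]] v(3)] .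
      have vu: "v u = v (x - \<iota> a) * (if poly P a \<noteq> 0 then 0 else int (mult_at a N))"
      proof (cases "poly P a = 0")
        case False
        have "u = ev x P + ev x B' * (y - \<iota> b)"
          by (simp add: u_def P_def ev_add ev_smult algebra_simps)
        with place_add_dominant(2)[OF v(1) ev_unit(1)[OF v(1,2) False]] small False
        show ?thesis by (simp add: ev_unit(2)[OF v(1,2) False])
      next
        case True
        define Q where "Q = A' - smult b B'"
        have Q: "poly Q a \<noteq> 0"
        proof
          assume "poly Q a = 0"
          with True have "poly A' a + b * poly B' a = 0" "poly A' a = b * poly B' a"
            by (simp_all add: P_def Q_def)
          then have "2 * poly A' a = 0" "2 * (b * poly B' a) = 0"
            by simp_all
          with nonzero b(2) show False by simp
        qed
        have "\<sigma> u = ev x Q + ev x (- B') * (y - \<iota> b)"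
          by (simp add: u_def Q_def ev_diff ev_smult ev_minus \<sigma>_add \<sigma>_mult \<sigma>_ev \<sigma>_y algebra_simps)
        then have "v (\<sigma> u) = 0"
          using place_add_dominant(2)[OF v(1) ev_unit(1)[OF v(1,2) Q]] small
          by (simp add: ev_unit(2)[OF v(1,2) Q])
        moreover have "v u + v (\<sigma> u) = v (ev x N)"
          using place_mult[OF v(1) u0, of "\<sigma> u"] u0 norm_u by simp
        ultimately show ?thesis
          using place_ev[OF v(1) x_nonconst v(2) N0] True by simp
      qed
      have "v f + v (ev x C) = int n * v (x - \<iota> a) + v u"
        using place_mult[OF v(1) \<open>f \<noteq> 0\<close> ev_nonzero[OF x_nonconst C]] fC xa u0
        by (simp add: place_mult[OF v(1)] place_power[OF v(1)])
      then show ?thesis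
        using vu place_ev[OF v(1) x_nonconst v(2) C] by (simp add: \<kappa>_def algebra_simps)
    qed
    then show ?thesis by blast
  qed
  have S: "?S \<subseteq> places \<iota>" and v': "v \<in> ?S" using v by auto
  have pos: "0 < v (x - \<iota> a)" if "v \<in> ?S" for v using that place_pos by simp
  show "v (x - \<iota> a) = 1"
    by (rule places_eq_of_proportional(1)[where S = ?S and h = "\<lambda>v. v (x - \<iota> a)", OF S])
      (use pos scaled v' in blast)+
  show "w = v" if "w \<in> above" "val_ge w 1 (y - \<iota> b)"
    by (rule places_eq_of_proportional(2)[where S = ?S and h = "\<lambda>v. v (x - \<iota> a)", OF S])
      (use pos scaled v' that in blast)+
qed

lemma places_above:
  assumes G: "mult_at a G \<le> 1" and v: "v \<in> above"
  shows "v (x - \<iota> a) = (if v \<circ> \<sigma> = v then 2 else 1)"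
    and "v \<circ> \<sigma> = v \<longleftrightarrow> poly G a = 0"
    and "w \<in> above \<Longrightarrow> w = v \<or> w = v \<circ> \<sigma>"
proof -
  have "v (x - \<iota> a) = (if v \<circ> \<sigma> = v then 2 else 1) \<and> (v \<circ> \<sigma> = v \<longleftrightarrow> poly G a = 0) \<and>
    (\<forall>w\<in>above. w = v \<or> w = v \<circ> \<sigma>)"
  proof (cases "poly G a = 0")
    case True
    then have "mult_at a G = 1" using G G_nonzero order_root[of G a] by simp
    note * = ramified_place[OF this v]
    from *(2)[OF above_conj[OF v]] *(1) *(2) True show ?thesis by auto
  next
    case False
    obtain b where b: "b ^ 2 = poly G a" using nth_root_exists[of 2] by auto
    with False have b0: "b \<noteq> 0" by auto
    \<comment> \<open>\<open>s v c\<close> says that \<open>y\<close> takes the value \<open>c\<close> at \<open>v\<close>; conjugation changes the sign of \<open>c\<close>.\<close>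
    define s where "s v c \<longleftrightarrow> val_ge v 1 (y - \<iota> c)" for v c
    have dich: "s w b \<or> s w (- b)" if "w \<in> above" for w
    proof (rule ccontr)
      assume no: "\<not> (s w b \<or> s w (- b))"
      have w: "w \<in> places \<iota>" "val_ge w 1 (x - \<iota> a)" using that by auto
      have "(y - \<iota> b) * (y - \<iota> (- b)) = ev x G - \<iota> (poly G a)"
        using y_sq by (simp add: const_minus power2_eq_square algebra_simps hom_mult flip: b)
      then have "val_ge w 1 ((y - \<iota> b) * (y - \<iota> (- b)))"
        using ev_value[OF w] by simp
      with no show False
        by (auto simp: s_def val_ge_def place_mult[OF w(1)])
    qed
    have swap: "s (w \<circ> \<sigma>) c \<longleftrightarrow> s w (- c)" if "w \<in> above" for w c
    proof -
      have w: "w \<in> places \<iota>" using that by simp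
      have "\<sigma> (y - \<iota> c) = - (y - \<iota> (- c))"
        by (simp add: \<sigma>_diff \<sigma>_y \<sigma>_const const_minus)
      moreover have "(y - \<iota> c = 0) = (\<sigma> (y - \<iota> c) = 0)"
        by (rule \<sigma>_eq_0_iff[symmetric])
      ultimately show ?thesis
        by (simp add: s_def val_ge_def place_minus[OF w] del: \<sigma>_eq_0_iff minus_diff_eq)
    qed
    have excl: "\<not> (s w b \<and> s w (- b))" if "w \<in> above" for w
    proof
      have w: "w \<in> places \<iota>" using that by simp
      assume "s w b \<and> s w (- b)"
      then have "val_ge w 1 ((y - \<iota> (- b)) - (y - \<iota> b))"
        unfolding s_def by (metis val_ge_diff[OF w])
      then have "val_ge w 1 (\<iota> (2 * b))"
        by (simp add: const_minus hom_mult const_2)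
      with b0 show False by (simp add: val_ge_def place_const[OF w])
    qed
    obtain c where c: "c = b \<or> c = - b" and vc: "s v c"
      using dich[OF v] by auto
    then have c2: "c ^ 2 = poly G a" "c \<noteq> 0" and c': "- c = b \<or> - c = - b" using b b0 by auto
    note * = split_place[OF c2 v vc[unfolded s_def]]
    have "v \<circ> \<sigma> \<noteq> v"
      using swap[OF v, of "- c"] vc excl[OF v] c by auto
    moreover have "w = v \<or> w = v \<circ> \<sigma>" if w: "w \<in> above" for w
    proof (cases "s w c")
      case True
      then show ?thesis using *(2)[OF w] by (simp add: s_def)
    next
      case False
      then have "s w (- c)" using dich[OF w] c by fastforce
      then have "s (w \<circ> \<sigma>) c" using swap[OF w, of c] by blast
      then have "w \<circ> \<sigma> = v" using *(2)[OF above_conj[OF w]] by (simp add: s_def)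
      then show ?thesis by (simp add: conj_eq_iff)
    qed
    ultimately show ?thesis using *(1) False by auto
  qed
  then show "v (x - \<iota> a) = (if v \<circ> \<sigma> = v then 2 else 1)"
    and "v \<circ> \<sigma> = v \<longleftrightarrow> poly G a = 0"
    and "w \<in> above \<Longrightarrow> w = v \<or> w = v \<circ> \<sigma>"
    by auto
qed

end

section \<open>Places at infinity\<close>

text \<open>
  The points at infinity are the points over \<open>0\<close> of this cover.  Its polynomial is the reversal
  of \<open>G\<close>, with an extra factor \<open>X\<close> when \<open>deg G\<close> is odd; it has a simple zero at \<open>0\<close> in that case
  and none otherwise.
\<close>

lemma cover_at_infinity:
  defines "m \<equiv> (degree G + 1) div 2"
  shows "quadratic_cover \<iota> (inverse x) (y / x ^ m) (monom 1 (2 * m - degree G) * reflect_poly G) \<sigma>"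
proof
  have x0: "x \<noteq> 0" using x_nonconst by (metis const_0 rangeI)
  have K: "simple_subfield \<iota> (inverse x) = simple_subfield \<iota> x"
    using simple_subfield_mobius[of x 0] by simp
  show "inverse x \<notin> range \<iota>"
    using mobius_nonconst[OF x_nonconst, of 0] by simp
  show "y / x ^ m \<noteq> 0"
    using x0 y_nonzero by simp
  have *: "ev (inverse x) (reflect_poly G) = ev x G / x ^ degree G"
  proof -
    have "map_poly \<iota> (reflect_poly G) = reflect_poly (map_poly \<iota> G)"
      by (intro poly_eqI) (simp add: coeff_map_poly coeff_reflect_poly degree_map_poly)
    then show ?thesis
      using poly_reflect_poly_nz[of "inverse x" "map_poly \<iota> G"] x0
      by (simp add: ev_def degree_map_poly field_simps)
  qed
  have "degree G \<le> 2 * m" by (simp add: m_def)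
  then have pow: "x ^ (m * 2) = x ^ (2 * m - degree G) * x ^ degree G"
    by (simp add: mult.commute flip: power_add)
  have "(y / x ^ m)\<^sup>2 = ev x G / x ^ (m * 2)"
    by (simp add: power_divide y_sq power_mult)
  also have "\<dots> = ev (inverse x) (monom 1 (2 * m - degree G) * reflect_poly G)"
    by (simp add: pow ev_mult ev_monom hom_one * power_inverse inverse_mult_distrib
        field_class.field_divide_inverse mult_ac)
  finally show "(y / x ^ m)\<^sup>2 = ev (inverse x) (monom 1 (2 * m - degree G) * reflect_poly G)" .
  show "\<exists>a\<in>simple_subfield \<iota> (inverse x). \<exists>b\<in>simple_subfield \<iota> (inverse x). f = a + b * (y / x ^ m)" for f
  proof -
    obtain a b where "a \<in> simple_subfield \<iota> x" "b \<in> simple_subfield \<iota> x" "f = a + b * y"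
      using span by blast
    then show ?thesis unfolding K using x0
      by (intro bexI[of _ a] bexI[of _ "b * x ^ m"]) (simp_all add: simple_subfield_closed)
  qed
  have inv: "\<sigma> (inverse x) = inverse x"
    by (intro \<sigma>_fixes simple_subfield_closed)
  show "\<sigma> (inverse x) = inverse x" by (rule inv)
  have "\<sigma> (inverse x ^ m) = inverse x ^ m"
    by (intro \<sigma>_fixes simple_subfield_closed)
  then show "\<sigma> (y / x ^ m) = - (y / x ^ m)"
    by (simp add: divide_inverse \<sigma>_mult \<sigma>_y power_inverse)
qed (simp_all add: \<sigma>_add \<sigma>_mult \<sigma>_const)

lemma above_infinity_iff:
  assumes v: "v \<in> places \<iota>"
  shows "val_ge v 1 (inverse x - \<iota> 0) \<longleftrightarrow> v x < 0"
proof -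
  have "x \<noteq> 0" using x_nonconst by (metis const_0 rangeI)
  then show ?thesis by (auto simp: val_ge_def place_inverse[OF v])
qed

lemma places_at_infinity:
  assumes v: "v \<in> places \<iota>" "v x < 0"
  shows "v x = - (if v \<circ> \<sigma> = v then 2 else 1)"
    and "v \<circ> \<sigma> = v \<longleftrightarrow> odd (degree G)"
    and "w \<in> places \<iota> \<Longrightarrow> w x < 0 \<Longrightarrow> w = v \<or> w = v \<circ> \<sigma>"
proof -
  define m where "m = (degree G + 1) div 2"
  define G' where "G' = monom 1 (2 * m - degree G) * reflect_poly G"
  interpret inf: quadratic_cover \<iota> "inverse x" "y / x ^ m" G' \<sigma>
    using cover_at_infinity by (simp add: m_def G'_def)
  have "mult_at 0 G' = 2 * m - degree G"
    using G_nonzero order_0I[of "reflect_poly G" 0] order_mult[of "monom 1 (2 * m - degree G)" "reflect_poly G" 0]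
    by (simp add: G'_def monom_eq_0_iff)
  then have le: "mult_at 0 G' \<le> 1" and root: "poly G' 0 = 0 \<longleftrightarrow> odd (degree G)"
    using inf.G_nonzero by (simp_all add: m_def order_root) presburger+
  have v': "v \<in> inf.above 0" using v above_infinity_iff by simp
  note * = inf.places_above[OF le v']
  show "v x = - (if v \<circ> \<sigma> = v then 2 else 1)"
    using *(1) place_inverse[OF v(1), of x] by simp
  show "v \<circ> \<sigma> = v \<longleftrightarrow> odd (degree G)" using *(2) root by simp
  show "w \<in> places \<iota> \<Longrightarrow> w x < 0 \<Longrightarrow> w = v \<or> w = v \<circ> \<sigma>"
    using *(3)[of w] above_infinity_iff[of w] by simp
qed

lemma residue:
  assumes v: "v \<in> places \<iota>" and f: "val_ge v 0 f"
  shows "\<exists>c. val_ge v 1 (f - \<iota> c)"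
  using finite_or_infinite_place[OF v]
proof
  assume "v x < 0"
  interpret inf: quadratic_cover \<iota> "inverse x" "y / x ^ ((degree G + 1) div 2)"
    "monom 1 (2 * ((degree G + 1) div 2) - degree G) * reflect_poly G" \<sigma>
    by (rule cover_at_infinity)
  show ?thesis
    using inf.residue_finite[OF v _ f] above_infinity_iff[OF v] \<open>v x < 0\<close> by blast
next
  assume "\<exists>a. val_ge v 1 (x - \<iota> a)"
  then show ?thesis using residue_finite[OF v _ f] by blast
qed

end

section \<open>A field of degree two over \<open>k(x)\<close> is a quadratic cover\<close>

context function_field
begin

text \<open>
  If \<open>b1, b2\<close> is a basis, then \<open>b2 / b1\<close> together with \<open>1\<close> is one as well.
\<close>

lemma degree_two_generator:
  assumes "has_ext_degree (simple_subfield \<iota> x) 2"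
  shows "\<exists>w. w \<notin> simple_subfield \<iota> x \<and>
    (\<forall>f. \<exists>a\<in>simple_subfield \<iota> x. \<exists>b\<in>simple_subfield \<iota> x. f = a + b * w)"
proof -
  let ?K = "simple_subfield \<iota> x"
  obtain B where B: "basis_over ?K B" "card B = 2"
    using assms by (auto simp: has_ext_degree_def)
  then obtain b1 b2 where b: "B = {b1, b2}" "b1 \<noteq> b2" by (auto simp: card_2_iff)
  have ex: "\<exists>c1\<in>?K. \<exists>c2\<in>?K. z = c1 * b1 + c2 * b2" for z
  proof -
    have "\<exists>!c. c ` B \<subseteq> ?K \<and> (\<forall>b. b \<notin> B \<longrightarrow> c b = 0) \<and> z = (\<Sum>b\<in>B. c b * b)"
      using B(1) by (simp add: basis_over_def)
    from ex1_implies_ex[OF this] obtain c where c: "c ` B \<subseteq> ?K" "z = (\<Sum>b\<in>B. c b * b)"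
      by (elim exE conjE)
    have "c b1 \<in> ?K" "c b2 \<in> ?K" using c(1) by (auto simp: b)
    moreover have "z = c b1 * b1 + c b2 * b2" using c(2) b(2) by (simp add: b(1))
    ultimately show ?thesis by blast
  qed
  have uniq: "c1 = d1 \<and> c2 = d2"
    if "c1 \<in> ?K" "c2 \<in> ?K" "d1 \<in> ?K" "d2 \<in> ?K" "c1 * b1 + c2 * b2 = d1 * b1 + d2 * b2"
    for c1 c2 d1 d2
  proof -
    define c where "c = (\<lambda>z. if z = b1 then c1 else if z = b2 then c2 else 0)"
    define d where "d = (\<lambda>z. if z = b1 then d1 else if z = b2 then d2 else 0)"
    define P where
      "P e \<longleftrightarrow> e ` B \<subseteq> ?K \<and> (\<forall>b. b \<notin> B \<longrightarrow> e b = 0) \<and> c1 * b1 + c2 * b2 = (\<Sum>b\<in>B. e b * b)" for e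
    have "\<exists>!e. P e"
      using B(1) by (simp add: basis_over_def P_def)
    moreover have "P c"
      using that(1,2) b(2) by (simp add: P_def c_def b(1))
    moreover have "P d"
      using that(3,4) b(2) by (simp add: P_def d_def b(1) that(5))
    ultimately have "c = d" by blast
    then have "c b1 = d b1" "c b2 = d b2" by simp_all
    then show ?thesis using b(2) by (auto simp: c_def d_def)
  qed
  have b1: "b1 \<noteq> 0"
    using uniq[of 1 0 0 0] by (auto simp: simple_subfield_closed)
  show ?thesis
  proof (intro exI[of _ "b2 / b1"] conjI allI)
    show "b2 / b1 \<notin> ?K"
      using uniq[of "b2 / b1" 0 0 1] b1 by (auto simp: simple_subfield_closed)
    fix f
    obtain c1 c2 where c: "c1 \<in> ?K" "c2 \<in> ?K" "f * b1 = c1 * b1 + c2 * b2" using ex by blast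
    then have "f = c1 + c2 * (b2 / b1)" using b1 by (simp add: field_simps)
    with c show "\<exists>a\<in>?K. \<exists>b\<in>?K. f = a + b * (b2 / b1)" by blast
  qed
qed

text \<open>
  Completing the square and clearing the denominator produces an element \<open>y\<close> outside \<open>k(x)\<close>
  whose square is a polynomial in \<open>x\<close>.  A polynomial of least degree arising so is squarefree, since a factor \<open>(X - a)\<^sup>2\<close> could be
  removed by dividing \<open>y\<close> by \<open>x - a\<close>.
\<close>

lemma exists_quadratic_cover:
  assumes x: "x \<notin> range \<iota>" and deg2: "has_ext_degree (simple_subfield \<iota> x) 2"
  shows "\<exists>y G \<sigma>. quadratic_cover \<iota> x y G \<sigma> \<and> (\<forall>a. mult_at a G \<le> 1)"
proof -
  let ?K = "simple_subfield \<iota> x"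
  obtain w where w: "w \<notin> ?K" and gen: "\<And>f. \<exists>a\<in>?K. \<exists>b\<in>?K. f = a + b * w"
    using degree_two_generator[OF deg2] by blast
  define root where "root G \<longleftrightarrow> (\<exists>y. y \<notin> ?K \<and> y ^ 2 = ev x G)" for G
  have "\<exists>G. root G"
  proof -
    obtain a b where ab: "a \<in> ?K" "b \<in> ?K" "w ^ 2 = a + b * w" using gen by blast
    define h where "h = b / 2"
    have h: "h \<in> ?K" "b = h + h"
      using ab two_neq_0 by (simp_all add: h_def simple_subfield_closed flip: mult_2)
    define z where "z = w - h"
    have "z ^ 2 = a + h ^ 2"
      using ab(3) by (simp add: z_def h(2) power2_eq_square algebra_simps)
    then have "z ^ 2 \<in> ?K" using ab h(1) by (simp add: simple_subfield_closed)
    then obtain A C where AC: "ev x C \<noteq> 0" "z ^ 2 = ev x A / ev x C"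
      unfolding simple_subfield_iff by blast
    have "ev x C * z \<notin> ?K"
    proof
      assume "ev x C * z \<in> ?K"
      then have "ev x C * z / ev x C + h \<in> ?K"
        using h(1) by (intro simple_subfield_add simple_subfield_divide simple_subfield_ev)
      moreover have "ev x C * z / ev x C + h = w"
        using AC(1) by (simp add: z_def)
      ultimately show False using w by metis
    qed
    moreover have "(ev x C * z) ^ 2 = ev x (C * A)"
      using AC(1) unfolding power_mult_distrib AC(2) by (simp add: ev_mult power2_eq_square)
    ultimately show ?thesis unfolding root_def by blast
  qed
  then obtain G where G: "root G" and min: "\<And>G'. root G' \<Longrightarrow> degree G \<le> degree G'"
    using exists_least_iff[of "\<lambda>n. \<exists>G. root G \<and> degree G = n"] by (metis not_le)
  obtain y where y: "y \<notin> ?K" "y ^ 2 = ev x G" using G by (auto simp: root_def)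
  have y0: "y \<noteq> 0" using y simple_subfield_0 by metis
  then have G0: "G \<noteq> 0" using y by auto
  have squarefree: "mult_at a G \<le> 1" for a
  proof (rule ccontr)
    assume "\<not> mult_at a G \<le> 1"
    then have "[:- a, 1:] ^ 2 dvd G" by (simp add: order_divides)
    then obtain H where H: "G = [:- a, 1:] ^ 2 * H" by (auto simp: dvd_def)
    have xa: "x - \<iota> a \<noteq> 0" using x by auto
    have "y / (x - \<iota> a) \<notin> ?K"
    proof
      assume "y / (x - \<iota> a) \<in> ?K"
      then have "y / (x - \<iota> a) * (x - \<iota> a) \<in> ?K"
        by (intro simple_subfield_mult simple_subfield_diff simple_subfield_self simple_subfield_const)
      then show False using y(1) xa by simp
    qed
    moreover have "(y / (x - \<iota> a)) ^ 2 = ev x H"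
      using y(2) xa unfolding H ev_mult ev_power ev_linear by (simp add: power_divide)
    ultimately have "degree G \<le> degree H" using min by (auto simp: root_def)
    moreover have "degree G = 2 + degree H"
      using G0 unfolding H by (subst degree_mult_eq) (auto simp: degree_power_eq)
    ultimately show False by simp
  qed
  have span: "\<exists>a\<in>?K. \<exists>b\<in>?K. f = a + b * y" for f
  proof -
    obtain c d where cd: "c \<in> ?K" "d \<in> ?K" "y = c + d * w" using gen by blast
    have d0: "d \<noteq> 0" using cd y(1) by auto
    obtain a b where ab: "a \<in> ?K" "b \<in> ?K" "f = a + b * w" using gen by blast
    have "f = (a - b * c / d) + b / d * y" using d0 by (simp add: ab(3) cd(3) field_simps)
    then show ?thesis
      using ab cd by (intro bexI[of _ "a - b * c / d"] bexI[of _ "b / d"]) (simp_all add: simple_subfield_closed)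
  qed
  have unique: "a = c \<and> b = d"
    if "a \<in> ?K" "b \<in> ?K" "c \<in> ?K" "d \<in> ?K" "a + b * y = c + d * y" for a b c d
  proof (cases "b = d")
    case False
    then have "y = (c - a) / (b - d)" using that(5) by (simp add: field_simps)
    then show ?thesis using y(1) that by (simp add: simple_subfield_closed)
  qed (use that in simp)
  obtain \<alpha> \<beta> where \<alpha>: "\<And>f. \<alpha> f \<in> ?K" and \<beta>: "\<And>f. \<beta> f \<in> ?K" and \<alpha>\<beta>: "\<And>f. f = \<alpha> f + \<beta> f * y"
    using span by metis
  define \<sigma> where "\<sigma> f = \<alpha> f - \<beta> f * y" for f
  have \<sigma>_eq: "\<sigma> (a + b * y) = a - b * y" if "a \<in> ?K" "b \<in> ?K" for a b
    using unique[OF \<alpha> \<beta> that, OF \<alpha>\<beta>[symmetric]] by (simp add: \<sigma>_def)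
  have "quadratic_cover \<iota> x y G \<sigma>"
  proof
    show "\<sigma> (f + g) = \<sigma> f + \<sigma> g" for f g
    proof -
      have "f + g = (\<alpha> f + \<alpha> g) + (\<beta> f + \<beta> g) * y"
        by (subst \<alpha>\<beta>[of f], subst \<alpha>\<beta>[of g]) (simp add: algebra_simps)
      then show ?thesis
        using \<sigma>_eq[of "\<alpha> f + \<alpha> g" "\<beta> f + \<beta> g"] \<alpha> \<beta>
        by (simp add: simple_subfield_closed \<sigma>_def[of f] \<sigma>_def[of g] algebra_simps)
    qed
    show "\<sigma> (f * g) = \<sigma> f * \<sigma> g" for f g
    proof -
      have yy: "y * y \<in> ?K" using y(2) by (simp add: simple_subfield_closed power2_eq_square)
      have fg: "f * g = (\<alpha> f * \<alpha> g + \<beta> f * \<beta> g * (y * y)) + (\<alpha> f * \<beta> g + \<beta> f * \<alpha> g) * y"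
        by (subst \<alpha>\<beta>[of f], subst \<alpha>\<beta>[of g]) (simp add: algebra_simps)
      have "\<alpha> f * \<alpha> g + \<beta> f * \<beta> g * (y * y) \<in> ?K" "\<alpha> f * \<beta> g + \<beta> f * \<alpha> g \<in> ?K"
        using \<alpha> \<beta> yy by (simp_all add: simple_subfield_add simple_subfield_mult)
      then have "\<sigma> (f * g) = (\<alpha> f * \<alpha> g + \<beta> f * \<beta> g * (y * y)) - (\<alpha> f * \<beta> g + \<beta> f * \<alpha> g) * y"
        by (simp only: fg \<sigma>_eq)
      then show ?thesis
        by (simp add: \<sigma>_def[of f] \<sigma>_def[of g] algebra_simps)
    qed
    show "\<sigma> (\<iota> c) = \<iota> c" for c
      using \<sigma>_eq[of "\<iota> c" 0] by (simp add: simple_subfield_closed)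
    show "\<sigma> x = x"
      using \<sigma>_eq[of x 0] by (simp add: simple_subfield_closed)
    show "\<sigma> y = - y"
      using \<sigma>_eq[of 0 1] by (simp add: simple_subfield_closed)
  qed (use x y y0 span in auto)
  with squarefree show ?thesis by blast
qed

end

abbreviation lookup where "lookup \<equiv> Poly_Mapping.lookup"

section \<open>Divisors\<close>

lemma divisors_iff: "D \<in> divisors \<iota> \<longleftrightarrow> Poly_Mapping.keys D \<subseteq> places \<iota>"
  by (simp add: divisors_def)

lemma divisors_0 [simp]: "0 \<in> divisors \<iota>"
  and divisors_frag_of [simp]: "frag_of v \<in> divisors \<iota> \<longleftrightarrow> v \<in> places \<iota>"
  by (simp_all add: divisors_iff)

lemma divisors_minus_iff [simp]: "- D \<in> divisors \<iota> \<longleftrightarrow> D \<in> divisors \<iota>"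
  by (simp add: divisors_iff)

lemma divisors_add: "D \<in> divisors \<iota> \<Longrightarrow> E \<in> divisors \<iota> \<Longrightarrow> D + E \<in> divisors \<iota>"
  using Poly_Mapping.keys_add[of D E] by (auto simp: divisors_iff)

lemma divisors_diff: "D \<in> divisors \<iota> \<Longrightarrow> E \<in> divisors \<iota> \<Longrightarrow> D - E \<in> divisors \<iota>"
  using divisors_add[of D \<iota> "- E"] by simp

lemma divisors_cmul: "D \<in> divisors \<iota> \<Longrightarrow> frag_cmul n D \<in> divisors \<iota>"
  using keys_cmul[of n D] by (auto simp: divisors_iff)

lemmas divisors_closed = divisors_add divisors_diff divisors_cmul

lemma lookup_outside: "D \<in> divisors \<iota> \<Longrightarrow> v \<notin> places \<iota> \<Longrightarrow> lookup D v = 0"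
  by (auto simp: divisors_iff Poly_Mapping.in_keys_iff)

lemma divisor_eqI:
  assumes "D \<in> divisors \<iota>" "E \<in> divisors \<iota>" "\<And>v. v \<in> places \<iota> \<Longrightarrow> lookup D v = lookup E v"
  shows "D = E"
  by (intro poly_mapping_eqI) (metis assms lookup_outside)

lemma divisor_degree_sum:
  assumes "finite S" "Poly_Mapping.keys D \<subseteq> S"
  shows "divisor_degree D = (\<Sum>v\<in>S. lookup D v)"
  unfolding divisor_degree_def using assms
  by (intro sum.mono_neutral_left) (auto simp: Poly_Mapping.in_keys_iff)

lemma divisor_degree_0 [simp]: "divisor_degree 0 = 0"
  and divisor_degree_frag_of [simp]: "divisor_degree (frag_of v) = 1"
  by (simp_all add: divisor_degree_def)

lemma divisor_degree_add: "divisor_degree (D + E) = divisor_degree D + divisor_degree E"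
proof -
  let ?S = "Poly_Mapping.keys D \<union> Poly_Mapping.keys E"
  have "divisor_degree F = (\<Sum>v\<in>?S. lookup F v)" if "Poly_Mapping.keys F \<subseteq> ?S" for F
    by (rule divisor_degree_sum) (use that in auto)
  with Poly_Mapping.keys_add[of D E] show ?thesis
    by (simp add: lookup_add sum.distrib)
qed

lemma divisor_degree_minus: "divisor_degree (- D) = - divisor_degree D"
  using divisor_degree_add[of D "- D"] by simp

lemma divisor_degree_diff: "divisor_degree (D - E) = divisor_degree D - divisor_degree E"
  using divisor_degree_add[of D "- E"] by (simp add: divisor_degree_minus)

lemma divisor_degree_cmul: "divisor_degree (frag_cmul n D) = n * divisor_degree D"
proof -
  have "divisor_degree (frag_cmul n D) = (\<Sum>v\<in>Poly_Mapping.keys D. lookup (frag_cmul n D) v)"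
    by (rule divisor_degree_sum) (use keys_cmul in auto)
  then show ?thesis by (simp add: divisor_degree_def sum_distrib_left)
qed

lemmas divisor_degree_simps =
  divisor_degree_add divisor_degree_minus divisor_degree_diff divisor_degree_cmul

definition effective :: "('k::field \<Rightarrow> 'f::field) \<Rightarrow> 'f divisor \<Rightarrow> bool" where
  "effective \<iota> D \<longleftrightarrow> D \<in> divisors \<iota> \<and> (\<forall>v. 0 \<le> lookup D v)"

lemma effectiveI:
  "D \<in> divisors \<iota> \<Longrightarrow> (\<And>v. v \<in> places \<iota> \<Longrightarrow> 0 \<le> lookup D v) \<Longrightarrow> effective \<iota> D"
  unfolding effective_def by (metis lookup_outside order_refl)

lemma effective_add: "effective \<iota> D \<Longrightarrow> effective \<iota> E \<Longrightarrow> effective \<iota> (D + E)"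
  by (simp add: effective_def divisors_add lookup_add)

lemma effective_degree_nonneg: "effective \<iota> D \<Longrightarrow> 0 \<le> divisor_degree D"
  by (simp add: effective_def divisor_degree_def sum_nonneg)

abbreviation point_sum :: "('f \<Rightarrow> int) list \<Rightarrow> 'f divisor" where
  "point_sum ps \<equiv> sum_list (map frag_of ps)"

lemma effective_point_sum: "set ps \<subseteq> places \<iota> \<Longrightarrow> effective \<iota> (point_sum ps)"
  by (induction ps) (auto simp: effective_def lookup_add divisors_add)

lemma degree_point_sum [simp]: "divisor_degree (point_sum ps) = int (length ps)"
  by (induction ps) (simp_all add: divisor_degree_simps)

lemma effective_degree_0:
  assumes "effective \<iota> D" "divisor_degree D = 0"
  shows "D = 0"
proof -
  have "\<forall>v\<in>Poly_Mapping.keys D. lookup D v = 0"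
    using assms by (subst sum_nonneg_eq_0_iff[symmetric]) (auto simp: effective_def divisor_degree_def)
  then show ?thesis by (intro poly_mapping_eqI) (auto simp: Poly_Mapping.in_keys_iff)
qed

lemma effective_obtain_points:
  assumes "effective \<iota> D" "divisor_degree D = int n"
  shows "\<exists>ps. length ps = n \<and> set ps \<subseteq> places \<iota> \<and> D = point_sum ps"
  using assms
proof (induction n arbitrary: D)
  case 0
  then show ?case using effective_degree_0 by auto
next
  case (Suc n)
  then have "D \<noteq> 0" by auto
  then obtain v where v: "v \<in> Poly_Mapping.keys D" by fastforce
  then have "1 \<le> lookup D v" "v \<in> places \<iota>"
    using Suc.prems(1) by (auto simp: effective_def divisors_iff Poly_Mapping.in_keys_iff)
      (metis Poly_Mapping.in_keys_iff int_one_le_iff_zero_less le_less)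
  then have "effective \<iota> (D - frag_of v)" "divisor_degree (D - frag_of v) = int n"
    using Suc.prems by (auto simp: effective_def divisors_diff lookup_minus divisor_degree_simps)
  from Suc.IH[OF this] obtain ps where
    "length ps = n" "set ps \<subseteq> places \<iota>" "D - frag_of v = point_sum ps" by blast
  then show ?case using \<open>v \<in> places \<iota>\<close>
    by (intro exI[of _ "v # ps"]) (auto simp: algebra_simps)
qed

section \<open>Principal divisors\<close>

definition has_div :: "('k::field \<Rightarrow> 'f::field) \<Rightarrow> 'f \<Rightarrow> 'f divisor \<Rightarrow> bool" where
  "has_div \<iota> f D \<longleftrightarrow> D \<in> divisors \<iota> \<and> (\<forall>v\<in>places \<iota>. lookup D v = v f)"

lemma principal_divisors_iff: "D \<in> principal_divisors \<iota> \<longleftrightarrow> (\<exists>f. f \<noteq> 0 \<and> has_div \<iota> f D)"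
  by (auto simp: principal_divisors_def has_div_def)

lemma has_div_unique: "has_div \<iota> f D \<Longrightarrow> has_div \<iota> f E \<Longrightarrow> D = E"
  by (auto simp: has_div_def intro: divisor_eqI)

context function_field
begin

lemma has_div_const: "has_div \<iota> (\<iota> c) 0"
  by (simp add: has_div_def place_const)

lemma has_div_1: "has_div \<iota> 1 0"
  using has_div_const[of 1] by (simp add: hom_one)

lemma has_div_mult:
  "f \<noteq> 0 \<Longrightarrow> g \<noteq> 0 \<Longrightarrow> has_div \<iota> f D \<Longrightarrow> has_div \<iota> g E \<Longrightarrow> has_div \<iota> (f * g) (D + E)"
  by (simp add: has_div_def divisors_add lookup_add place_mult)

lemma has_div_inverse: "has_div \<iota> f D \<Longrightarrow> has_div \<iota> (inverse f) (- D)"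
  by (simp add: has_div_def place_inverse)

lemma principal_0: "0 \<in> principal_divisors \<iota>"
  unfolding principal_divisors_iff using has_div_1 by (intro exI[of _ 1]) simp

lemma principal_add:
  "D \<in> principal_divisors \<iota> \<Longrightarrow> E \<in> principal_divisors \<iota> \<Longrightarrow> D + E \<in> principal_divisors \<iota>"
  unfolding principal_divisors_iff by (metis has_div_mult mult_eq_0_iff)

lemma principal_minus: "D \<in> principal_divisors \<iota> \<Longrightarrow> - D \<in> principal_divisors \<iota>"
  unfolding principal_divisors_iff by (metis has_div_inverse inverse_nonzero_iff_nonzero)

section \<open>Dimensions of Riemann-Roch spaces\<close>

sublocale VS: vector_space "\<lambda>c z. \<iota> c * z"
  by (rule vector_space_constants)

lemma card_le_of_independent_family:
  fixes b :: "'i \<Rightarrow> 'f"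
  assumes I: "finite I" and T: "finite T" and sub: "b ` I \<subseteq> VS.span T"
    and indep: "\<And>c. (\<Sum>i\<in>I. \<iota> (c i) * b i) = 0 \<Longrightarrow> \<forall>i\<in>I. c i = 0"
  shows "card I \<le> card T"
proof -
  have inj: "inj_on b I"
  proof (rule inj_onI, rule ccontr)
    fix i j assume ij: "i \<in> I" "j \<in> I" "b i = b j" "i \<noteq> j"
    define c :: "'i \<Rightarrow> 'k" where "c k = (if k = i then 1 else if k = j then - 1 else 0)" for k
    have "(\<Sum>k\<in>I. \<iota> (c k) * b k) = (\<Sum>k\<in>{i, j}. \<iota> (c k) * b k)"
      using I ij by (intro sum.mono_neutral_right) (auto simp: c_def)
    also have "\<dots> = 0" using ij by (simp add: c_def const_minus hom_one)
    finally have "c i = 0" using indep ij by blast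
    then show False by (simp add: c_def)
  qed
  have "VS.independent (b ` I)"
  proof (rule VS.independent_if_scalars_zero)
    fix u z assume "(\<Sum>z\<in>b ` I. \<iota> (u z) * z) = 0" "z \<in> b ` I"
    then have "(\<Sum>i\<in>I. \<iota> ((u \<circ> b) i) * b i) = 0" by (simp add: sum.reindex[OF inj])
    then show "u z = 0" using indep \<open>z \<in> b ` I\<close> by fastforce
  qed (use I in simp)
  from VS.independent_span_bound[OF T this sub] show ?thesis
    by (simp add: card_image[OF inj])
qed

lemma ev_sum_monom: "ev x (\<Sum>i<n. monom (c i) i) = (\<Sum>i<n. \<iota> (c i) * x ^ i)"
  by (induction n) (simp_all add: ev_add ev_monom)

lemma coeff_sum_monom: "i < n \<Longrightarrow> coeff (\<Sum>i<n. monom (c i) i) i = c i"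
  by (simp add: coeff_sum)

text \<open>
  A space without a finite basis has dimension \<open>0\<close> by convention, so positivity of the dimension
  certifies that it is finite.
\<close>

lemma dim_positive_spanned:
  assumes "0 < VS.dim V"
  shows "\<exists>T. finite T \<and> T \<subseteq> V \<and> V \<subseteq> VS.span T \<and> card T = VS.dim V"
  using VS.basis_exists[of V] assms by (metis card.infinite less_irrefl)

lemma RR_space_iff: "f \<in> RR_space \<iota> D \<longleftrightarrow> (\<forall>v\<in>places \<iota>. val_ge v (- lookup D v) f)"
  by (auto simp: RR_space_def val_ge_def)

end

section \<open>A quadratic cover with a chosen point at infinity\<close>

lemma dvd_of_mult_at_le:
  fixes A C :: "'k::alg_closed_field poly"
  assumes "A \<noteq> 0" "C \<noteq> 0" "\<And>a. mult_at a C \<le> mult_at a A"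
  shows "C dvd A"
  using assms
proof (induction "degree C" arbitrary: A C)
  case 0
  then show ?case by (metis degree_0_id is_unit_triv pCons_0_0 unit_imp_dvd)
next
  case (Suc n)
  then obtain a where a: "poly C a = 0" using alg_closed_imp_poly_has_root[of C] by auto
  then have "0 < mult_at a C" using order_gt_0_iff[of C a] Suc.prems by simp
  then have "0 < mult_at a A" using Suc.prems(3)[of a] by linarith
  then have "poly A a = 0" using order_gt_0_iff[of A a] Suc.prems by simp
  from this a obtain A' C' where AC: "A = [:- a, 1:] * A'" "C = [:- a, 1:] * C'"
    by (auto simp: poly_eq_0_iff_dvd dvd_def)
  have nz: "A' \<noteq> 0" "C' \<noteq> 0" using AC Suc.prems by auto
  have "n = degree C'"
    using Suc.hyps(2) nz unfolding AC by (subst (asm) degree_mult_eq) auto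
  moreover have "mult_at b C' \<le> mult_at b A'" for b
  proof -
    have "mult_at b C = mult_at b [:- a, 1:] + mult_at b C'"
      "mult_at b A = mult_at b [:- a, 1:] + mult_at b A'"
      using Suc.prems(1,2) unfolding AC by (intro order_mult; simp)+
    with Suc.prems(3)[of b] show ?thesis by linarith
  qed
  ultimately have "C' dvd A'" using Suc.hyps(1) nz by blast
  then show ?case unfolding AC by (rule mult_dvd_mono[OF dvd_refl])
qed

locale pointed_cover = quadratic_cover \<iota> x y G \<sigma>
  for \<iota> :: "'k::{alg_closed_field, field_char_0} \<Rightarrow> 'f::field" and x y G \<sigma> +
  fixes q :: "'f \<Rightarrow> int" and g :: nat
  assumes squarefree: "mult_at a G \<le> 1"
    and q: "q \<in> places \<iota>" and q_pole: "q x < 0"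
    and genus: "has_genus \<iota> g"
begin

lemma x_nonzero: "x \<noteq> 0"
  using x_nonconst by (metis const_0 rangeI)

lemma conj_x: "(v \<circ> \<sigma>) x = v x"
  by (simp add: \<sigma>_x)

lemma degree_le_RR_dim: "D \<in> divisors \<iota> \<Longrightarrow> divisor_degree D + 1 \<le> int g + int (RR_dim \<iota> D)"
  using genus by (auto simp: has_genus_def)

text \<open>
  If no place lay over \<open>a\<close>, then \<open>u = 1 / (x - a)\<close> would have no poles, and all its powers would lie
  in \<open>L(g q)\<close>.  But this space is finite-dimensional, because its dimension is positive by the
  definition of the genus.
\<close>

lemma exists_place_above: "\<exists>v\<in>places \<iota>. val_ge v 1 (x - \<iota> a)"
proof (rule ccontr)
  assume none: "\<not> ?thesis"
  define u where "u = inverse (x - \<iota> a)"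
  have u: "u \<notin> range \<iota>" using mobius_nonconst[OF x_nonconst] by (simp add: u_def)
  have xa: "x - \<iota> a \<noteq> 0" using x_nonconst by auto
  have u_nonneg: "0 \<le> v u" if "v \<in> places \<iota>" for v
    using none that xa by (auto simp: u_def val_ge_def place_inverse)
  define D where "D = frag_cmul (int g) (frag_of q)"
  have "D \<in> divisors \<iota>" "divisor_degree D = int g"
    using q by (simp_all add: D_def divisors_cmul divisor_degree_cmul)
  then have "0 < RR_dim \<iota> D" using degree_le_RR_dim by fastforce
  then obtain T where T: "finite T" "RR_space \<iota> D \<subseteq> VS.span T"
    using dim_positive_spanned[of "RR_space \<iota> D"] unfolding RR_dim_def by blast
  have "u ^ n \<in> RR_space \<iota> D" for n
    unfolding RR_space_iff
  proof
    fix v assume v: "v \<in> places \<iota>"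
    have "0 \<le> v (u ^ n)" using u_nonneg[OF v] xa by (simp add: place_power[OF v] u_def)
    moreover have "0 \<le> lookup D v" by (simp add: D_def)
    ultimately show "val_ge v (- lookup D v) (u ^ n)" by (simp add: val_ge_def)
  qed
  then have "(\<lambda>i. u ^ i) ` {..<Suc (card T)} \<subseteq> VS.span T" using T by auto
  moreover have "\<forall>i\<in>{..<Suc (card T)}. c i = 0" if "(\<Sum>i<Suc (card T). \<iota> (c i) * u ^ i) = 0" for c
    using that ev_nonzero[OF u] coeff_sum_monom[of _ "Suc (card T)" c]
    by (metis coeff_0 ev_sum_monom lessThan_iff)
  ultimately have "card {..<Suc (card T)} \<le> card T"
    by (rule card_le_of_independent_family[OF finite_lessThan T(1)])
  then show False by simp
qed

section \<open>The divisor of a function\<close>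

text \<open>
  The fibre of the double cover through \<open>v\<close>, counted with multiplicity.
\<close>

definition fibre :: "('f \<Rightarrow> int) \<Rightarrow> 'f divisor" where
  "fibre v = frag_of v + frag_of (v \<circ> \<sigma>)"

lemma fibre_divisor: "v \<in> places \<iota> \<Longrightarrow> fibre v \<in> divisors \<iota>"
  by (simp add: fibre_def divisors_add place_conj)

lemma degree_fibre: "divisor_degree (fibre v) = 2"
  by (simp add: fibre_def divisor_degree_simps)

lemma lookup_fibre:
  "lookup (fibre v) w = (if w = v \<or> w = v \<circ> \<sigma> then if w \<circ> \<sigma> = w then 2 else 1 else 0)"
  by (auto simp: fibre_def lookup_add)

lemma lookup_fibre_q:
  assumes "v \<in> places \<iota>"
  shows "lookup (fibre q) v = (if v x < 0 then - v x else 0)"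
proof (cases "v x < 0")
  case True
  then have "v = q \<or> v = q \<circ> \<sigma>"
    using places_at_infinity(3)[OF q q_pole assms] by blast
  with True places_at_infinity(1)[OF assms True] show ?thesis by (simp add: lookup_fibre)
next
  case False
  then have "v \<noteq> q" "v \<noteq> q \<circ> \<sigma>" using q_pole conj_x[of q] by metis+
  with False show ?thesis by (simp add: lookup_fibre)
qed

text \<open>
  The function \<open>x - a\<close> vanishes on the fibre over \<open>a\<close> and has its poles on the fibre at infinity;
  the ramification indices account for the coefficient \<open>2\<close> of a fibre with a single point.
\<close>

lemma has_div_linear:
  assumes v: "v \<in> places \<iota>" "val_ge v 1 (x - \<iota> a)"
  shows "has_div \<iota> (x - \<iota> a) (fibre v - fibre q)"
  unfolding has_div_def
proof (intro conjI ballI)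
  show "fibre v - fibre q \<in> divisors \<iota>" using v q by (simp add: divisors_diff fibre_divisor)
  fix w assume w: "w \<in> places \<iota>"
  have v': "v \<in> above a" using v by simp
  have above_nonneg: "0 \<le> u x" if "u \<in> above a" for u
    using val_ge_of_value[of u x a] that x_nonzero by (auto simp: val_ge_def)
  show "lookup (fibre v - fibre q) w = w (x - \<iota> a)"
  proof (cases "w x < 0")
    case True
    then have "w \<notin> above a" using above_nonneg[of w] by auto
    then have "w \<noteq> v" "w \<noteq> v \<circ> \<sigma>" using v' above_conj[OF v'] by auto
    moreover have "w (x - \<iota> a) = w x"
      using place_ev_pole[where v = w and x = x and A = "[:- a, 1:]"] w True by (simp add: ev_linear)
    ultimately show ?thesis
      using True by (simp add: lookup_minus lookup_fibre_q[OF w] lookup_fibre[of v])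
  next
    case False
    show ?thesis
    proof (cases "w \<in> above a")
      case True
      then have "w = v \<or> w = v \<circ> \<sigma>" using places_above(3)[OF squarefree v'] by blast
      with False show ?thesis
        using places_above(1)[OF squarefree True]
        by (simp add: lookup_minus lookup_fibre_q[OF w] lookup_fibre[of v])
    next
      case not_above: False
      then have "w \<noteq> v" "w \<noteq> v \<circ> \<sigma>" using v' above_conj[OF v'] by auto
      moreover have "w (x - \<iota> a) = 0"
      proof -
        have "val_ge w 0 x" using False by (simp add: val_ge_def)
        then have "val_ge w 0 (x - \<iota> a)"
          using val_ge_diff[OF w _ val_ge_const[OF w]] by blast
        with not_above w x_nonconst show ?thesis by (auto simp: val_ge_def)
      qed
      ultimately show ?thesis
        using False by (simp add: lookup_minus lookup_fibre_q[OF w] lookup_fibre[of v])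
    qed
  qed
qed

lemma exists_div_ev:
  assumes "A \<noteq> 0"
  shows "\<exists>D. has_div \<iota> (ev x A) D \<and> divisor_degree D = 0"
proof -
  have "\<exists>D. has_div \<iota> (ev x (\<Prod>a\<in>#M. [:- a, 1:])) D \<and> divisor_degree D = 0
      \<and> ev x (\<Prod>a\<in>#M. [:- a, 1:]) \<noteq> 0" for M
  proof (induction M)
    case empty
    show ?case using has_div_1 by (intro exI[of _ 0]) simp
  next
    case (add a M)
    obtain D where D: "has_div \<iota> (ev x (\<Prod>a\<in>#M. [:- a, 1:])) D" "divisor_degree D = 0"
      "ev x (\<Prod>a\<in>#M. [:- a, 1:]) \<noteq> 0" using add.IH by blast
    obtain v where v: "v \<in> places \<iota>" "val_ge v 1 (x - \<iota> a)" using exists_place_above by blast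
    have xa: "x - \<iota> a \<noteq> 0" using x_nonconst by auto
    have "ev x (\<Prod>a\<in>#add_mset a M. [:- a, 1:]) = (x - \<iota> a) * ev x (\<Prod>a\<in>#M. [:- a, 1:])"
      by (simp add: ev_mult ev_linear del: mult_pCons_left)
    moreover have "divisor_degree (fibre v - fibre q + D) = 0"
      by (simp add: divisor_degree_simps degree_fibre D(2))
    ultimately show ?case
      using has_div_mult[OF xa D(3) has_div_linear[OF v] D(1)] xa D(3) by (metis mult_eq_0_iff)
  qed
  moreover obtain M where M: "A = smult (lead_coeff A) (\<Prod>a\<in>#M. [:- a, 1:])"
    using alg_closed_imp_factorization[OF assms] by blast
  moreover have "ev x A = \<iota> (lead_coeff A) * ev x (\<Prod>a\<in>#M. [:- a, 1:])"
    by (subst M) (simp only: ev_smult)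
  ultimately show ?thesis
    using assms has_div_mult[OF _ _ has_div_const] by (metis add_0 const_eq_0_iff leading_coeff_0_iff)
qed

lemma exists_div_subfield:
  assumes "f \<in> simple_subfield \<iota> x" "f \<noteq> 0"
  shows "\<exists>D. has_div \<iota> f D \<and> divisor_degree D = 0"
proof -
  obtain A B where AB: "ev x B \<noteq> 0" "f = ev x A / ev x B"
    using assms(1) unfolding simple_subfield_iff by blast
  with assms(2) have A: "ev x A \<noteq> 0" by auto
  obtain D E where D: "has_div \<iota> (ev x A) D" "divisor_degree D = 0"
    and E: "has_div \<iota> (ev x B) E" "divisor_degree E = 0"
    using exists_div_ev A AB(1) by (metis ev_0)
  have "has_div \<iota> f (D + - E)"
    unfolding AB(2) field_class.field_divide_inverse
    using A AB(1) D E by (intro has_div_mult has_div_inverse) auto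
  then show ?thesis using D E by (intro exI[of _ "D + - E"]) (simp add: divisor_degree_simps)
qed

definition conj_divisor :: "'f divisor \<Rightarrow> 'f divisor" where
  "conj_divisor D = frag_extend (\<lambda>v. frag_of (v \<circ> \<sigma>)) D"

lemma conj_divisor_diff: "conj_divisor (D - E) = conj_divisor D - conj_divisor E"
  by (simp add: conj_divisor_def frag_extend_diff)

lemma lookup_conj_divisor: "lookup (conj_divisor D) v = lookup D (v \<circ> \<sigma>)"
proof (induction D rule: frag_induction[where S = UNIV, OF subset_UNIV])
  case (2 w)
  show ?case using conj_eq_iff[of v w] by (simp add: conj_divisor_def del: comp_apply)
next
  case (3 D E)
  then show ?case by (simp only: conj_divisor_diff lookup_minus)
qed (simp add: conj_divisor_def)

lemma conj_divisor_in: "D \<in> divisors \<iota> \<Longrightarrow> conj_divisor D \<in> divisors \<iota>"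
  unfolding divisors_iff
proof (induction D rule: frag_induction)
  case (one v)
  then show ?case by (simp add: conj_divisor_def place_conj)
next
  case (diff D E)
  then show ?case
    using keys_diff[of "conj_divisor D" "conj_divisor E"] by (auto simp: conj_divisor_diff)
qed (simp add: conj_divisor_def)

lemma degree_conj_divisor: "divisor_degree (conj_divisor D) = divisor_degree D"
proof (induction D rule: frag_induction[where S = UNIV, OF subset_UNIV])
  case (3 D E)
  then show ?case by (simp only: conj_divisor_diff divisor_degree_diff)
qed (simp_all add: conj_divisor_def)

text \<open>
  A function has only finitely many zeros and poles, as many of the one as of the other.  The trace
  and the norm of \<open>f\<close> lie in \<open>k(x)\<close>, where divisors are explicit.  Where the trace and the norm have
  order \<open>0\<close>, so has \<open>f\<close>, since \<open>f\<close> and \<open>\<sigma> f\<close> have opposite orders and the smaller one would be the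
  order of the trace.  The divisors of \<open>f\<close> and \<open>\<sigma> f\<close> have equal degree and add up to that of the norm.
\<close>

lemma exists_div:
  assumes f: "f \<noteq> 0"
  shows "\<exists>D. has_div \<iota> f D \<and> divisor_degree D = 0"
proof -
  define N T where "N = f * \<sigma> f" and "T = f + \<sigma> f"
  have N0: "N \<noteq> 0" using f by (simp add: N_def)
  obtain DN where DN: "has_div \<iota> N DN" "divisor_degree DN = 0"
    using exists_div_subfield[OF norm_in, of f] N0 by (auto simp: N_def)
  obtain ST where ST: "finite ST" "\<And>v. v \<in> places \<iota> \<Longrightarrow> v T \<noteq> 0 \<Longrightarrow> v \<in> ST"
  proof (cases "T = 0")
    case True
    then show ?thesis by (intro that[of "{}"]) (auto simp: place_0)
  next
    case False
    then obtain DT where "has_div \<iota> T DT"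
      using exists_div_subfield[OF trace_in, of f] by (auto simp: T_def)
    then show ?thesis
      by (intro that[of "Poly_Mapping.keys DT"]) (auto simp: has_div_def Poly_Mapping.in_keys_iff)
  qed
  define S where "S = (Poly_Mapping.keys DN \<union> ST) \<inter> places \<iota>"
  have S: "finite S" "S \<subseteq> places \<iota>" using ST by (auto simp: S_def)
  have zero: "v f = 0" if v: "v \<in> places \<iota>" "v \<notin> S" for v
  proof (rule ccontr)
    assume nz: "v f \<noteq> 0"
    have "v N = 0" "v T = 0"
      using v ST DN by (auto simp: S_def has_div_def Poly_Mapping.in_keys_iff)
    then have sum0: "v f + v (\<sigma> f) = 0" using place_mult[OF v(1) f, of "\<sigma> f"] f by (simp add: N_def)
    show False
    proof (cases "v f < 0")
      case True
      then have "val_ge v (v f + 1) (\<sigma> f)" using sum0 by (auto simp: val_ge_def)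
      from place_add_dominant(2)[OF v(1) f this] \<open>v T = 0\<close> nz show False by (simp add: T_def)
    next
      case False
      then have "val_ge v (v (\<sigma> f) + 1) f" using sum0 nz by (auto simp: val_ge_def)
      from place_add_dominant(2)[OF v(1) _ this] \<open>v T = 0\<close> nz sum0 f
      show False by (simp add: T_def add.commute)
    qed
  qed
  define D where "D = (\<Sum>v\<in>S. frag_cmul (v f) (frag_of v))"
  have lookup_D: "lookup D w = (if w \<in> S then w f else 0)" for w
  proof -
    have "lookup D w = (\<Sum>v\<in>S. if w = v then v f else 0)"
      unfolding D_def lookup_sum by (intro sum.cong) auto
    then show ?thesis using S by simp
  qed
  have D: "has_div \<iota> f D"
    unfolding has_div_def
  proof
    show "D \<in> divisors \<iota>"
      using S(2) by (auto simp: divisors_iff Poly_Mapping.in_keys_iff lookup_D split: if_splits)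
  qed (use zero lookup_D in auto)
  have "has_div \<iota> (\<sigma> f) (conj_divisor D)"
    using D place_conj by (auto simp: has_div_def conj_divisor_in lookup_conj_divisor)
  from has_div_mult[OF f _ D this] have "has_div \<iota> N (D + conj_divisor D)"
    using f by (simp add: N_def)
  then have "D + conj_divisor D = DN" using DN(1) by (rule has_div_unique)
  then have "divisor_degree D = 0"
    using DN(2) by (auto simp: divisor_degree_simps degree_conj_divisor)
  with D show ?thesis by blast
qed

lemma degree_has_div: "f \<noteq> 0 \<Longrightarrow> has_div \<iota> f D \<Longrightarrow> divisor_degree D = 0"
  using exists_div has_div_unique by blast

section \<open>Riemann-Roch spaces grow by at most one dimension per point\<close>

lemma RR_space_negative_degree:
  assumes D: "D \<in> divisors \<iota>" "divisor_degree D < 0"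
  shows "RR_space \<iota> D \<subseteq> {0}"
proof
  fix f assume f: "f \<in> RR_space \<iota> D"
  show "f \<in> {0}"
  proof (rule ccontr)
    assume "f \<notin> {0}"
    then have f0: "f \<noteq> 0" by simp
    then obtain E where E: "has_div \<iota> f E" "divisor_degree E = 0" using exists_div by blast
    have "effective \<iota> (D + E)"
    proof (rule effectiveI)
      show "D + E \<in> divisors \<iota>" using D E by (simp add: divisors_add has_div_def)
      fix v assume "v \<in> places \<iota>"
      then show "0 \<le> lookup (D + E) v"
        using f f0 E by (auto simp: RR_space_def lookup_add has_div_def add.commute)
    qed
    from effective_degree_nonneg[OF this] D E show False by (simp add: divisor_degree_simps)
  qed
qed

text \<open>
  If \<open>h\<close> attains the additional pole order at \<open>v\<close>, then \<open>f / h\<close> takes a value \<open>c\<close> at \<open>v\<close>, and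
  \<open>f - c h\<close> has a smaller pole.
\<close>

lemma RR_space_add_point:
  assumes v: "v \<in> places \<iota>"
  shows "\<exists>h. RR_space \<iota> (D + frag_of v) \<subseteq> VS.span (insert h (RR_space \<iota> D))"
proof (cases "RR_space \<iota> (D + frag_of v) \<subseteq> RR_space \<iota> D")
  case True
  then show ?thesis using VS.span_superset by blast
next
  case False
  then obtain h where h: "h \<in> RR_space \<iota> (D + frag_of v)" "h \<notin> RR_space \<iota> D" by blast
  have h0: "h \<noteq> 0" using h(2) by (auto simp: RR_space_def)
  have "\<forall>w\<in>places \<iota>. w \<noteq> v \<longrightarrow> val_ge w (- lookup D w) h"
    using h(1) by (auto simp: RR_space_iff lookup_add)
  then have "\<not> val_ge v (- lookup D v) h" using h(2) by (auto simp: RR_space_iff)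
  moreover have "val_ge v (- lookup D v - 1) h"
    using h(1) v by (auto simp: RR_space_iff lookup_add)
  ultimately have vh: "v h = - lookup D v - 1" using h0 by (auto simp: val_ge_def)
  have "f \<in> VS.span (insert h (RR_space \<iota> D))" if f: "f \<in> RR_space \<iota> (D + frag_of v)" for f
  proof -
    have "val_ge v (- lookup D v - 1) f" using f v by (auto simp: RR_space_iff lookup_add)
    then have "val_ge v 0 (f / h)"
      using h0 vh by (cases "f = 0") (simp_all add: val_ge_def place_divide[OF v])
    then obtain c where "val_ge v 1 (f / h - \<iota> c)" using residue[OF v] by blast
    then have "val_ge v (1 + v h) ((f / h - \<iota> c) * h)"
      by (intro val_ge_mult[OF v]) (simp_all add: val_ge_def)
    then have at_v: "val_ge v (- lookup D v) (f - \<iota> c * h)"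
      using h0 vh by (simp add: left_diff_distrib)
    have "f - \<iota> c * h \<in> RR_space \<iota> D"
      unfolding RR_space_iff
    proof
      fix w assume w: "w \<in> places \<iota>"
      show "val_ge w (- lookup D w) (f - \<iota> c * h)"
      proof (cases "w = v")
        case False
        then have "val_ge w (- lookup D w) f" "val_ge w (- lookup D w) h"
          using f h(1) w by (auto simp: RR_space_iff lookup_add)
        then show ?thesis
          using val_ge_diff[OF w _ val_ge_mult0[OF w val_ge_const[OF w]]] by blast
      qed (use at_v in simp)
    qed
    then show ?thesis unfolding VS.span_breakdown_eq using VS.span_base by blast
  qed
  then show ?thesis by blast
qed

lemma RR_space_add_points:
  assumes "set ps \<subseteq> places \<iota>" "finite T" "RR_space \<iota> D \<subseteq> VS.span T"
  shows "\<exists>T'. finite T' \<and> card T' \<le> card T + length ps \<and>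
    RR_space \<iota> (D + point_sum ps) \<subseteq> VS.span T'"
  using assms(1)
proof (induction ps)
  case Nil
  then show ?case using assms by auto
next
  case (Cons v ps)
  then obtain T' where T': "finite T'" "card T' \<le> card T + length ps"
    "RR_space \<iota> (D + point_sum ps) \<subseteq> VS.span T'" by auto
  obtain h where h: "RR_space \<iota> (D + point_sum ps + frag_of v)
      \<subseteq> VS.span (insert h (RR_space \<iota> (D + point_sum ps)))"
    using RR_space_add_point Cons.prems by fastforce
  also have "\<dots> \<subseteq> VS.span (insert h T')"
  proof (rule VS.span_minimal)
    show "insert h (RR_space \<iota> (D + point_sum ps)) \<subseteq> VS.span (insert h T')"
      using T'(3) VS.span_mono[of T' "insert h T'"] VS.span_base[of h "insert h T'"] by blast
  qed (rule VS.subspace_span)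
  finally have "RR_space \<iota> (D + point_sum (v # ps)) \<subseteq> VS.span (insert h T')"
    by (simp add: algebra_simps)
  moreover have "card (insert h T') \<le> card T + length (v # ps)"
    using T'(2) by (simp add: card_insert_if T'(1))
  ultimately show ?case using T'(1) by blast
qed

lemma RR_space_finite_dim:
  assumes D: "D \<in> divisors \<iota>"
  shows "\<exists>T. finite T \<and> card T = RR_dim \<iota> D \<and> RR_space \<iota> D \<subseteq> VS.span T"
proof -
  define n where "n = nat (divisor_degree D + 1)"
  define ps where "ps = replicate n q"
  have ps: "set ps \<subseteq> places \<iota>" using q by (auto simp: ps_def)
  have "effective \<iota> (point_sum ps)" using ps by (rule effective_point_sum)
  then have "D - point_sum ps \<in> divisors \<iota>" using D by (simp add: effective_def divisors_diff)
  moreover have "divisor_degree (D - point_sum ps) < 0"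
    by (simp add: divisor_degree_diff degree_point_sum ps_def n_def del: map_replicate)
  ultimately have "RR_space \<iota> (D - point_sum ps) \<subseteq> VS.span {}"
    using RR_space_negative_degree by simp
  from RR_space_add_points[OF ps _ this] obtain T' where T': "finite T'" "RR_space \<iota> D \<subseteq> VS.span T'"
    by auto
  obtain B where B: "B \<subseteq> RR_space \<iota> D" "VS.independent B" "RR_space \<iota> D \<subseteq> VS.span B"
    "card B = VS.dim (RR_space \<iota> D)" by (rule VS.basis_exists)
  have "finite B" using VS.independent_span_bound[OF T'(1) B(2)] B(1) T'(2) by blast
  with B show ?thesis by (auto simp: RR_dim_def)
qed

section \<open>The genus bounds the degree of \<open>G\<close>\<close>

text \<open>
  Up to linear equivalence every divisor can be enlarged to a multiple of the fibre at infinity: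
  a point is completed by its conjugate to a fibre, and all fibres are equivalent.
\<close>

lemma divisor_below_fibres:
  assumes "D \<in> divisors \<iota>"
  shows "\<exists>n h H E. h \<noteq> 0 \<and> has_div \<iota> h H \<and> effective \<iota> E \<and>
    D + E = frag_cmul (int n) (fibre q) + H"
proof -
  define P where "P D \<longleftrightarrow> (\<exists>n h H E. h \<noteq> 0 \<and> has_div \<iota> h H \<and> effective \<iota> E \<and>
    D + E = frag_cmul (int n) (fibre q) + H)" for D
  have P_add: "P (D + D')" if "P D" "P D'" for D D'
  proof -
    obtain n h H E where 1: "h \<noteq> 0" "has_div \<iota> h H" "effective \<iota> E"
      "D + E = frag_cmul (int n) (fibre q) + H" using \<open>P D\<close> unfolding P_def by blast
    obtain n' h' H' E' where 2: "h' \<noteq> 0" "has_div \<iota> h' H'" "effective \<iota> E'"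
      "D' + E' = frag_cmul (int n') (fibre q) + H'" using \<open>P D'\<close> unfolding P_def by blast
    have "D + D' + (E + E') = frag_cmul (int (n + n')) (fibre q) + (H + H')"
      using arg_cong2[OF 1(4) 2(4), of "(+)"] by (simp add: frag_cmul_distrib algebra_simps)
    then show ?thesis unfolding P_def
      using has_div_mult[OF 1(1) 2(1) 1(2) 2(2)] effective_add[OF 1(3) 2(3)] 1(1) 2(1)
      by (metis mult_eq_0_iff)
  qed
  have P_pos: "P (frag_of v)" if v: "v \<in> places \<iota>" for v
  proof -
    have E: "effective \<iota> (frag_of (v \<circ> \<sigma>))"
      using place_conj[OF v] by (simp add: effective_def)
    show ?thesis
    proof (cases "v x < 0")
      case True
      then have "v = q \<or> v = q \<circ> \<sigma>" using places_at_infinity(3)[OF q q_pole v] by blast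
      then have "frag_of v + frag_of (v \<circ> \<sigma>) = frag_cmul (int 1) (fibre q) + 0"
        by (auto simp: fibre_def add.commute)
      then show ?thesis unfolding P_def using E has_div_1 by (metis one_neq_zero)
    next
      case False
      then obtain a where a: "val_ge v 1 (x - \<iota> a)" using finite_or_infinite_place[OF v] by blast
      have "frag_of v + frag_of (v \<circ> \<sigma>) = frag_cmul (int 1) (fibre q) + (fibre v - fibre q)"
        by (simp add: fibre_def)
      moreover have "x - \<iota> a \<noteq> 0" using x_nonconst by auto
      ultimately show ?thesis unfolding P_def using E has_div_linear[OF v a] by blast
    qed
  qed
  have P_neg: "P (- frag_of v)" if v: "v \<in> places \<iota>" for v
  proof -
    have "effective \<iota> (frag_of v)" using v by (simp add: effective_def)
    moreover have "- frag_of v + frag_of v = frag_cmul (int 0) (fibre q) + 0" by simp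
    ultimately show ?thesis unfolding P_def using has_div_1 by (metis one_neq_zero)
  qed
  from assms have "Poly_Mapping.keys D \<subseteq> places \<iota>" by (simp add: divisors_iff)
  \<comment> \<open>Divisors are generated by points under subtraction, hence the two signs.\<close>
  then have "P D \<and> P (- D)"
  proof (induction D rule: frag_induction)
    case zero
    have "P 0" unfolding P_def
      using has_div_1 by (intro exI[of _ 0] exI[of _ 1]) (simp add: effective_def)
    then show ?case by simp
  next
    case (diff A B)
    then show ?case using P_add[of A "- B"] P_add[of B "- A"] by simp
  qed (use P_pos P_neg in auto)
  then show ?thesis by (simp add: P_def)
qed

lemma place_y_finite: "v \<in> places \<iota> \<Longrightarrow> 0 \<le> v x \<Longrightarrow> 0 \<le> v y"
proof -
  assume v: "v \<in> places \<iota>" "0 \<le> v x"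
  have "2 * v y = v (ev x G)" using place_power[OF v(1) y_nonzero, of 2] y_sq by simp
  moreover have "val_ge v 0 (ev x G)" by (rule val_ge_ev[OF v(1)]) (use v in \<open>simp add: val_ge_def\<close>)
  ultimately show ?thesis using y_sq y_nonzero by (auto simp: val_ge_def)
qed

lemma place_y_infinite:
  assumes "v \<in> places \<iota>" "v x < 0"
  shows "2 * v y = int (degree G) * v x"
  using place_power[OF assms(1) y_nonzero, of 2] y_sq place_ev_pole[OF assms G_nonzero] by simp

text \<open>
  Let \<open>D\<close> attain the genus and enlarge it to \<open>D + E = n \<Phi> + div h\<close>, where \<open>\<Phi>\<close> is the fibre at
  infinity.  The order of \<open>y\<close> at infinity is at least \<open>m\<close> times that of \<open>x\<close>, for \<open>m = \<lceil>deg G / 2\<rceil>\<close>,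
  so \<open>L(D + E)\<close> contains the independent functions \<open>x\<^sup>i / h\<close> for \<open>i \<le> n\<close> and \<open>x\<^sup>j y / h\<close> for
  \<open>j \<le> n - m\<close>.  Passing from \<open>D\<close> to \<open>D + E\<close> adds at most \<open>deg E = 2 n - deg D\<close> dimensions, which
  leaves \<open>L(D)\<close> with dimension at least \<open>deg D + 2 - m\<close>, that is, \<open>g \<le> m - 1\<close>.
\<close>

lemma genus_less: "g < (degree G + 1) div 2"
proof -
  define m where "m = (degree G + 1) div 2"
  obtain D where D: "D \<in> divisors \<iota>" "divisor_degree D - int (RR_dim \<iota> D) + 1 = int g"
    using genus by (auto simp: has_genus_def)
  obtain n h H E where h: "h \<noteq> 0" "has_div \<iota> h H" and E: "effective \<iota> E"
    and eq: "D + E = frag_cmul (int n) (fibre q) + H"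
    using divisor_below_fibres[OF D(1)] by blast
  have deg: "divisor_degree D + divisor_degree E = 2 * int n"
    using arg_cong[OF eq, of divisor_degree] degree_has_div[OF h]
    by (simp add: divisor_degree_simps degree_fibre)
  obtain ps where ps: "set ps \<subseteq> places \<iota>" "E = point_sum ps" "int (length ps) = divisor_degree E"
    using effective_obtain_points[OF E, of "nat (divisor_degree E)"] effective_degree_nonneg[OF E]
    by auto
  obtain T where T: "finite T" "card T = RR_dim \<iota> D" "RR_space \<iota> D \<subseteq> VS.span T"
    using RR_space_finite_dim[OF D(1)] by blast
  obtain T' where T': "finite T'" "card T' \<le> card T + length ps"
    "RR_space \<iota> (D + E) \<subseteq> VS.span T'"
    using RR_space_add_points[OF ps(1) T(1,3)] ps(2) by blast
  define I :: "(nat + nat) set" where "I = {..<n + 1} <+> {..<n + 1 - m}"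
  define b where "b = case_sum (\<lambda>i. inverse h * x ^ i) (\<lambda>j. inverse h * x ^ j * y)"
  have "card I \<le> card T'"
  proof (rule card_le_of_independent_family)
    show "finite I" "finite T'" by (simp_all add: I_def T')
    show "\<forall>i\<in>I. c i = 0" if "(\<Sum>i\<in>I. \<iota> (c i) * b i) = 0" for c
    proof -
      define A where "A = (\<Sum>i<n + 1. monom (c (Inl i)) i)"
      define B where "B = (\<Sum>i<n + 1 - m. monom (c (Inr i)) i)"
      have "0 = inverse h * (ev x A + ev x B * y)"
        unfolding that[symmetric] A_def B_def ev_sum_monom distrib_left sum_distrib_left sum_distrib_right
        by (simp add: I_def sum.Plus b_def mult_ac)
      then have "ev x A + ev x B * y = 0" using h by simp
      moreover from arg_cong[OF this, of \<sigma>] have "ev x A - ev x B * y = 0"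
        by (simp add: \<sigma>_add \<sigma>_mult \<sigma>_ev \<sigma>_y)
      ultimately have "2 * ev x A = 0" "2 * (ev x B * y) = 0"
        by (simp_all only: mult_2) (simp_all add: algebra_simps)
      then have "ev x A = 0" "ev x B = 0" using two_neq_0 y_nonzero by simp_all
      then have "A = 0" "B = 0" using ev_nonzero[OF x_nonconst] by blast+
      then have "c (Inl i) = 0" if "i < n + 1" for i
        using coeff_sum_monom[OF that, of "\<lambda>i. c (Inl i)"] by (simp add: A_def)
      moreover have "c (Inr i) = 0" if "i < n + 1 - m" for i
        using coeff_sum_monom[OF that, of "\<lambda>i. c (Inr i)"] \<open>B = 0\<close> by (simp add: B_def)
      ultimately show ?thesis by (auto simp: I_def)
    qed
    have "inverse h * f \<in> RR_space \<iota> (D + E)"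
      if "f \<noteq> 0" "\<And>v. v \<in> places \<iota> \<Longrightarrow> 0 \<le> v f + int n * lookup (fibre q) v" for f
      using that h by (auto simp: eq RR_space_def place_mult place_inverse lookup_add has_div_def)
    note mem = this
    have "b i \<in> RR_space \<iota> (D + E)" if i: "i \<in> I" for i
    proof -
      consider j where "i = Inl j" "j \<le> n" | j where "i = Inr j" "j + m \<le> n"
        using i by (auto simp: I_def)
      then show ?thesis
      proof cases
        case 1
        have "0 \<le> v (x ^ j) + int n * lookup (fibre q) v" if v: "v \<in> places \<iota>" for v
        proof (cases "v x < 0")
          case True
          then have "int n * v x \<le> int j * v x" using 1 by (simp add: mult_right_mono_neg)
          with True show ?thesis
            by (simp add: lookup_fibre_q[OF v] place_power[OF v x_nonzero])
        qed (simp add: lookup_fibre_q[OF v] place_power[OF v x_nonzero])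
        from mem[OF _ this] show ?thesis using x_nonzero by (simp add: 1 b_def)
      next
        case 2
        have "0 \<le> v (x ^ j * y) + int n * lookup (fibre q) v" if v: "v \<in> places \<iota>" for v
        proof (cases "v x < 0")
          case True
          have "int (degree G) \<le> 2 * int m" by (simp add: m_def)
          then have "2 * int m * v x \<le> 2 * v y"
            unfolding place_y_infinite[OF v True] using True by (simp add: mult_right_mono_neg)
          then have "int m * v x \<le> v y" by simp
          moreover have "int n * v x \<le> int (j + m) * v x"
            using True 2(2) by (intro mult_right_mono_neg) auto
          ultimately show ?thesis using True x_nonzero y_nonzero
            by (simp add: lookup_fibre_q[OF v] place_power[OF v] place_mult[OF v] algebra_simps)
        next
          case False
          then show ?thesis using x_nonzero y_nonzero place_y_finite[OF v]
            by (simp add: lookup_fibre_q[OF v] place_power[OF v] place_mult[OF v])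
        qed
        from mem[OF _ this] show ?thesis using x_nonzero y_nonzero by (simp add: 2 b_def mult.assoc)
      qed
    qed
    then show "b ` I \<subseteq> VS.span T'" using T'(3) by blast
  qed
  moreover have "card I = (n + 1) + (n + 1 - m)" by (simp add: I_def card_Plus)
  ultimately have "int (n + 1) + int (n + 1 - m) \<le> int (RR_dim \<iota> D) + divisor_degree E"
    using T' T ps by linarith
  then have "2 * int n + 2 - int m \<le> int (RR_dim \<iota> D) + divisor_degree E" by linarith
  with deg D(2) show ?thesis unfolding m_def[symmetric] by linarith
qed

lemma degree_G_ge: "2 * g + 1 \<le> degree G"
  using genus_less by linarith

section \<open>Functions with few poles, all at infinity\<close>

text \<open>
  A zero of the denominator that is not cancelled would be a pole at the place over it.
\<close>

lemma ev_of_regular: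
  assumes f: "f \<in> simple_subfield \<iota> x"
    and reg: "\<And>v. v \<in> places \<iota> \<Longrightarrow> 0 \<le> v x \<Longrightarrow> val_ge v 0 f"
  shows "\<exists>A. f = ev x A"
proof (cases "f = 0")
  case True
  then show ?thesis by (intro exI[of _ 0]) simp
next
  case False
  obtain A B where AB: "ev x B \<noteq> 0" "f = ev x A / ev x B"
    using f unfolding simple_subfield_iff by blast
  with False have nz: "A \<noteq> 0" "B \<noteq> 0" by auto
  have "mult_at a B \<le> mult_at a A" for a
  proof -
    obtain v where v: "v \<in> places \<iota>" "val_ge v 1 (x - \<iota> a)" using exists_place_above by blast
    have pos: "0 < v (x - \<iota> a)" using place_pos[of v a] v by simp
    have "0 \<le> v x" using val_ge_of_value[OF v] x_nonzero by (simp add: val_ge_def)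
    then have "0 \<le> v f" using reg[OF v(1)] False by (simp add: val_ge_def)
    also have "v f = (int (mult_at a A) - int (mult_at a B)) * v (x - \<iota> a)"
      using nz unfolding AB(2)
      by (simp add: place_divide[OF v(1)] ev_nonzero[OF x_nonconst]
          place_ev[OF v(1) x_nonconst v(2)] left_diff_distrib)
    finally show ?thesis using pos by (simp add: zero_le_mult_iff)
  qed
  from dvd_of_mult_at_le[OF nz this] obtain C where "A = B * C" by (auto simp: dvd_def)
  then have "f = ev x C" using AB by (simp add: ev_mult)
  then show ?thesis ..
qed

text \<open>
  The square of \<open>z = f - \<sigma> f = 2 b y\<close> is \<open>4 b\<^sup>2 G\<close>, and \<open>z\<close> satisfies the same bounds as \<open>f\<close>.  A pole of
  \<open>b\<close> over \<open>a\<close> would give \<open>b\<^sup>2\<close> a pole of order at least two in \<open>x - a\<close>, which the simple zeros of \<open>G\<close>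
  cannot compensate.  So \<open>b\<close> is a polynomial, and if it were not zero the degree \<open>2 deg b + deg G\<close> of
  \<open>z\<^sup>2\<close> would exceed \<open>2 g\<close>.
\<close>

lemma polynomial_of_bounded_poles:
  assumes reg: "\<And>v. v \<in> places \<iota> \<Longrightarrow> 0 \<le> v x \<Longrightarrow> val_ge v 0 f"
    and inf: "val_ge q (int g * q x) f" "val_ge (q \<circ> \<sigma>) (int g * q x) f"
  shows "\<exists>A. f = ev x A \<and> degree A \<le> g"
proof -
  obtain a b where ab: "a \<in> simple_subfield \<iota> x" "b \<in> simple_subfield \<iota> x" "f = a + b * y"
    using span by blast
  define z where "z = f - \<sigma> f"
  have z: "z = 2 * b * y"
    using ab by (simp add: z_def \<sigma>_add \<sigma>_mult \<sigma>_fixes \<sigma>_y algebra_simps)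
  have val_\<sigma>: "val_ge v n (\<sigma> f) \<longleftrightarrow> val_ge (v \<circ> \<sigma>) n f" for v n by (simp add: val_ge_def)
  have z_reg: "val_ge v 0 z" if v: "v \<in> places \<iota>" "0 \<le> v x" for v
  proof -
    have "val_ge (v \<circ> \<sigma>) 0 f"
      using reg[OF place_conj[OF v(1)]] v(2) unfolding conj_x .
    then show ?thesis
      unfolding z_def using reg[OF v] by (intro val_ge_diff[OF v(1)]) (simp_all only: val_\<sigma>)
  qed
  have z_q: "val_ge q (int g * q x) z"
    unfolding z_def using inf by (intro val_ge_diff[OF q]) (auto simp: val_\<sigma>)
  have "b = 0"
  proof (rule ccontr)
    assume b0: "b \<noteq> 0"
    have z0: "z \<noteq> 0" using z b0 two_neq_0 y_nonzero by simp
    have vz: "2 * v z = 2 * v b + v (ev x G)" if "v \<in> places \<iota>" for v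
    proof -
      have "v z = v b + v y" unfolding z using that b0 y_nonzero two_neq_0
        using place_const[OF that, of 2] by (simp add: place_mult const_2)
      then show ?thesis using place_power[OF that y_nonzero, of 2] y_sq by simp
    qed
    have "val_ge v 0 b" if v: "v \<in> places \<iota>" "0 \<le> v x" for v
    proof -
      obtain a where a: "val_ge v 1 (x - \<iota> a)" using finite_or_infinite_place[OF v(1)] v(2) by auto
      have pos: "0 < v (x - \<iota> a)" using place_pos[of v a] v a by simp
      obtain A B where AB: "ev x B \<noteq> 0" "b = ev x A / ev x B"
        using ab(2) unfolding simple_subfield_iff by blast
      with b0 have nz: "A \<noteq> 0" "B \<noteq> 0" by auto
      define k where "k = int (mult_at a A) - int (mult_at a B)"
      have vb: "v b = k * v (x - \<iota> a)"
        using nz unfolding AB(2) k_def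
        by (simp add: place_divide[OF v(1)] ev_nonzero[OF x_nonconst]
            place_ev[OF v(1) x_nonconst a] left_diff_distrib)
      have "0 \<le> 2 * v z" using z_reg[OF v] z0 by (simp add: val_ge_def)
      also have "\<dots> = (2 * k + int (mult_at a G)) * v (x - \<iota> a)"
        using vz[OF v(1)] vb place_ev[OF v(1) x_nonconst a G_nonzero] by (simp add: algebra_simps)
      finally have "0 \<le> 2 * k + int (mult_at a G)" using pos by (simp add: zero_le_mult_iff)
      then have "0 \<le> k" using squarefree[of a] by linarith
      with vb pos show ?thesis by (simp add: val_ge_def)
    qed
    from ev_of_regular[OF ab(2) this] obtain B where B: "b = ev x B" by blast
    with b0 have "B \<noteq> 0" by auto
    then have "2 * q z = int (2 * degree B + degree G) * q x"
      using vz[OF q] place_ev_pole[OF q q_pole] G_nonzero B by (simp add: algebra_simps)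
    moreover have "int (2 * g) * q x \<le> 2 * q z" using z_q z0 by (simp add: val_ge_def)
    ultimately have "int (2 * degree B + degree G) \<le> int (2 * g)"
      using q_pole by (simp add: mult_le_cancel_right)
    with degree_G_ge show False by linarith
  qed
  with ab have fK: "f \<in> simple_subfield \<iota> x" by simp
  from ev_of_regular[OF this reg] obtain A where A: "f = ev x A" by blast
  have "degree A \<le> g"
  proof (cases "A = 0")
    case False
    then have "int g * q x \<le> int (degree A) * q x"
      using inf(1) place_ev_pole[OF q q_pole False] by (simp add: A val_ge_def)
    with q_pole show ?thesis by (simp add: mult_le_cancel_right)
  qed simp
  with A show ?thesis by blast
qed

text \<open>
  Take a nonconstant function with a pole of order at most \<open>g\<close> at \<open>q\<close> and no other pole.  It is a
  polynomial in \<open>x\<close>, so it has equal orders at \<open>q\<close> and \<open>q \<circ> \<sigma>\<close>; if these were different points, it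
  would have no pole at all and be constant.
\<close>

lemma weierstrass_conj:
  assumes "weierstrass_point \<iota> g q"
  shows "q \<circ> \<sigma> = q"
proof (rule ccontr)
  assume unram: "q \<circ> \<sigma> \<noteq> q"
  let ?L = "RR_space \<iota> (frag_cmul (int g) (frag_of q))"
  have "\<exists>f\<in>?L. f \<notin> range \<iota>"
  proof (rule ccontr)
    assume "\<not> ?thesis"
    then have "?L \<subseteq> VS.span {1}" by (auto simp: VS.span_singleton)
    from VS.dim_le_card[OF this] assms show False
      by (simp add: weierstrass_point_def RR_dim_def)
  qed
  then obtain f where f: "f \<in> ?L" "f \<notin> range \<iota>" by blast
  have reg: "val_ge v 0 f" if "v \<in> places \<iota>" "v \<noteq> q" for v
    using f(1) that by (auto simp: RR_space_iff)
  have "- int g \<ge> int g * q x"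
    using mult_left_mono[of "q x" "- 1" "int g"] q_pole by simp
  moreover have "val_ge q (- int g) f" using f(1) q by (auto simp: RR_space_iff)
  ultimately have "val_ge q (int g * q x) f" by (rule val_ge_mono[rotated])
  moreover have conj_reg: "val_ge (q \<circ> \<sigma>) 0 f" using reg place_conj[OF q] unram by blast
  then have "val_ge (q \<circ> \<sigma>) (int g * q x) f"
    by (rule val_ge_mono) (use q_pole in \<open>simp add: mult_nonneg_nonpos\<close>)
  moreover have "val_ge v 0 f" if "v \<in> places \<iota>" "0 \<le> v x" for v
    using reg that q_pole by force
  ultimately obtain A where A: "f = ev x A" using polynomial_of_bounded_poles by blast
  have "degree A = 0"
  proof (rule ccontr)
    assume "degree A \<noteq> 0"
    then have "A \<noteq> 0" by auto
    have "(q \<circ> \<sigma>) f = int (degree A) * q x" "f \<noteq> 0"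
      using place_ev_pole[OF q q_pole \<open>A \<noteq> 0\<close>] by (simp_all add: A \<sigma>_ev)
    moreover have "int (degree A) * q x < 0"
      using \<open>degree A \<noteq> 0\<close> q_pole by (simp add: mult_pos_neg)
    ultimately show False using conj_reg by (simp add: val_ge_def)
  qed
  then obtain c where "A = [:c:]" by (metis degree_eq_zeroE)
  then show False using f(2) by (simp add: A ev_pCons)
qed

end

section \<open>Divisor classes\<close>

context function_field
begin

definition linearly_equivalent :: "'f divisor \<Rightarrow> 'f divisor \<Rightarrow> bool" (infix \<open>\<sim>\<close> 50) where
  "D \<sim> E \<longleftrightarrow> D - E \<in> principal_divisors \<iota>"

lemma lin_refl [simp]: "D \<sim> D"
  by (simp add: linearly_equivalent_def principal_0)

lemma lin_sym: "D \<sim> E \<Longrightarrow> E \<sim> D"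
  using principal_minus[of "D - E"] by (simp add: linearly_equivalent_def)

lemma lin_trans: "D \<sim> E \<Longrightarrow> E \<sim> F \<Longrightarrow> D \<sim> F"
  using principal_add[of "D - E" "E - F"] by (simp add: linearly_equivalent_def)

lemma lin_add: "D \<sim> E \<Longrightarrow> D' \<sim> E' \<Longrightarrow> D + D' \<sim> E + E'"
  using principal_add[of "D - E" "D' - E'"]
  by (simp add: linearly_equivalent_def algebra_simps)

lemma lin_minus: "D \<sim> E \<Longrightarrow> - D \<sim> - E"
  using principal_minus[of "D - E"] by (simp add: linearly_equivalent_def)

lemma lin_diff: "D \<sim> E \<Longrightarrow> D' \<sim> E' \<Longrightarrow> D - D' \<sim> E - E'"
  using lin_add[OF _ lin_minus, of D E D' E'] by simp

lemma divisor_class_eq: "divisor_class \<iota> D = {h + D | h. h \<in> principal_divisors \<iota>}"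
  by (auto simp: divisor_class_def r_coset_def degree_zero_divisors_def)

lemma divisor_class_eq_iff: "divisor_class \<iota> D = divisor_class \<iota> E \<longleftrightarrow> D \<sim> E"
proof
  assume "divisor_class \<iota> D = divisor_class \<iota> E"
  moreover have "D \<in> divisor_class \<iota> D" unfolding divisor_class_eq using principal_0 by force
  ultimately show "D \<sim> E" by (auto simp: divisor_class_eq linearly_equivalent_def)
next
  have sub: "divisor_class \<iota> D \<subseteq> divisor_class \<iota> E" if "D \<sim> E" for D E
  proof
    fix F assume "F \<in> divisor_class \<iota> D"
    then obtain h where h: "h \<in> principal_divisors \<iota>" "F = h + D" by (auto simp: divisor_class_eq)
    then have "F = (h + (D - E)) + E" by simp
    moreover have "h + (D - E) \<in> principal_divisors \<iota>"
      using h that by (intro principal_add) (simp_all add: linearly_equivalent_def)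
    ultimately show "F \<in> divisor_class \<iota> E" unfolding divisor_class_eq by blast
  qed
  assume "D \<sim> E"
  then show "divisor_class \<iota> D = divisor_class \<iota> E" using sub lin_sym by blast
qed

text \<open>
  Principal divisors are closed under addition, so the product of cosets is a single coset.
\<close>

lemma Jac_mult: "divisor_class \<iota> D \<otimes>\<^bsub>Jac \<iota>\<^esub> divisor_class \<iota> E = divisor_class \<iota> (D + E)"
proof -
  have "divisor_class \<iota> D \<otimes>\<^bsub>Jac \<iota>\<^esub> divisor_class \<iota> E =
      {h + D + (h' + E) | h h'. h \<in> principal_divisors \<iota> \<and> h' \<in> principal_divisors \<iota>}"
    by (auto simp: Jac_def set_mult_def degree_zero_divisors_def divisor_class_eq)
  also have "\<dots> = divisor_class \<iota> (D + E)"
  proof (intro equalityI subsetI)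
    fix F assume "F \<in> {h + D + (h' + E) | h h'. h \<in> principal_divisors \<iota> \<and> h' \<in> principal_divisors \<iota>}"
    then obtain h h' where h: "h \<in> principal_divisors \<iota>" "h' \<in> principal_divisors \<iota>"
      "F = h + D + (h' + E)" by blast
    then have "F = (h + h') + (D + E)" by (simp add: algebra_simps)
    with principal_add[OF h(1,2)] show "F \<in> divisor_class \<iota> (D + E)"
      unfolding divisor_class_eq by blast
  next
    fix F assume "F \<in> divisor_class \<iota> (D + E)"
    then obtain h where h: "h \<in> principal_divisors \<iota>" "F = h + (D + E)"
      by (auto simp: divisor_class_eq)
    then have "F = h + D + (0 + E)" by (simp add: algebra_simps)
    with h(1) principal_0
    show "F \<in> {h + D + (h' + E) | h h'. h \<in> principal_divisors \<iota> \<and> h' \<in> principal_divisors \<iota>}"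
      by blast
  qed
  finally show ?thesis .
qed

lemma Jac_one: "\<one>\<^bsub>Jac \<iota>\<^esub> = divisor_class \<iota> 0"
  by (simp add: Jac_def divisor_class_eq)

lemma Jac_pow: "divisor_class \<iota> D [^]\<^bsub>Jac \<iota>\<^esub> j = divisor_class \<iota> (frag_cmul (int j) D)"
proof (induction j)
  case 0
  then show ?case by (simp add: nat_pow_def Jac_one)
next
  case (Suc j)
  have "divisor_class \<iota> D [^]\<^bsub>Jac \<iota>\<^esub> Suc j
      = divisor_class \<iota> D [^]\<^bsub>Jac \<iota>\<^esub> j \<otimes>\<^bsub>Jac \<iota>\<^esub> divisor_class \<iota> D"
    by (simp add: nat_pow_def)
  also have "\<dots> = divisor_class \<iota> (frag_cmul (int j) D + D)"
    by (simp add: Suc.IH Jac_mult)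
  also have "frag_cmul (int j) D + D = frag_cmul (int (Suc j)) D"
    by (simp add: frag_cmul_distrib algebra_simps)
  finally show ?case .
qed

end

locale hyperelliptic_jacobian = pointed_cover \<iota> x y G \<sigma> q g
  for \<iota> :: "'k::{alg_closed_field, field_char_0} \<Rightarrow> 'f::field" and x y G \<sigma> q g +
  assumes weierstrass: "weierstrass_point \<iota> g q"
begin

lemma conj_q [simp]: "q \<circ> \<sigma> = q"
  using weierstrass by (rule weierstrass_conj)

lemma q_x: "q x = - 2"
  using places_at_infinity(1)[OF q q_pole] by simp

lemma pole_only_q: "v \<in> places \<iota> \<Longrightarrow> v x < 0 \<longleftrightarrow> v = q"
  using places_at_infinity(3)[OF q q_pole, of v] q_pole by auto

lemma fibre_q: "fibre q = frag_cmul 2 (frag_of q)"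
  unfolding fibre_def conj_q using frag_cmul_distrib[of 1 1 "frag_of q"] by simp

abbreviation nq :: "int \<Rightarrow> 'f divisor" where
  "nq n \<equiv> frag_cmul n (frag_of q)"

lemma nq_divisor: "nq n \<in> divisors \<iota>"
  using q by (simp add: divisors_cmul)

lemma fibre_lin: "v \<in> places \<iota> \<Longrightarrow> fibre v \<sim> nq 2"
proof (cases "v = q")
  case False
  assume v: "v \<in> places \<iota>"
  then obtain a where a: "val_ge v 1 (x - \<iota> a)"
    using finite_or_infinite_place[OF v] pole_only_q False by blast
  moreover have "x - \<iota> a \<noteq> 0" using x_nonconst by auto
  ultimately show ?thesis
    using has_div_linear[OF v a] unfolding linearly_equivalent_def principal_divisors_iff fibre_q by blast
qed (simp add: fibre_q)

lemma conj_divisor_lin: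
  assumes "D \<in> divisors \<iota>"
  shows "D + conj_divisor D \<sim> nq (2 * divisor_degree D)"
  using assms unfolding divisors_iff
proof (induction D rule: frag_induction)
  case zero
  show ?case by (simp add: conj_divisor_def)
next
  case (one v)
  then show ?case using fibre_lin[of v] by (simp add: conj_divisor_def fibre_def)
next
  case (diff D E)
  from lin_diff[OF this] show ?case
    by (simp add: conj_divisor_diff divisor_degree_diff frag_cmul_diff_distrib algebra_simps)
qed

lemma effective_conj: "effective \<iota> D \<Longrightarrow> effective \<iota> (conj_divisor D)"
  by (auto simp: effective_def conj_divisor_in lookup_conj_divisor)

section \<open>Effective divisors equivalent to a multiple of \<open>q\<close>\<close>

text \<open>
  A function \<open>f\<close> with divisor \<open>M - n q\<close> has a pole of order at most \<open>2 g\<close> at \<open>q\<close> and no other pole.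
  It is therefore a polynomial \<open>A\<close> in \<open>x\<close>: fixed by \<open>\<sigma>\<close>, of even order at the branch points, where
  \<open>x - a\<close> has order two, and of order \<open>- 2 deg A\<close> at \<open>q\<close>.
\<close>

lemma effective_lin_nq:
  assumes M: "effective \<iota> M" "divisor_degree M = int n" "n \<le> 2 * g" "M \<sim> nq (int n)"
  shows "v \<in> places \<iota> \<Longrightarrow> lookup M (v \<circ> \<sigma>) = lookup M v"
    and "v \<in> places \<iota> \<Longrightarrow> v \<circ> \<sigma> = v \<Longrightarrow> v \<noteq> q \<Longrightarrow> even (lookup M v)"
    and "even (lookup M q) \<longleftrightarrow> even n"
proof -
  obtain f where f: "f \<noteq> 0" "has_div \<iota> f (M - nq (int n))"
    using M(4) by (auto simp: linearly_equivalent_def principal_divisors_iff)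
  have vf: "v f = lookup M v - (if v = q then int n else 0)" if "v \<in> places \<iota>" for v
    using f(2) that by (auto simp: has_div_def lookup_minus)
  have eff: "0 \<le> lookup M v" for v using M(1) by (simp add: effective_def)
  have inf: "val_ge q (int g * q x) f"
    using vf[OF q] eff[of q] M(3) by (simp add: val_ge_def q_x)
  have "val_ge v 0 f" if "v \<in> places \<iota>" "0 \<le> v x" for v
    using vf[OF that(1)] eff[of v] that q_pole by (auto simp: val_ge_def)
  from polynomial_of_bounded_poles[OF this inf] inf
  obtain A where A: "f = ev x A" unfolding conj_q by blast
  with f(1) have A0: "A \<noteq> 0" by auto
  show "lookup M (v \<circ> \<sigma>) = lookup M v" if v: "v \<in> places \<iota>"
  proof -
    have "(v \<circ> \<sigma>) f = v f" by (simp add: A \<sigma>_ev)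
    moreover have "v \<circ> \<sigma> = q \<longleftrightarrow> v = q" using conj_eq_iff[of v q] by simp
    ultimately show ?thesis using vf[OF v] vf[OF place_conj[OF v]] by simp
  qed
  show "even (lookup M v)" if v: "v \<in> places \<iota>" "v \<circ> \<sigma> = v" "v \<noteq> q"
  proof -
    obtain a where a: "val_ge v 1 (x - \<iota> a)"
      using finite_or_infinite_place[OF v(1)] pole_only_q v by blast
    have "v (x - \<iota> a) = 2" using places_above(1)[OF squarefree, of v a] v a by simp
    then have "v f = 2 * int (mult_at a A)"
      using place_ev[OF v(1) x_nonconst a A0] by (simp add: A)
    with vf[OF v(1)] v(3) have "lookup M v = 2 * int (mult_at a A)" by simp
    then show ?thesis by simp
  qed
  have "q f = - 2 * int (degree A)" using place_ev_pole[OF q q_pole A0] by (simp add: A q_x)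
  then have "lookup M q = int n - 2 * int (degree A)" using vf[OF q] by simp
  then show "even (lookup M q) \<longleftrightarrow> even n" by simp
qed

text \<open>
  The divisor contains neither \<open>q\<close> nor the whole fibre through any other point; at a branch point
  the fibre is twice the point.
\<close>

definition reduced :: "'f divisor \<Rightarrow> bool" where
  "reduced D \<longleftrightarrow> lookup D q = 0 \<and> (\<forall>v\<in>places \<iota>.
     if v \<circ> \<sigma> = v then lookup D v \<le> 1 else lookup D v = 0 \<or> lookup D (v \<circ> \<sigma>) = 0)"

text \<open>
  Since \<open>E + \<sigma> E \<sim> 2 e q\<close>, the divisor \<open>M = D + \<sigma> E\<close> is equivalent to \<open>(d + e) q\<close> and so is symmetric.
  As \<open>D\<close> contains no fibre, its points must be balanced by conjugates in \<open>\<sigma> E\<close>, whence \<open>D \<le> E\<close>.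
\<close>

lemma reduced_degree_le:
  assumes D: "effective \<iota> D" "divisor_degree D = int d" "reduced D"
    and E: "effective \<iota> E" "divisor_degree E = int e"
    and lin: "D - nq (int d) \<sim> E - nq (int e)" and le: "d + e \<le> 2 * g"
  shows "d \<le> e"
proof -
  define M where "M = D + conj_divisor E"
  have E_div: "E \<in> divisors \<iota>" and D_div: "D \<in> divisors \<iota>" using D E by (simp_all add: effective_def)
  have M: "effective \<iota> M" "divisor_degree M = int (d + e)"
    using D E effective_conj by (simp_all add: M_def effective_add divisor_degree_add degree_conj_divisor)
  have "D - nq (int d) + (conj_divisor E + nq (int d)) \<sim> E - nq (int e) + (conj_divisor E + nq (int d))"
    using lin by (rule lin_add) simp
  then have "M \<sim> (E + conj_divisor E) + (nq (int d) - nq (int e))"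
    by (simp add: M_def algebra_simps)
  moreover have "(E + conj_divisor E) + (nq (int d) - nq (int e)) \<sim> nq (2 * int e) + (nq (int d) - nq (int e))"
    using conj_divisor_lin[OF E_div] by (intro lin_add) (simp_all add: E(2))
  moreover have "nq (2 * int e) + (nq (int d) - nq (int e)) = nq (int (d + e))"
    by (simp flip: frag_cmul_distrib frag_cmul_diff_distrib add: algebra_simps)
  ultimately have "M \<sim> nq (int (d + e))" by (metis lin_trans)
  note * = effective_lin_nq[OF M le this]
  have nonneg: "0 \<le> lookup D v" "0 \<le> lookup E v" for v
    using D(1) E(1) by (simp_all add: effective_def)
  have "lookup D v \<le> lookup E v" if v: "v \<in> places \<iota>" for v
  proof (cases "v = q")
    case True
    then show ?thesis using D(3) nonneg by (simp add: reduced_def)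
  next
    case v_q: False
    show ?thesis
    proof (cases "v \<circ> \<sigma> = v")
      case True
      then have "even (lookup D v + lookup E v)"
        using *(2)[OF v True v_q] by (simp add: M_def lookup_add lookup_conj_divisor)
      moreover have "lookup D v \<le> 1" using D(3) v True by (auto simp: reduced_def)
      ultimately show ?thesis using nonneg[of v] by presburger
    next
      case False
      have "lookup D v + lookup E (v \<circ> \<sigma>) = lookup D (v \<circ> \<sigma>) + lookup E v"
        using *(1)[OF v] by (simp add: M_def lookup_add lookup_conj_divisor)
      moreover have "lookup D v = 0 \<or> lookup D (v \<circ> \<sigma>) = 0"
        using D(3) v False by (auto simp: reduced_def)
      ultimately show ?thesis using nonneg[of v] nonneg[of "v \<circ> \<sigma>"] by linarith
    qed
  qed
  then have "effective \<iota> (E - D)"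
    using D_div E_div by (intro effectiveI) (simp_all add: divisors_diff lookup_minus)
  from effective_degree_nonneg[OF this] show ?thesis
    by (simp add: divisor_degree_diff D(2) E(2))
qed

section \<open>The theta stratification\<close>

text \<open>
  Membership of the class of \<open>X\<close> in \<open>\<Theta>\<^sub>d\<close>, expressed by divisors.
\<close>

definition theta :: "nat \<Rightarrow> 'f divisor \<Rightarrow> bool" where
  "theta d X \<longleftrightarrow> (\<exists>E. effective \<iota> E \<and> divisor_degree E = int d \<and> X \<sim> E - nq (int d))"

lemma Theta_iff: "divisor_class \<iota> X \<in> Theta \<iota> q d \<longleftrightarrow> theta d X"
proof
  assume "divisor_class \<iota> X \<in> Theta \<iota> q d"
  then obtain ps where "length ps = d" "set ps \<subseteq> places \<iota>" "X \<sim> point_sum ps - nq (int d)"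
    by (auto simp: Theta_def divisor_class_eq_iff)
  then show "theta d X"
    unfolding theta_def using effective_point_sum degree_point_sum by metis
next
  assume "theta d X"
  then obtain E where E: "effective \<iota> E" "divisor_degree E = int d" "X \<sim> E - nq (int d)"
    by (auto simp: theta_def)
  from effective_obtain_points[OF E(1,2)] E(3) show "divisor_class \<iota> X \<in> Theta \<iota> q d"
    by (auto simp: Theta_def divisor_class_eq_iff)
qed

lemma theta_cong: "X \<sim> Y \<Longrightarrow> theta d X \<longleftrightarrow> theta d Y"
  unfolding theta_def using lin_trans lin_sym by blast

lemma theta_add:
  assumes "theta d X" "theta e Y"
  shows "theta (d + e) (X + Y)"
proof -
  obtain D E where D: "effective \<iota> D" "divisor_degree D = int d" "X \<sim> D - nq (int d)"
    and E: "effective \<iota> E" "divisor_degree E = int e" "Y \<sim> E - nq (int e)"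
    using assms by (auto simp: theta_def)
  have "(D - nq (int d)) + (E - nq (int e)) = D + E - nq (int (d + e))"
    by (simp add: frag_cmul_distrib algebra_simps)
  then have "X + Y \<sim> D + E - nq (int (d + e))" using lin_add[OF D(3) E(3)] by (simp only:)
  then show ?thesis
    unfolding theta_def using D E
    by (intro exI[of _ "D + E"]) (simp add: effective_add divisor_degree_add)
qed

lemma theta_0: "theta 0 0"
  unfolding theta_def by (intro exI[of _ 0]) (simp add: effective_def)

lemma theta_point: "p \<in> places \<iota> \<Longrightarrow> theta 1 (frag_of p - frag_of q)"
  unfolding theta_def by (intro exI[of _ "frag_of p"]) (simp add: effective_def)

lemma theta_Suc: "theta d X \<Longrightarrow> theta (Suc d) X"
  using theta_add[OF _ theta_point[OF q], of d X] by simp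

lemma theta_mono:
  assumes "theta d X" "d \<le> e"
  shows "theta e X"
  using assms(2,1) by (induction rule: dec_induct) (auto intro: theta_Suc)

text \<open>
  If \<open>X \<sim> D - d q\<close>, then \<open>- X \<sim> \<sigma> D - d q\<close>, because \<open>D + \<sigma> D \<sim> 2 d q\<close>.
\<close>

lemma theta_minus:
  assumes "theta d X"
  shows "theta d (- X)"
proof -
  obtain D where D: "effective \<iota> D" "divisor_degree D = int d" "X \<sim> D - nq (int d)"
    using assms by (auto simp: theta_def)
  have D_div: "D \<in> divisors \<iota>" using D(1) by (simp add: effective_def)
  have "- X + (nq (2 * int d)) \<sim> - (D - nq (int d)) + (D + conj_divisor D)"
    using lin_add[OF lin_minus[OF D(3)] lin_sym[OF conj_divisor_lin[OF D_div]]]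
    by (simp add: D(2))
  then have "- X + nq (2 * int d) - nq (2 * int d) \<sim> - (D - nq (int d)) + (D + conj_divisor D) - nq (2 * int d)"
    by (rule lin_diff) simp
  moreover have "- X + nq (2 * int d) - nq (2 * int d) = - X" by simp
  moreover have "- (D - nq (int d)) + (D + conj_divisor D) - nq (2 * int d) = conj_divisor D - nq (int d)"
    by (rule poly_mapping_eqI) (simp add: lookup_add lookup_minus algebra_simps)
  ultimately have "- X \<sim> conj_divisor D - nq (int d)" by (simp only:)
  then show ?thesis
    unfolding theta_def using D
    by (intro exI[of _ "conj_divisor D"]) (simp add: effective_conj degree_conj_divisor)
qed

text \<open>
  The definition of the genus gives \<open>L(X + g q)\<close> positive dimension.  A nonzero function in it turns
  \<open>X + g q\<close> into an equivalent effective divisor, of the same degree by the product formula.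
\<close>

lemma theta_genus:
  assumes X: "X \<in> divisors \<iota>" "divisor_degree X = 0"
  shows "theta g X"
proof -
  define D where "D = X + nq (int g)"
  have D: "D \<in> divisors \<iota>" "divisor_degree D = int g"
    using X by (simp_all add: D_def divisors_add nq_divisor divisor_degree_simps)
  have "0 < RR_dim \<iota> D" using degree_le_RR_dim[OF D(1)] D(2) by simp
  have "\<not> RR_space \<iota> D \<subseteq> {0}"
  proof
    assume "RR_space \<iota> D \<subseteq> {0}"
    then have "RR_space \<iota> D \<subseteq> VS.span {}" by simp
    from VS.dim_le_card[OF this] \<open>0 < RR_dim \<iota> D\<close> show False by (simp add: RR_dim_def)
  qed
  then obtain f where f: "f \<in> RR_space \<iota> D" "f \<noteq> 0" by blast
  obtain F where F: "has_div \<iota> f F" "divisor_degree F = 0" using exists_div[OF f(2)] by blast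
  have "effective \<iota> (D + F)"
  proof (rule effectiveI)
    show "D + F \<in> divisors \<iota>" using D F by (simp add: divisors_add has_div_def)
    fix v assume "v \<in> places \<iota>"
    then show "0 \<le> lookup (D + F) v"
      using f F by (auto simp: RR_space_def lookup_add has_div_def add.commute)
  qed
  moreover have "F \<in> principal_divisors \<iota>" using F f by (auto simp: principal_divisors_iff)
  then have "X \<sim> D + F - nq (int g)"
    using principal_minus by (simp add: linearly_equivalent_def D_def)
  ultimately show ?thesis
    unfolding theta_def using D F by (intro exI[of _ "D + F"]) (simp add: divisor_degree_add)
qed

definition degree_zero :: "'f divisor \<Rightarrow> bool" where
  "degree_zero X \<longleftrightarrow> X \<in> divisors \<iota> \<and> divisor_degree X = 0"

lemma degree_zero_closed:
  "degree_zero 0" "degree_zero X \<Longrightarrow> degree_zero Y \<Longrightarrow> degree_zero (X + Y)"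
  "degree_zero X \<Longrightarrow> degree_zero (- X)" "degree_zero X \<Longrightarrow> degree_zero (frag_cmul n X)"
  "p \<in> places \<iota> \<Longrightarrow> degree_zero (frag_of p - frag_of q)"
  using q by (simp_all add: degree_zero_def divisors_closed divisor_degree_simps)

text \<open>
  The index of the stratum \<open>\<Theta>\<^sub>d\<^sup>0\<close> that contains the class of \<open>X\<close>.
\<close>

definition weight :: "'f divisor \<Rightarrow> nat" where
  "weight X = (LEAST d. theta d X)"

lemma theta_iff_weight: "degree_zero X \<Longrightarrow> theta d X \<longleftrightarrow> weight X \<le> d"
proof
  assume "degree_zero X"
  then have "theta g X" by (simp add: degree_zero_def theta_genus)
  then have "theta (weight X) X" unfolding weight_def by (rule LeastI)
  then show "weight X \<le> d \<Longrightarrow> theta d X" by (rule theta_mono)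
qed (simp add: weight_def Least_le)

lemma weight_le_genus: "degree_zero X \<Longrightarrow> weight X \<le> g"
  using theta_iff_weight theta_genus by (auto simp: degree_zero_def)

lemma weight_cong: "X \<sim> Y \<Longrightarrow> weight X = weight Y"
  unfolding weight_def using theta_cong by metis

lemma weight_0 [simp]: "weight 0 = 0"
  using theta_iff_weight[OF degree_zero_closed(1), of 0] theta_0 by simp

lemma weight_add:
  "degree_zero X \<Longrightarrow> degree_zero Y \<Longrightarrow> weight (X + Y) \<le> weight X + weight Y"
  using theta_iff_weight theta_add degree_zero_closed(2) by (metis order_refl)

lemma weight_minus: "degree_zero X \<Longrightarrow> weight (- X) = weight X"
  using theta_iff_weight theta_minus degree_zero_closed(3) by (metis le_antisym minus_minus order_refl)

lemma mult_profile_eq_weight: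
  assumes "degree_zero X"
  shows "mult_profile \<iota> g q (divisor_class \<iota> X) j = weight (frag_cmul (int j) X)"
  unfolding mult_profile_def
proof (rule the_equality)
  have jX: "degree_zero (frag_cmul (int j) X)" using assms by (rule degree_zero_closed)
  have iff: "divisor_class \<iota> X [^]\<^bsub>Jac \<iota>\<^esub> j \<in> Theta0 \<iota> q e \<longleftrightarrow> weight (frag_cmul (int j) X) = e" for e
    by (auto simp: Theta0_def Jac_pow Theta_iff theta_iff_weight[OF jX])
  show "weight (frag_cmul (int j) X) \<le> g \<and>
      divisor_class \<iota> X [^]\<^bsub>Jac \<iota>\<^esub> j \<in> Theta0 \<iota> q (weight (frag_cmul (int j) X))"
    using iff weight_le_genus[OF jX] by simp
  show "e = weight (frag_cmul (int j) X)"
    if "e \<le> g \<and> divisor_class \<iota> X [^]\<^bsub>Jac \<iota>\<^esub> j \<in> Theta0 \<iota> q e" for e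
    using iff that by simp
qed

section \<open>Reduced representatives and their weights\<close>

text \<open>
  Removing \<open>q\<close>, or a fibre, which is equivalent to \<open>2 q\<close>, would leave an effective representative
  of smaller degree.
\<close>

lemma reduced_of_weight:
  assumes X: "degree_zero X"
    and D: "effective \<iota> D" "divisor_degree D = int (weight X)" "X \<sim> D - nq (int (weight X))"
  shows "reduced D"
proof (rule ccontr)
  assume not_red: "\<not> reduced D"
  have D_div: "D \<in> divisors \<iota>" and nonneg: "0 \<le> lookup D v" for v
    using D(1) by (simp_all add: effective_def)
  have smaller: False
    if F: "effective \<iota> F" "F \<sim> nq (divisor_degree F)" "0 < divisor_degree F" "effective \<iota> (D - F)" for F
  proof -
    define e where "e = nat (divisor_degree (D - F))"
    have e: "divisor_degree (D - F) = int e"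
      using effective_degree_nonneg[OF F(4)] by (simp add: e_def)
    then have we: "int (weight X) = int e + divisor_degree F"
      using D(2) by (simp add: divisor_degree_diff)
    have "D - nq (int (weight X)) - (F - nq (divisor_degree F)) \<sim> D - nq (int (weight X)) - 0"
    proof (rule lin_diff)
      show "F - nq (divisor_degree F) \<sim> 0" using F(2) by (simp add: linearly_equivalent_def)
    qed simp
    moreover have "D - nq (int (weight X)) - (F - nq (divisor_degree F)) = D - F - nq (int e)"
      by (simp add: we frag_cmul_distrib algebra_simps)
    ultimately have "D - F - nq (int e) \<sim> D - nq (int (weight X))" by simp
    then have "X \<sim> D - F - nq (int e)" using lin_trans[OF D(3) lin_sym] by blast
    then have "theta e X" unfolding theta_def using F(4) e by blast
    then show False using theta_iff_weight[OF X] we F(3) by simp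
  qed
  have frag_eff: "effective \<iota> (frag_of v)" if "v \<in> places \<iota>" for v
    using that by (simp add: effective_def)
  show False
  proof (cases "lookup D q = 0")
    case False
    then have "1 \<le> lookup D q" using nonneg[of q] by linarith
    then have "effective \<iota> (D - frag_of q)"
      using D_div q nonneg by (intro effectiveI) (auto simp: divisors_diff lookup_minus)
    then show False by (rule smaller[OF frag_eff[OF q], rotated -1]) auto
  next
    case True
    with not_red obtain v where v0: "v \<in> places \<iota>"
      "\<not> (if v \<circ> \<sigma> = v then lookup D v \<le> 1 else lookup D v = 0 \<or> lookup D (v \<circ> \<sigma>) = 0)"
      unfolding reduced_def by blast
    have v: "v \<in> places \<iota>"
      "if v \<circ> \<sigma> = v then 2 \<le> lookup D v else 1 \<le> lookup D v \<and> 1 \<le> lookup D (v \<circ> \<sigma>)"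
      using v0 nonneg[of v] nonneg[of "v \<circ> \<sigma>"] by (auto split: if_splits simp del: comp_apply)
    have "effective \<iota> (D - fibre v)"
      using D_div v nonneg
      by (intro effectiveI) (auto simp: divisors_diff fibre_divisor lookup_minus lookup_fibre split: if_splits)
    moreover have "effective \<iota> (fibre v)"
      unfolding fibre_def using v frag_eff place_conj by (intro effective_add) auto
    ultimately show False
      using smaller[of "fibre v"] fibre_lin[OF v(1)] by (simp add: degree_fibre)
  qed
qed

lemma weight_representative:
  assumes "degree_zero X"
  shows "\<exists>D. effective \<iota> D \<and> divisor_degree D = int (weight X) \<and> X \<sim> D - nq (int (weight X))
    \<and> reduced D"
proof -
  have "theta (weight X) X" using theta_iff_weight[OF assms] by simp
  then show ?thesis using reduced_of_weight[OF assms] unfolding theta_def by blast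
qed

context
  fixes p
  assumes p: "p \<in> places \<iota>" and p_q: "p \<noteq> q"
begin

abbreviation "\<xi> \<equiv> frag_of p - frag_of q"

text \<open>
  Let \<open>D\<close> and \<open>E\<close> represent \<open>X\<close> and \<open>X + \<xi>\<close> with the same minimal degree \<open>d\<close>.  Then \<open>D + p + \<sigma> E\<close>
  is equivalent to \<open>(2 d + 1) q\<close>, so \<open>q\<close> occurs in it with odd multiplicity.  But \<open>q\<close> occurs
  neither in the reduced divisors \<open>D\<close> and \<open>E\<close> nor in \<open>p\<close>.
\<close>

lemma weight_step_neq:
  assumes X: "degree_zero X" and less: "weight X < g"
  shows "weight (X + \<xi>) \<noteq> weight X"
proof
  assume eq: "weight (X + \<xi>) = weight X"
  define d where "d = weight X"
  have X': "degree_zero (X + \<xi>)" using X p by (intro degree_zero_closed)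
  obtain D where D: "effective \<iota> D" "divisor_degree D = int d" "X \<sim> D - nq (int d)" "reduced D"
    using weight_representative[OF X] by (auto simp: d_def)
  obtain E where E: "effective \<iota> E" "divisor_degree E = int d" "X + \<xi> \<sim> E - nq (int d)" "reduced E"
    using weight_representative[OF X'] by (auto simp: eq d_def)
  have E_div: "E \<in> divisors \<iota>" using E by (simp add: effective_def)
  define M where "M = D + frag_of p + conj_divisor E"
  have M: "effective \<iota> M" "divisor_degree M = int (2 * d + 1)" "2 * d + 1 \<le> 2 * g"
    using D(1,2) E(1,2) p effective_conj less
    by (auto simp: M_def d_def divisor_degree_add degree_conj_divisor effective_def divisors_add lookup_add)
  have "(D - nq (int d)) + \<xi> \<sim> E - nq (int d)"
    using lin_add[OF lin_sym[OF D(3)] lin_refl, of \<xi>] E(3) lin_trans by blast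
  then have "(D - nq (int d)) + \<xi> + (conj_divisor E + nq (int d) + frag_of q)
      \<sim> E - nq (int d) + (conj_divisor E + nq (int d) + frag_of q)"
    by (rule lin_add) simp
  moreover have "(D - nq (int d)) + \<xi> + (conj_divisor E + nq (int d) + frag_of q) = M"
    by (simp add: M_def algebra_simps)
  moreover have "E - nq (int d) + (conj_divisor E + nq (int d) + frag_of q) = E + conj_divisor E + frag_of q"
    by (simp add: algebra_simps)
  moreover have "E + conj_divisor E + frag_of q \<sim> nq (2 * int d) + frag_of q"
    using conj_divisor_lin[OF E_div] by (intro lin_add) (simp_all add: E(2))
  moreover have "nq (2 * int d) + frag_of q = nq (int (2 * d + 1))"
    using frag_cmul_distrib[of "2 * int d" 1 "frag_of q"] by (simp add: algebra_simps)
  ultimately have "M \<sim> nq (int (2 * d + 1))" by (metis lin_trans)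
  from effective_lin_nq(3)[OF M this] have "odd (lookup M q)" by simp
  moreover have "lookup M q = 0"
    using D(4) E(4) p_q by (simp add: M_def lookup_add lookup_conj_divisor reduced_def)
  ultimately show False by simp
qed

text \<open>
  Let \<open>D\<close> represent \<open>X\<close> with minimal degree \<open>d\<close>.  As the weight of \<open>X + \<xi>\<close> is \<open>d + 1\<close>, the divisor
  \<open>D + p\<close> is minimal and hence reduced.  Then \<open>D\<close> avoids the conjugate of \<open>p\<close>, which is different
  from \<open>p\<close>, and \<open>D + 2 p\<close> is reduced as well.  Its degree \<open>d + 2\<close> cannot exceed the degree \<open>d\<close>
  of another representative of the same class.
\<close>

lemma weight_no_peak:
  assumes X: "degree_zero X" and unram: "p \<circ> \<sigma> \<noteq> p"
    and up: "weight (X + \<xi>) = weight X + 1"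
  shows "weight (X + \<xi> + \<xi>) \<noteq> weight X"
proof
  assume down: "weight (X + \<xi> + \<xi>) = weight X"
  define d where "d = weight X"
  have X1: "degree_zero (X + \<xi>)" and X2: "degree_zero (X + \<xi> + \<xi>)"
    using X p by (auto intro!: degree_zero_closed(2,5))
  obtain D where D: "effective \<iota> D" "divisor_degree D = int d" "X \<sim> D - nq (int d)"
    using weight_representative[OF X] by (auto simp: d_def)
  obtain E where E: "effective \<iota> E" "divisor_degree E = int d" "X + \<xi> + \<xi> \<sim> E - nq (int d)"
    using weight_representative[OF X2] by (auto simp: down d_def)
  have p_eff: "effective \<iota> (frag_of p)" using p by (simp add: effective_def)
  have nq_Suc: "nq (int (Suc n)) = nq (int n) + frag_of q" for n
    using frag_cmul_distrib[of "int n" 1 "frag_of q"] by (simp add: add.commute)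
  have step: "Y + \<xi> \<sim> F + frag_of p - nq (int (Suc n))" if "Y \<sim> F - nq (int n)" for Y F n
    using lin_add[OF that lin_refl, of \<xi>] by (simp add: nq_Suc algebra_simps del: of_nat_Suc)
  note D1 = step[OF D(3)]
  have "reduced (D + frag_of p)"
  proof (rule reduced_of_weight[OF X1])
    show "effective \<iota> (D + frag_of p)" using D(1) p_eff by (rule effective_add)
  qed (use D D1 up in \<open>simp_all add: divisor_degree_add d_def\<close>)
  then have red: "lookup D q = 0" "\<And>v. v \<in> places \<iota> \<Longrightarrow>
      if v \<circ> \<sigma> = v then lookup (D + frag_of p) v \<le> 1
      else lookup (D + frag_of p) v = 0 \<or> lookup (D + frag_of p) (v \<circ> \<sigma>) = 0"
    using p_q by (auto simp: reduced_def lookup_add)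
  have nonneg: "0 \<le> lookup D v" for v using D(1) by (simp add: effective_def)
  have "lookup D (p \<circ> \<sigma>) = 0"
    using red(2)[OF p] unram nonneg[of p] by (auto simp: lookup_add)
  have "reduced (D + frag_of p + frag_of p)"
    unfolding reduced_def
  proof (intro conjI ballI)
    show "lookup (D + frag_of p + frag_of p) q = 0" using red(1) p_q by (simp add: lookup_add)
    fix v assume v: "v \<in> places \<iota>"
    consider "v = p" | "v = p \<circ> \<sigma>" | "v \<noteq> p" "v \<circ> \<sigma> \<noteq> p" using conj_eq_iff[of v p] by blast
    then show "if v \<circ> \<sigma> = v then lookup (D + frag_of p + frag_of p) v \<le> 1
        else lookup (D + frag_of p + frag_of p) v = 0 \<or> lookup (D + frag_of p + frag_of p) (v \<circ> \<sigma>) = 0"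
    proof cases
      case 1
      then show ?thesis using unram \<open>lookup D (p \<circ> \<sigma>) = 0\<close> by (simp add: lookup_add del: comp_apply)
    next
      case 2
      then have "v \<noteq> p" "v \<circ> \<sigma> = p" using unram by auto
      then show ?thesis using \<open>lookup D (p \<circ> \<sigma>) = 0\<close> 2 by (simp add: lookup_add del: comp_apply)
    next
      case 3
      then show ?thesis using red(2)[OF v] by (simp add: lookup_add del: comp_apply split: if_splits)
    qed
  qed
  moreover have "effective \<iota> (D + frag_of p + frag_of p)"
    using D(1) p_eff by (intro effective_add)
  moreover have "divisor_degree (D + frag_of p + frag_of p) = int (Suc (Suc d))"
    using D(2) by (simp add: divisor_degree_add)
  moreover have "D + frag_of p + frag_of p - nq (int (Suc (Suc d))) \<sim> E - nq (int d)"
    using lin_trans[OF lin_sym[OF step[OF D1]] E(3)] .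
  moreover have "Suc (Suc d) + d \<le> 2 * g"
    using weight_le_genus[OF X1] up by (simp add: d_def)
  ultimately have "Suc (Suc d) \<le> d" using E(1,2) reduced_degree_le by blast
  then show False by simp
qed

text \<open>
  The divisor \<open>N p\<close> is reduced, so it cannot be equivalent to \<open>N q\<close> without being zero.
\<close>

lemma weight_multiple_nonzero:
  assumes unram: "p \<circ> \<sigma> \<noteq> p" and N: "1 \<le> N" "N \<le> 2 * g"
  shows "weight (frag_cmul (int N) \<xi>) \<noteq> 0"
proof
  assume "weight (frag_cmul (int N) \<xi>) = 0"
  then have "theta 0 (frag_cmul (int N) \<xi>)"
    using theta_iff_weight[of "frag_cmul (int N) \<xi>" 0] degree_zero_closed(4,5) p by simp
  then obtain E where E: "effective \<iota> E" "divisor_degree E = int 0" "frag_cmul (int N) \<xi> \<sim> E - nq (int 0)"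
    by (auto simp: theta_def)
  define D where "D = frag_cmul (int N) (frag_of p)"
  have D: "effective \<iota> D" "divisor_degree D = int N"
    using p by (simp_all add: D_def effective_def divisors_cmul divisor_degree_cmul)
  have "reduced D"
    using unram p_q by (auto simp: reduced_def D_def)
  moreover have "frag_cmul (int N) \<xi> = D - nq (int N)"
    by (rule poly_mapping_eqI) (simp add: D_def lookup_minus algebra_simps)
  ultimately have "N \<le> 0" using reduced_degree_le[OF D _ E(1,2)] E(3) N by simp
  with N show False by simp
qed

end

lemma weight_eq_0_iff: "degree_zero X \<Longrightarrow> weight X = 0 \<longleftrightarrow> X \<sim> 0"
proof
  assume "degree_zero X" "weight X = 0"
  then have "theta 0 X" using theta_iff_weight by simp
  then show "X \<sim> 0" using effective_degree_0 by (auto simp: theta_def)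
qed (use weight_cong in fastforce)

lemma weight_periodic:
  assumes "frag_cmul (int N) X \<sim> 0"
  shows "weight (frag_cmul (int (s * N + r)) X) = weight (frag_cmul (int r) X)"
proof (induction s)
  case (Suc s)
  have "frag_cmul (int (Suc s * N + r)) X = frag_cmul (int N) X + frag_cmul (int (s * N + r)) X"
    by (simp flip: frag_cmul_distrib add: algebra_simps)
  also have "\<dots> \<sim> 0 + frag_cmul (int (s * N + r)) X"
    using assms by (rule lin_add) simp
  finally show ?case using Suc.IH weight_cong by simp
qed simp

lemma weight_reflect:
  assumes X: "degree_zero X" and N: "frag_cmul (int N) X \<sim> 0" and r: "r \<le> N"
  shows "weight (frag_cmul (int (N - r)) X) = weight (frag_cmul (int r) X)"
proof -
  have "frag_cmul (int (N - r)) X = frag_cmul (int N) X - frag_cmul (int r) X"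
    using r by (simp add: of_nat_diff frag_cmul_diff_distrib)
  also have "\<dots> \<sim> 0 - frag_cmul (int r) X"
    using N by (rule lin_diff) simp
  finally have "weight (frag_cmul (int (N - r)) X) = weight (- frag_cmul (int r) X)"
    using weight_cong by simp
  also have "\<dots> = weight (frag_cmul (int r) X)"
    using X by (intro weight_minus degree_zero_closed)
  finally show ?thesis .
qed

lemma branch_point_order_two:
  assumes "p \<in> places \<iota>" "p \<circ> \<sigma> = p"
  shows "frag_cmul (int 2) (frag_of p - frag_of q) \<sim> 0"
proof -
  have "fibre p = frag_cmul 2 (frag_of p)"
    unfolding fibre_def assms(2) using frag_cmul_distrib[of 1 1 "frag_of p"] by simp
  moreover have "frag_cmul (int 2) (frag_of p - frag_of q) = frag_cmul 2 (frag_of p) - nq 2"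
    by (rule poly_mapping_eqI) (simp add: lookup_minus)
  ultimately show ?thesis
    using fibre_lin[OF assms(1)] by (simp add: linearly_equivalent_def)
qed

end

section \<open>The multiplication profile\<close>

theorem proposition4p9:
  fixes \<iota> :: "'k::{alg_closed_field, field_char_0} \<Rightarrow> 'f::field"
    and \<gamma> :: nat
    and p q :: "'f \<Rightarrow> int"
    and \<epsilon> :: "nat \<Rightarrow> nat"
  assumes curve: "function_field \<iota>"
    and hyp: "hyperelliptic \<iota>"
    and genus: "has_genus \<iota> \<gamma>" "\<gamma> \<ge> 2"
    and q: "weierstrass_point \<iota> \<gamma> q"
    and p: "p \<in> places \<iota>"
    and pq: "divisor_class \<iota> (frag_of p - frag_of q) \<in> Theta0 \<iota> q 1"
    and profile: "\<forall>j\<ge>1. \<epsilon> j = mult_profile \<iota> \<gamma> q (divisor_class \<iota> (frag_of p - frag_of q)) j"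
  shows
    "(\<epsilon> 1 = 1 \<and> (\<forall>j\<ge>1. 0 \<le> \<epsilon> j \<and> \<epsilon> j \<le> \<gamma>)) \<and>
     (\<forall>i\<ge>1. \<forall>j\<ge>1. \<epsilon> i + \<epsilon> j \<ge> \<epsilon> (i + j)) \<and>
     (\<forall>j\<ge>1. \<bar>int (\<epsilon> j) - int (\<epsilon> (j + 1))\<bar> \<le> 1 \<and>
             (\<epsilon> j < \<gamma> \<longrightarrow> \<epsilon> j \<noteq> \<epsilon> (j + 1))) \<and>
     (\<forall>j\<ge>1. \<epsilon> (j + 1) = \<epsilon> j + 1 \<and> \<epsilon> j + 1 = \<epsilon> (j + 2) + 1 \<longrightarrow> \<epsilon> j = 0 \<and> \<epsilon> 2 = 0) \<and>
     (\<forall>N\<ge>1. \<epsilon> N = 0 \<and> (\<forall>m. 1 \<le> m \<and> m < N \<longrightarrow> \<epsilon> m \<noteq> 0) \<longrightarrow>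
        (N = 2 \<or> N \<ge> 2 * \<gamma> + 1) \<and>
        (\<forall>r s. 1 \<le> r \<and> r < N \<longrightarrow> \<epsilon> (s * N + r) = \<epsilon> r \<and> \<epsilon> (N - r) = \<epsilon> r))"
proof -
  interpret function_field \<iota> by (rule curve)
  \<comment> \<open>A coordinate \<open>x\<close> of degree two with a pole at \<open>q\<close>.\<close>
  have q_place: "q \<in> places \<iota>" using q by (simp add: weierstrass_point_def)
  obtain z where z: "z \<notin> range \<iota>" "has_ext_degree (simple_subfield \<iota> z) 2"
    using hyp by (auto simp: hyperelliptic_def transcendental_over_iff)
  obtain x where x: "x \<notin> range \<iota>" "has_ext_degree (simple_subfield \<iota> x) 2" "q x < 0"
  proof (cases "q z < 0")
    case True
    with z show ?thesis by (rule that)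
  next
    case False
    obtain w H \<tau> where "quadratic_cover \<iota> z w H \<tau>" using exists_quadratic_cover[OF z] by blast
    from quadratic_cover.finite_or_infinite_place[OF this q_place] False
    obtain a where a: "val_ge q 1 (z - \<iota> a)" by blast
    have "z - \<iota> a \<noteq> 0" using z(1) by auto
    then have "q (inverse (z - \<iota> a)) < 0" using a place_inverse[OF q_place] by (simp add: val_ge_def)
    moreover have "has_ext_degree (simple_subfield \<iota> (inverse (z - \<iota> a))) 2"
      using z(2) by (simp only: simple_subfield_mobius)
    ultimately show ?thesis using that mobius_nonconst[OF z(1)] by blast
  qed
  obtain y G \<sigma> where cover: "quadratic_cover \<iota> x y G \<sigma>" "\<And>a. Polynomial.order a G \<le> 1"
    using exists_quadratic_cover[OF x(1,2)] by blast
  interpret hyperelliptic_jacobian \<iota> x y G \<sigma> q \<gamma>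
    by (intro hyperelliptic_jacobian.intro pointed_cover.intro cover(1) pointed_cover_axioms.intro
        hyperelliptic_jacobian_axioms.intro cover(2) q_place x(3) genus(1) q)
  define X where "X = frag_of p - frag_of q"
  define \<omega> where "\<omega> j = weight (frag_cmul (int j) X)" for j
  have X: "degree_zero X" using p by (simp add: X_def degree_zero_closed)
  then have jX: "degree_zero (frag_cmul n X)" for n by (rule degree_zero_closed)
  have \<epsilon>: "\<epsilon> j = \<omega> j" if "1 \<le> j" for j
    using profile that mult_profile_eq_weight[OF X] by (simp add: X_def \<omega>_def)
  have \<omega>_0: "\<omega> 0 = 0" by (simp add: \<omega>_def)
  have \<omega>_1: "\<omega> 1 = 1"
    using pq theta_iff_weight[OF X] by (simp add: Theta0_def Theta_iff X_def \<omega>_def)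
  have p_q: "p \<noteq> q" using \<omega>_1 by (auto simp: \<omega>_def X_def)
  have Suc_X: "frag_cmul (int (j + 1)) X = frag_cmul (int j) X + X" for j
    by (simp add: frag_cmul_distrib)
  have Suc2_X: "frag_cmul (int (j + 2)) X = frag_cmul (int j) X + X + X" for j
    using Suc_X[of j] Suc_X[of "j + 1"] by simp
  have le: "\<omega> j \<le> \<gamma>" for j
    unfolding \<omega>_def using jX by (rule weight_le_genus)
  have add: "\<omega> (i + j) \<le> \<omega> i + \<omega> j" for i j
    unfolding \<omega>_def using weight_add[OF jX jX] by (simp add: frag_cmul_distrib)
  have step: "\<bar>int (\<omega> j) - int (\<omega> (j + 1))\<bar> \<le> 1" for j
  proof -
    have "frag_cmul (int j) X = frag_cmul (int (j + 1)) X + - X" by (simp only: Suc_X) simp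
    then have "\<omega> j \<le> \<omega> (j + 1) + weight (- X)"
      unfolding \<omega>_def using weight_add[OF jX degree_zero_closed(3)[OF X]] by metis
    moreover have "weight (- X) = 1"
      using \<omega>_1 weight_minus[OF X] by (simp add: \<omega>_def)
    ultimately show ?thesis using add[of j 1] \<omega>_1 by linarith
  qed
  have neq: "\<omega> j \<noteq> \<omega> (j + 1)" if "\<omega> j < \<gamma>" for j
    using weight_step_neq[OF p p_q jX] that unfolding \<omega>_def Suc_X unfolding X_def by metis
  have period: "\<omega> (s * N + r) = \<omega> r" if "\<omega> N = 0" for s N r
    unfolding \<omega>_def using that weight_eq_0_iff[OF jX] by (intro weight_periodic) (simp add: \<omega>_def)
  have reflect: "\<omega> (N - r) = \<omega> r" if "\<omega> N = 0" "r \<le> N" for N r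
    unfolding \<omega>_def using that weight_eq_0_iff[OF jX] by (intro weight_reflect[OF X]) (simp_all add: \<omega>_def)
  have branch: "\<omega> 2 = 0" if "p \<circ> \<sigma> = p"
    using weight_cong[OF branch_point_order_two[OF p that]] by (simp add: \<omega>_def X_def)
  \<comment> \<open>At a branch point \<open>\<omega>\<close> alternates between \<open>1\<close> and \<open>0\<close>, so \<open>\<omega>\<close> goes up only from even \<open>j\<close>.\<close>
  have peak: "\<omega> j = 0 \<and> \<omega> 2 = 0" if up: "\<omega> (j + 1) = \<omega> j + 1" and down: "\<omega> (j + 2) = \<omega> j" for j
  proof (cases "p \<circ> \<sigma> = p")
    case True
    note zero = branch[OF True]
    have "even j"
    proof (rule ccontr)
      assume "odd j"
      then obtain k where "j = 2 * k + 1" by (elim oddE)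
      then have "\<omega> (j + 1) = \<omega> ((k + 1) * 2 + 0)" by (simp add: mult.commute)
      then show False using period[OF zero, of "k + 1" 0] \<omega>_0 up by simp
    qed
    then obtain k where "j = k * 2 + 0" by (elim evenE) (simp add: mult.commute)
    then show ?thesis using period[OF zero, of k 0] \<omega>_0 zero by simp
  next
    case False
    then show ?thesis
      using weight_no_peak[OF p p_q jX False, of "int j"] up down
      unfolding \<omega>_def Suc_X Suc2_X unfolding X_def by metis
  qed
  have order: "N = 2 \<or> 2 * \<gamma> + 1 \<le> N"
    if N: "1 \<le> N" "\<omega> N = 0" "\<And>m. 1 \<le> m \<Longrightarrow> m < N \<Longrightarrow> \<omega> m \<noteq> 0" for N
  proof (cases "p \<circ> \<sigma> = p")
    case True
    have "N \<le> 2" using N(3)[of 2] branch[OF True] by fastforce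
    moreover have "N \<noteq> 1" using N(2) \<omega>_1 by auto
    ultimately show ?thesis using N(1) by linarith
  next
    case False
    then show ?thesis
      using weight_multiple_nonzero[OF p p_q False N(1)] N(2) by (fastforce simp: \<omega>_def X_def)
  qed
  have "\<epsilon> 1 = 1 \<and> (\<forall>j\<ge>1. 0 \<le> \<epsilon> j \<and> \<epsilon> j \<le> \<gamma>)"
    using \<epsilon> \<omega>_1 le by simp
  moreover have "\<forall>i\<ge>1. \<forall>j\<ge>1. \<epsilon> i + \<epsilon> j \<ge> \<epsilon> (i + j)"
    using \<epsilon> add by simp
  moreover have "\<forall>j\<ge>1. \<bar>int (\<epsilon> j) - int (\<epsilon> (j + 1))\<bar> \<le> 1 \<and> (\<epsilon> j < \<gamma> \<longrightarrow> \<epsilon> j \<noteq> \<epsilon> (j + 1))"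
    using \<epsilon> step neq by simp
  moreover have "\<forall>j\<ge>1. \<epsilon> (j + 1) = \<epsilon> j + 1 \<and> \<epsilon> j + 1 = \<epsilon> (j + 2) + 1 \<longrightarrow> \<epsilon> j = 0 \<and> \<epsilon> 2 = 0"
  proof (intro allI impI)
    fix j :: nat
    assume j: "1 \<le> j" and "\<epsilon> (j + 1) = \<epsilon> j + 1 \<and> \<epsilon> j + 1 = \<epsilon> (j + 2) + 1"
    then have "\<epsilon> (j + 1) = \<epsilon> j + 1" "\<epsilon> (j + 2) = \<epsilon> j" by linarith+
    moreover have "\<epsilon> j = \<omega> j" "\<epsilon> (j + 1) = \<omega> (j + 1)" "\<epsilon> (j + 2) = \<omega> (j + 2)" "\<epsilon> 2 = \<omega> 2"
      using j by (intro \<epsilon>; simp)+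
    ultimately show "\<epsilon> j = 0 \<and> \<epsilon> 2 = 0" using peak[of j] by metis
  qed
  moreover have "\<forall>N\<ge>1. \<epsilon> N = 0 \<and> (\<forall>m. 1 \<le> m \<and> m < N \<longrightarrow> \<epsilon> m \<noteq> 0) \<longrightarrow>
        (N = 2 \<or> N \<ge> 2 * \<gamma> + 1) \<and>
        (\<forall>r s. 1 \<le> r \<and> r < N \<longrightarrow> \<epsilon> (s * N + r) = \<epsilon> r \<and> \<epsilon> (N - r) = \<epsilon> r)"
  proof (intro allI impI, elim conjE)
    fix N :: nat
    assume N: "1 \<le> N" "\<epsilon> N = 0" "\<forall>m. 1 \<le> m \<and> m < N \<longrightarrow> \<epsilon> m \<noteq> 0"
    then have "\<omega> N = 0" "\<And>m. 1 \<le> m \<Longrightarrow> m < N \<Longrightarrow> \<omega> m \<noteq> 0" using \<epsilon> by auto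
    with N(1) order period reflect \<epsilon>
    show "(N = 2 \<or> N \<ge> 2 * \<gamma> + 1) \<and>
        (\<forall>r s. 1 \<le> r \<and> r < N \<longrightarrow> \<epsilon> (s * N + r) = \<epsilon> r \<and> \<epsilon> (N - r) = \<epsilon> r)"
      by auto
  qed
  ultimately show ?thesis by (elim conjE) (intro conjI)
qed

end
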